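(* Let $n\ge 1$ and $1\le k\le n$ be integers. Let $\mathcal F_{n,k}$ be the set of non-crossing forests on $n$ vertices with $k$ components, and let the cyclic group $\langle\rho\rangle$ of order $n$ act on $\mathcal F_{n,k}$ by rotation (the generator $\rho$ rotating by $2\pi/n$). Let $$f_{n,k}(q)=\frac{1}{[2n-k]_q}\begin{bmatrix} n\\ k-1\end{bmatrix}_q\begin{bmatrix} 3n-2k-1\\ n-k\end{bmatrix}_q.$$ Then the triple $(\mathcal F_{n,k},\langle\rho\rangle,f_{n,k}(q))$ exhibits the cyclic sieving phenomenon; that is, $f_{n,k}(q)$ is a polynomial in $q$ with nonnegative integer coefficients, and for every $c\in\langle\rho\rangle$ we have $f_{n,k}(\omega_{o(c)})=|\{\Phi\in\mathcal F_{n,k}: c(\Phi)=\Phi\}|$, where $o(c)$ is the order of $c$ and $\omega_{o(c)}$ is a primitive $o(c)$-th root of unity.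
   Context: A non-crossing graph on $n$ vertices is a graph whose vertices are $n$ fixed points arranged on a circle (labelled $1,\dots,n$ clockwise) and whose edges are straight line segments that do not cross; a non-crossing forest is an acyclic non-crossing graph. The $q$-analogues are $[m]_q=1+q+\dots+q^{m-1}=\frac{1-q^m}{1-q}$, $[m]_q!=[m]_q[m-1]_q\cdots[1]_q$, and $\begin{bmatrix} m\\ j\end{bmatrix}_q=\frac{[m]_q!}{[j]_q![m-j]_q!}$ (zero if $j<0$ or $j>m$). A triple $(X,C,X(q))$ with $X$ a finite set, $C$ a finite cyclic group acting on $X$, and $X(q)$ a polynomial with nonnegative integer coefficients exhibits the cyclic sieving phenomenon if $X(\omega_{o(c)})$ equals the number of fixed points of $c$ on $X$ for all $c\in C$. *)

theory Defs
  imports Complex_Main "HOL-Computational_Algebra.Polynomial"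
begin

section \<open>q-analogues as polynomials in q\<close>

definition qint :: "nat \<Rightarrow> 'a::comm_ring_1 poly" where
  "qint m = (\<Sum>i<m. monom 1 i)"

definition qfact :: "nat \<Rightarrow> 'a::comm_ring_1 poly" where
  "qfact m = (\<Prod>i\<in>{1..m}. qint i)"

text \<open>q-binomial coefficient [m]!/([j]![m-j]!), zero if j > m (j<0 impossible for nat).\<close>
definition qbinom :: "nat \<Rightarrow> nat \<Rightarrow> 'a::field poly" where
  "qbinom m j = (if j \<le> m then qfact m div (qfact j * qfact (m - j)) else 0)"

section \<open>Non-crossing forests on vertices 0,...,n-1 placed clockwise on a circle\<close>

text \<open>A graph is a set of edges, each edge a 2-element subset of the vertex set.\<close>
definition is_graph :: "nat \<Rightarrow> nat set set \<Rightarrow> bool" where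
  "is_graph n F \<longleftrightarrow> (\<forall>e\<in>F. e \<subseteq> {0..<n} \<and> card e = 2)"

text \<open>Two chords {a,b}, {c,d} with a<c<b<d cross.\<close>
definition non_crossing :: "nat set set \<Rightarrow> bool" where
  "non_crossing F \<longleftrightarrow>
     \<not> (\<exists>a b c d. {a, b} \<in> F \<and> {c, d} \<in> F \<and> a < c \<and> c < b \<and> b < d)"

text \<open>A cycle: distinct vertices v_0,...,v_{m-1}, m \<ge> 3, consecutive (cyclically) ones adjacent.\<close>
definition has_cycle :: "nat set set \<Rightarrow> bool" where
  "has_cycle F \<longleftrightarrow> (\<exists>vs. length vs \<ge> 3 \<and> distinct vs \<and>
      (\<forall>i < length vs. {vs ! i, vs ! ((i + 1) mod length vs)} \<in> F))"

definition adj :: "nat set set \<Rightarrow> (nat \<times> nat) set" where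
  "adj F = {(u, v). {u, v} \<in> F}"

text \<open>Number of connected components (isolated vertices count as components).\<close>
definition num_components :: "nat \<Rightarrow> nat set set \<Rightarrow> nat" where
  "num_components n F = card ({0..<n} // ((adj F)\<^sup>*))"

definition nc_forests :: "nat \<Rightarrow> nat \<Rightarrow> nat set set set" where
  "nc_forests n k = {F. is_graph n F \<and> non_crossing F \<and> \<not> has_cycle F
                        \<and> num_components n F = k}"

text \<open>Rotation by j steps, i.e. the group element rho^j.\<close>
definition rotate_graph :: "nat \<Rightarrow> nat \<Rightarrow> nat set set \<Rightarrow> nat set set" where
  "rotate_graph n j F = (\<lambda>e. (\<lambda>i. (i + j) mod n) ` e) ` F"

end

theory Submission
  imports Defs "HOL-Computational_Algebra.Formal_Power_Series"
begin

text \<open>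
  Acyclicity gives \<open>e = n - k\<close> edges, so forests are counted by edges. Cutting a forest on an interval
  at the gaps that no edge passes over splits it into indecomposable forests, and an indecomposable
  forest is determined by the longest edge at its first vertex and the pieces below and beyond it. With
  \<open>A\<close> the series of all forests and \<open>zU\<close> that of the indecomposable ones this reads
  \<open>A = 1 + zAU\<close>, \<open>U = 1 + yzAU\<^sup>3\<close>, from which Lagrange's formula gives all coefficients.

  Let \<open>n = dm\<close> and consider the forests invariant under rotation by \<open>m\<close>. Without a diameter, some gap
  is not covered by the short arc of an edge, since otherwise the visible edges close up to a cycle
  around the centre; cutting at the first such gap shows that the forest is a rotated \<open>d\<close>-fold copy of
  a forest on \<open>m\<close> points, and there are \<open>(e + 1) A\<^bsub>m,e\<^esub>\<close> of them. A diameter is possible only for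
  \<open>d = 2\<close>; it splits the forest into two congruent halves.

  On the other side, \<open>f\<close> is written as an explicit integer combination of products of Gaussian
  coefficients, which the \<open>q\<close>-Lucas theorem evaluates at roots of unity. Nonnegativity holds because
  \<open>f [2n-k]\<close> is palindromic and unimodal, the latter by the \<open>sl\<^sub>2\<close>-argument on pairs of subsets.
\<close>

section \<open>Gaussian binomial coefficients and roots of unity\<close>

text \<open>Why the quotient is made explicit: if \<open>d \<ge> 2\<close> divides \<open>n\<close>
  and \<open>k\<close>, both \<open>[2n-k]\<close> and the numerator vanish at a primitive
  \<open>d\<close>-th root of unity, so a value needs a division-free expression; it also gives
  integer coefficients. Where the cube comes from: below the longest edge \<open>{a, j}\<close> at
  the first vertex only decomposable forests may stand, since an indecomposable one already connects
  \<open>a\<close> with \<open>j\<close>. Their series is \<open>A - 1 - zU = A(zU)^2\<close>; the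
  piece beyond \<open>j\<close> adds one more \<open>U\<close>. Where the factor
  \<open>e + 1\<close> comes from: a forest on \<open>m\<close> points yields one invariant forest
  for each rotation that brings 0 no further back than its last cut, that is, as many as its last
  indecomposable block has vertices. Summed over all forests this is a coefficient of
  \<open>z (zU)' A\<close>, and implicit differentiation identifies that series with
  \<open>A - 1 + y dA/dy\<close>. The numerator is a product of two Gaussian coefficients. Its
  coefficients count subsets of two consecutive chains, so that a single action with weights
  blocking the passage between the chains proves unimodality of the whole product.\<close>

definition qn :: "'a::comm_ring_1 \<Rightarrow> nat \<Rightarrow> 'a" where
  "qn q m = (\<Sum>i<m. q ^ i)"

text \<open>The q-Pascal rule instead of a quotient of q-factorials: it makes sense in every
  commutative ring, also at roots of unity where the factorials vanish, and ring homomorphisms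
  preserve it.\<close>

fun gauss :: "'a::comm_ring_1 \<Rightarrow> nat \<Rightarrow> nat \<Rightarrow> 'a" where
  "gauss q n 0 = 1"
| "gauss q 0 (Suc k) = 0"
| "gauss q (Suc n) (Suc k) = gauss q n k + q ^ Suc k * gauss q n (Suc k)"

lemma qn_0 [simp]: "qn q 0 = 0" and qn_1 [simp]: "qn q (Suc 0) = 1"
  by (simp_all add: qn_def)

lemma qn_add: "qn q (a + b) = qn q a + q ^ a * qn q b"
  by (induction b) (simp_all add: qn_def algebra_simps power_add)

lemma qn_geometric: "(1 - q) * qn q m = 1 - q ^ m"
  by (simp add: qn_def one_diff_power_eq)

lemma gauss_eq_0: "n < k \<Longrightarrow> gauss q n k = 0"
  by (induction q n k rule: gauss.induct) auto

lemma gauss_same [simp]: "gauss q n n = 1"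
  by (induction n) (simp_all add: gauss_eq_0)

text \<open>In the induction step with \<open>k = j + 1\<close> both sides equal
  \<open>[n+1] * gauss q n (j+1)\<close>: write \<open>[n+1]\<close> as a sum split after
  \<open>j + 2\<close> resp. \<open>j + 1\<close> terms and use the induction hypothesis for
  \<open>j + 1\<close> resp. \<open>j\<close>.\<close>

lemma gauss_step: "k \<le> n \<Longrightarrow> qn q (Suc k) * gauss q n (Suc k) = qn q (n - k) * gauss q n k"
proof (induction n arbitrary: k)
  case 0
  then show ?case by simp
next
  case (Suc n)
  show ?case
  proof (cases k)
    case 0
    have "gauss q (Suc n) (Suc 0) = qn q (Suc n)"
      using Suc.IH[of 0] qn_add[of q 1 n] by simp
    then show ?thesis using 0 by simp
  next
    case (Suc j)
    show ?thesis
    proof (cases "j = n")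
      case True
      then show ?thesis using Suc by (simp add: gauss_eq_0)
    next
      case False
      then have j: "Suc j \<le> n" using Suc Suc.prems by simp
      have s1: "qn q (Suc (Suc j)) * gauss q n (Suc (Suc j)) = qn q (n - Suc j) * gauss q n (Suc j)"
        using Suc.IH[of "Suc j"] j by simp
      have s2: "qn q (Suc j) * gauss q n (Suc j) = qn q (n - j) * gauss q n j"
        using Suc.IH[of j] j by simp
      have "qn q (Suc (Suc j)) * gauss q (Suc n) (Suc (Suc j))
          = (qn q (Suc (Suc j)) + q ^ Suc (Suc j) * qn q (n - Suc j)) * gauss q n (Suc j)"
        using s1 by (simp add: algebra_simps)
      also have "\<dots> = qn q (Suc n) * gauss q n (Suc j)"
        using qn_add[of q "Suc (Suc j)" "n - Suc j"] j by simp
      also have "\<dots> = (qn q (Suc j) + q ^ Suc j * qn q (n - j)) * gauss q n (Suc j)"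
        using qn_add[of q "Suc j" "n - j"] j by simp
      also have "\<dots> = qn q (n - j) * gauss q (Suc n) (Suc j)"
        using s2 by (simp add: algebra_simps)
      finally show ?thesis using Suc by simp
    qed
  qed
qed

lemma gauss_absorb:
  assumes "k \<le> n"
  shows "qn q (Suc k) * gauss q (Suc n) (Suc k) = qn q (Suc n) * gauss q n k"
proof -
  have "qn q (Suc k) * gauss q (Suc n) (Suc k)
      = (qn q (Suc k) + q ^ Suc k * qn q (n - k)) * gauss q n k"
    using gauss_step[OF assms, of q] by (simp add: algebra_simps)
  then show ?thesis using qn_add[of q "Suc k" "n - k"] assms by simp
qed

text \<open>Dividing the product of the two Gaussian coefficients by \<open>[2n - k]\<close> explicitly: use
  \<open>1 = [n-k+1] - q [n-k]\<close> together with the absorption identities.\<close>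
definition forest_q :: "'a::comm_ring_1 \<Rightarrow> nat \<Rightarrow> nat \<Rightarrow> 'a" where
  "forest_q q n k =
     (let G' = (if k < n then gauss q (3*n - 2*k - 1) (n - k - 1) else 0) in
      gauss q (n - 1) (k - 1) * (gauss q (3*n - 2*k - 1) (n - k) - q ^ n * G')
        - q * gauss q n (k - 1) * G')"

lemma forest_q_mult:
  assumes "1 \<le> k" "k \<le> n"
  shows "forest_q q n k * qn q (2*n - k) = gauss q n (k - 1) * gauss q (3*n - 2*k - 1) (n - k)"
proof -
  define G where "G = gauss q (3*n - 2*k - 1) (n - k)"
  define G' where "G' = (if k < n then gauss q (3*n - 2*k - 1) (n - k - 1) else 0)"
  define a where "a = gauss q n (k - 1)"
  define b where "b = gauss q (n - 1) (k - 1)"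
  \<comment> \<open>Here \<open>[2n-k]\<close> becomes a factor: it is the difference of the entries
    \<open>3n-2k-1\<close> and \<open>n-k-1\<close> of \<open>G'\<close>.\<close>
  have G: "qn q (n - k) * G = qn q (2*n - k) * G'"
  proof (cases "k < n")
    case True
    then have "n - k = Suc (n - k - 1)" "3*n - 2*k - 1 - (n - k - 1) = 2*n - k" by auto
    then show ?thesis
      using gauss_step[of "n - k - 1" "3*n - 2*k - 1" q] True by (auto simp: G_def G'_def)
  next
    case False
    then show ?thesis by (simp add: G'_def)
  qed
  have ab: "qn q (Suc (n - k)) * a = qn q n * b"
    using gauss_step[of "k - 1" n q] gauss_absorb[of "k - 1" "n - 1" q] assms
    by (simp add: a_def b_def Suc_diff_le)
  have D: "qn q (2*n - k) = qn q n + q ^ n * qn q (n - k)"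
    using qn_add[of q n "n - k"] assms by (simp add: mult_2)
  have M: "qn q (Suc (n - k)) = 1 + q * qn q (n - k)"
    using qn_add[of q 1 "n - k"] by simp
  have "forest_q q n k * qn q (2*n - k)
      = b * (G * qn q (2*n - k) - q ^ n * (qn q (2*n - k) * G')) - q * a * (qn q (2*n - k) * G')"
    by (simp add: forest_q_def Let_def G_def G'_def a_def b_def algebra_simps)
  also have "\<dots> = G * (qn q n * b) - q * a * (qn q (n - k) * G)"
    unfolding G[symmetric] unfolding D by (simp add: algebra_simps)
  also have "\<dots> = a * G"
    unfolding ab[symmetric] M by (simp add: algebra_simps)
  finally show ?thesis by (simp add: a_def G_def)
qed

lemma gauss_hom:
  assumes "\<And>x y. h (x + y) = h x + h y" "\<And>x y. h (x * y) = h x * h y" "h 1 = 1"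
  shows "h (gauss q n k) = gauss (h q) n k"
proof -
  have "h 0 = 0" using assms(1)[of 0 0] by simp
  moreover have "h (q ^ j) = h q ^ j" for j by (induction j) (simp_all add: assms)
  ultimately show ?thesis
    by (induction q n k rule: gauss.induct) (simp_all add: assms del: power_Suc)
qed

text \<open>The map \<open>h\<close> is left abstract because it is used twice: for passing to
  rational coefficients and for evaluating an integer polynomial at a complex number.\<close>

lemma forest_q_hom:
  assumes "\<And>x y. h (x + y) = h x + h y" "\<And>x y. h (x * y) = h x * h y" "h 1 = 1"
  shows "h (forest_q q n k) = forest_q (h q) n k"
proof -
  have h0: "h 0 = 0" using assms(1)[of 0 0] by simp
  have hp: "h (q ^ j) = h q ^ j" for j by (induction j) (simp_all add: assms)
  have hm: "h (x - y) = h x - h y" for x y using assms(1)[of "x - y" y] by simp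
  show ?thesis
    by (simp add: forest_q_def Let_def h0 hp hm assms(2) gauss_hom[OF assms])
qed

section \<open>Comparison with the definitions by q-factorials\<close>

lemma map_poly_of_int_add:
  "map_poly of_int (p + q) = (map_poly of_int p + map_poly of_int q :: 'a::comm_ring_1 poly)"
  by (rule poly_eqI) (simp add: coeff_map_poly)

lemma map_poly_of_int_mult:
  "map_poly of_int (p * q) = (map_poly of_int p * map_poly of_int q :: 'a::comm_ring_1 poly)"
  by (rule poly_eqI) (simp add: coeff_map_poly coeff_mult)

lemma qint_eq_qn: "qint m = qn (monom 1 1) m"
  by (simp add: qint_def qn_def monom_power)

lemma qint_nonzero:
  assumes "m > 0"
  shows "(qint m :: 'a::comm_ring_1 poly) \<noteq> 0"
proof -
  have "coeff (qint m :: 'a poly) 0 = (\<Sum>i<m. if i = 0 then 1 else 0)"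
    by (simp add: qint_def coeff_sum)
  also have "\<dots> = 1" using assms by simp
  finally show ?thesis by auto
qed

lemma qfact_nonzero: "(qfact m :: 'a::idom poly) \<noteq> 0"
  by (auto simp: qfact_def qint_nonzero)

lemma qfact_Suc: "qfact (Suc m) = qfact m * qint (Suc m)"
  by (simp add: qfact_def mult.commute)

lemma gauss_mult_qfact:
  "k \<le> n \<Longrightarrow> gauss (monom 1 1) n k * (qfact k * qfact (n - k)) = (qfact n :: 'a::comm_ring_1 poly)"
proof (induction k arbitrary: n)
  case 0
  then show ?case by (simp add: qfact_def)
next
  case (Suc k)
  then obtain m where n: "n = Suc m" "k \<le> m" by (cases n) auto
  have "gauss (monom 1 1) n (Suc k) * (qfact (Suc k) * qfact (n - Suc k))
      = (qn (monom 1 1) (Suc k) * gauss (monom 1 1) n (Suc k)) * (qfact k * qfact (m - k) :: 'a poly)"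
    by (simp add: n qfact_Suc qint_eq_qn mult_ac)
  also have "\<dots> = qint n * (gauss (monom 1 1) m k * (qfact k * qfact (m - k)))"
    using gauss_absorb[OF n(2), of "monom (1::'a) 1"] n by (simp add: qint_eq_qn mult_ac)
  also have "\<dots> = qfact n"
    using Suc.IH[OF n(2)] n by (simp add: qfact_Suc mult.commute)
  finally show ?case .
qed

lemma qbinom_eq_gauss: "qbinom n k = gauss (monom 1 1) n k"
proof (cases "k \<le> n")
  case True
  have "(qfact k * qfact (n - k) :: 'a poly) \<noteq> 0" by (simp add: qfact_nonzero)
  then show ?thesis
    using True gauss_mult_qfact[OF True, where 'a = 'a]
    by (metis nonzero_mult_div_cancel_right qbinom_def)
next
  case False
  then show ?thesis by (simp add: qbinom_def gauss_eq_0)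
qed

section \<open>Values at roots of unity\<close>

definition primitive_root :: "nat \<Rightarrow> 'a::field \<Rightarrow> bool" where
  "primitive_root d \<omega> \<longleftrightarrow> 0 < d \<and> \<omega> ^ d = 1 \<and> (\<forall>m. 0 < m \<and> m < d \<longrightarrow> \<omega> ^ m \<noteq> 1)"

lemma primitive_root_neq_1:
  assumes "primitive_root d \<omega>" "2 \<le> d"
  shows "\<omega> \<noteq> 1"
proof
  assume "\<omega> = 1"
  then have "\<omega> ^ 1 = 1" by simp
  moreover have "0 < (1::nat) \<and> 1 < d" using assms(2) by simp
  ultimately show False using assms(1) unfolding primitive_root_def by blast
qed

lemma primitive_root_power_mod:
  assumes "primitive_root d \<omega>"
  shows "\<omega> ^ a = \<omega> ^ (a mod d)"
proof -
  have "\<omega> ^ a = (\<omega> ^ d) ^ (a div d) * \<omega> ^ (a mod d)"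
    by (simp flip: power_mult power_add)
  then show ?thesis using assms by (simp add: primitive_root_def)
qed

lemma qn_root_nonzero:
  assumes "primitive_root d \<omega>" "\<not> d dvd b"
  shows "qn \<omega> b \<noteq> 0"
proof
  assume "qn \<omega> b = 0"
  then have "\<omega> ^ b = 1" using qn_geometric[of \<omega> b] by simp
  then have "\<omega> ^ (b mod d) = 1" using primitive_root_power_mod[OF assms(1)] by simp
  moreover have "b mod d < d" "0 < b mod d" using assms by (auto simp: primitive_root_def mod_greater_zero_iff_not_dvd)
  ultimately show False using assms(1) by (auto simp: primitive_root_def)
qed

text \<open>In the absorption identity \<open>[b] * gauss d b = [d] * gauss (d-1) (b-1)\<close> the
  factor \<open>[d]\<close> vanishes while \<open>[b]\<close> does not.\<close>

lemma gauss_root_order: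
  assumes "primitive_root d \<omega>" "0 < b" "b < d"
  shows "gauss \<omega> d b = 0"
proof -
  have "\<omega> \<noteq> 1" using primitive_root_neq_1[OF assms(1)] assms(2,3) by linarith
  then have d0: "qn \<omega> d = 0"
    using qn_geometric[of \<omega> d] assms(1) by (simp add: primitive_root_def)
  have "qn \<omega> b * gauss \<omega> d b = qn \<omega> d * gauss \<omega> (d - 1) (b - 1)"
    using gauss_absorb[of "b - 1" "d - 1" \<omega>] assms by simp
  moreover have "qn \<omega> b \<noteq> 0"
    using assms by (intro qn_root_nonzero) (auto dest: dvd_imp_le)
  ultimately show ?thesis using d0 by simp
qed

text \<open>The analogue of \<open>(1+x)^(a+d) = (1+x)^a (1+x^d)\<close>: of row \<open>d\<close>
  only the two ends survive, and \<open>\<omega> ^ d = 1\<close> lets the Pascal rule carry this to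
  the later rows.\<close>

lemma gauss_root_period:
  assumes "primitive_root d \<omega>"
  shows "gauss \<omega> (a + d) b = gauss \<omega> a b + (if d \<le> b then gauss \<omega> a (b - d) else 0)"
proof (induction a arbitrary: b)
  case 0
  have "d > 0" using assms by (simp add: primitive_root_def)
  consider "b = 0" | "0 < b" "b < d" | "b = d" | "b > d" by linarith
  then show ?case
    using \<open>d > 0\<close> gauss_root_order[OF assms, of b] by cases (auto simp: gauss_eq_0)
next
  case (Suc a)
  have "d > 0" using assms by (simp add: primitive_root_def)
  show ?case
  proof (cases b)
    case 0
    then show ?thesis using \<open>d > 0\<close> by simp
  next
    case (Suc c)
    show ?thesis
    proof (cases "d \<le> c")
      case True
      then obtain x where x: "c = d + x" using le_Suc_ex by blast
      have "\<omega> ^ (d + x) = \<omega> ^ x"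
        using assms by (simp add: power_add primitive_root_def)
      then show ?thesis
        using Suc.IH[of c] Suc.IH[of "Suc c"] x Suc by (simp add: Suc_diff_le algebra_simps)
    next
      case False
      then show ?thesis
        using Suc.IH[of c] Suc.IH[of "Suc c"] Suc assms
        by (auto simp: algebra_simps primitive_root_def dest: le_antisym)
    qed
  qed
qed

text \<open>By \<open>gauss_root_period\<close>, adding \<open>d\<close> to the upper entry is an
  ordinary Pascal step on the quotient \<open>b div d\<close> and leaves the remainder
  \<open>b mod d\<close> alone.\<close>

lemma q_Lucas:
  assumes "primitive_root d \<omega>" "r < d"
  shows "gauss \<omega> (d * a + r) b = of_nat (a choose (b div d)) * gauss \<omega> r (b mod d)"
proof (induction a arbitrary: b)
  case 0
  show ?case
  proof (cases "b < d")
    case False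
    then have "b div d \<noteq> 0" using assms(2) by (simp add: div_eq_0_iff)
    then show ?thesis using False assms(2) by (simp add: gauss_eq_0 binomial_eq_0)
  qed simp
next
  case (Suc a)
  have "gauss \<omega> (d * Suc a + r) b = gauss \<omega> (d * a + r + d) b"
    by (simp add: algebra_simps)
  also have "\<dots> = of_nat (Suc a choose (b div d)) * gauss \<omega> r (b mod d)"
  proof (cases "d \<le> b")
    case True
    have "b div d = Suc ((b - d) div d)" "b mod d = (b - d) mod d"
      using True assms(2) by (auto simp: div_if le_mod_geq)
    then show ?thesis
      using True by (simp add: gauss_root_period[OF assms(1)] Suc.IH distrib_right)
  next
    case False
    then show ?thesis by (simp add: gauss_root_period[OF assms(1)] Suc.IH)
  qed
  finally show ?case .
qed

lemma gauss_1: "gauss 1 n k = of_nat (n choose k)"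
  by (induction "1::'a" n k rule: gauss.induct) (simp_all add: add.commute)

text \<open>Since \<open>[2n-k]\<close> vanishes at \<omega>, \<open>forest_q_mult\<close> says
  nothing here; the value is read off from the explicit form of \<open>forest_q\<close>.\<close>

lemma forest_q_root_dvd:
  assumes \<omega>: "primitive_root d \<omega>" and d: "2 \<le> d" and a: "1 \<le> a" "a \<le> m"
  shows "forest_q \<omega> (d * m) (d * a) = of_nat ((m - 1) choose (a - 1)) *
     (of_nat ((3*m - 2*a - 1) choose (m - a)) -
      of_nat (if a < m then (3*m - 2*a - 1) choose (m - a - 1) else 0))"
proof -
  have lt: "d - 1 < d" using d by simp
  \<comment> \<open>The entries diminished by one have remainder \<open>d - 1\<close>, so each
    remainder factor of \<open>q_Lucas\<close> in \<open>g1\<close>, \<open>g2\<close>,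
    \<open>g3\<close> is \<open>gauss (d-1) 0\<close> or \<open>gauss (d-1) (d-1)\<close>, hence
    1.\<close>
  have pred: "d * x - 1 = d * (x - 1) + (d - 1)" if "x \<ge> 1" for x
    using that d by (cases x) auto
  have pd: "(d * x - 1) div d = x - 1" "(d * x - 1) mod d = d - 1" if "x \<ge> 1" for x
    unfolding pred[OF that] using lt by (simp_all only: div_mult_self4 mod_mult_self4 div_less mod_less)
  have lt': "d * a < d * m \<longleftrightarrow> a < m" using d by simp
  have x1: "3*m - 2*a \<ge> 1" "1 \<le> m" using a by linarith+
  have "3 * (d * m) - 2 * (d * a) - 1 = d * (3*m - 2*a) - 1"
    by (simp only: diff_mult_distrib2 mult.left_commute)
  then have N: "3 * (d * m) - 2 * (d * a) - 1 = d * (3*m - 2*a - 1) + (d - 1)"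
    unfolding pred[OF x1(1)] .
  have M: "d * m - d * a = d * (m - a)" by (simp only: diff_mult_distrib2)
  have g1: "gauss \<omega> (d * m - 1) (d * a - 1) = of_nat ((m - 1) choose (a - 1))"
    unfolding pred[OF x1(2)] q_Lucas[OF \<omega> lt] pd[OF a(1)] by simp
  have g2: "gauss \<omega> (3 * (d * m) - 2 * (d * a) - 1) (d * m - d * a)
      = of_nat ((3*m - 2*a - 1) choose (m - a))"
    unfolding N M q_Lucas[OF \<omega> lt] using d by simp
  have g3: "gauss \<omega> (3 * (d * m) - 2 * (d * a) - 1) (d * m - d * a - 1)
      = of_nat ((3*m - 2*a - 1) choose (m - a - 1))" if "a < m"
  proof -
    have "1 \<le> m - a" using that by simp
    then show ?thesis unfolding N M q_Lucas[OF \<omega> lt] by (simp only: pd gauss_same mult_1_right)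
  qed
  \<comment> \<open>The second summand of \<open>forest_q\<close> drops out: remainder 0 above,
    remainder \<open>d - 1 > 0\<close> below.\<close>
  have g4: "gauss \<omega> (d * m) (d * a - 1) = 0"
  proof -
    have "gauss \<omega> (d * m + 0) (d * a - 1) = of_nat (m choose ((d * a - 1) div d)) * gauss \<omega> 0 ((d * a - 1) mod d)"
      using d by (intro q_Lucas[OF \<omega>]) simp
    moreover have "gauss \<omega> 0 ((d * a - 1) mod d) = 0"
      unfolding pd[OF a(1)] using d by (intro gauss_eq_0) simp
    ultimately show ?thesis by simp
  qed
  have "\<omega> ^ (d * m) = 1" using \<omega> by (simp add: power_mult primitive_root_def)
  then show ?thesis
    unfolding forest_q_def Let_def g1 g2 g4 lt' using g3 by (cases "a < m") simp_all
qed

text \<open>Now \<open>[2n-k]\<close> is nonzero at \<omega>, so a vanishing numerator suffices. Its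
  first factor vanishes unless \<open>k\<close> is 1 modulo \<open>d\<close>; in that case
  \<open>d \<ge> 3\<close>, and the second factor has remainder \<open>d - 3\<close> above and
  \<open>d - 1\<close> below.\<close>

lemma forest_q_root_not_dvd:
  assumes \<omega>: "primitive_root d \<omega>" and k: "1 \<le> k" "k \<le> d * m" "\<not> d dvd k"
    and d: "\<not> (d = 2 \<and> odd k)"
  shows "forest_q \<omega> (d * m) k = 0"
proof -
  have d2: "2 \<le> d" using \<omega> k by (cases "d = 0 \<or> d = 1") (auto simp: primitive_root_def)
  have "\<not> d dvd 2 * (d * m) - k"
  proof
    assume "d dvd 2 * (d * m) - k"
    then have "d dvd 2 * (d * m) - (2 * (d * m) - k)" by (rule dvd_diff_nat[rotated]) simp
    moreover have "2 * (d * m) - (2 * (d * m) - k) = k" using k by simp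
    ultimately show False using k by simp
  qed
  then have nz: "qn \<omega> (2 * (d * m) - k) \<noteq> 0" by (rule qn_root_nonzero[OF \<omega>])
  have "gauss \<omega> (d * m) (k - 1) * gauss \<omega> (3 * (d * m) - 2*k - 1) (d * m - k) = 0"
  proof (cases "d dvd k - 1")
    case False
    then have "gauss \<omega> (d * m) (k - 1) = 0"
      using q_Lucas[OF \<omega>, of 0 m "k - 1"] d2 by (simp add: gauss_eq_0 mod_greater_zero_iff_not_dvd)
    then show ?thesis by simp
  next
    case True
    then obtain a where a: "k - 1 = d * a" by blast
    then have ka: "k = d * a + 1" using k by simp
    have "d \<noteq> 2" using d ka by auto
    then have d3: "3 \<le> d" using d2 by simp
    have am: "a < m"
    proof (rule ccontr)
      assume "\<not> a < m"
      then have "d * m \<le> d * a" by simp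
      then show False using k(2) ka by linarith
    qed
    then obtain x where x: "m = Suc (a + x)" using less_iff_Suc_add by auto
    obtain d' where d': "d = d' + 3" using d3 le_Suc_ex[OF d3] by (auto simp: add.commute)
    have "d * m = (d * x + (d - 1)) + k" unfolding x ka d' by (simp add: algebra_simps)
    then have M: "d * m - k = d * x + (d - 1)" by simp
    have "3 * (d * m) = (d * (3 * x + a + 2) + (d - 3)) + 1 + 2 * k"
      unfolding x ka d' by (simp add: algebra_simps)
    then have N: "3 * (d * m) - 2 * k - 1 = d * (3 * x + a + 2) + (d - 3)" by simp
    have "(d * m - k) mod d = d - 1" unfolding M using d3 by (simp only: mod_mult_self4) simp
    then have "gauss \<omega> (3 * (d * m) - 2*k - 1) (d * m - k) = 0"
      unfolding N using q_Lucas[OF \<omega>, of "d - 3" "3 * x + a + 2" "d * m - k"] d3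
      by (simp add: gauss_eq_0)
    then show ?thesis by simp
  qed
  then have "forest_q \<omega> (d * m) k * qn \<omega> (2 * (d * m) - k) = 0"
    unfolding forest_q_mult[OF k(1,2)] .
  then show ?thesis using nz by simp
qed

text \<open>At -1 an odd q-integer equals 1, so the value is that of the numerator.\<close>

lemma forest_q_root_2_odd:
  assumes \<omega>: "primitive_root 2 \<omega>" and am: "a < m"
  shows "forest_q \<omega> (2 * m) (2 * a + 1) = of_nat ((m choose a) * ((3*m - 2*a - 2) choose (m - a - 1)))"
proof -
  have D: "qn \<omega> (2 * (2 * m) - (2 * a + 1)) = 1"
  proof -
    have e: "2 * (2 * m) - (2 * a + 1) = 2 * (2 * m - a - 1) + 1" using am by linarith
    have p: "\<omega> ^ (2 * (2 * m) - (2 * a + 1)) = \<omega>"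
      unfolding e power_add power_mult using \<omega> by (simp add: primitive_root_def)
    have "\<omega> \<noteq> 1" using primitive_root_neq_1[OF \<omega>] by simp
    then show ?thesis
      using qn_geometric[of \<omega> "2 * (2 * m) - (2 * a + 1)"] unfolding p by simp
  qed
  have M: "2 * m - (2 * a + 1) = 2 * (m - a - 1) + 1" using am by linarith
  have N: "3 * (2 * m) - 2 * (2 * a + 1) - 1 = 2 * (3*m - 2*a - 2) + 1" using am by presburger
  have 1: "gauss \<omega> (3 * (2 * m) - 2 * (2 * a + 1) - 1) (2 * m - (2 * a + 1)) = of_nat ((3*m - 2*a - 2) choose (m - a - 1))"
    unfolding M N by (subst q_Lucas[OF \<omega>]) simp_all
  have 2: "gauss \<omega> (2 * m) (2 * a + 1 - 1) = of_nat (m choose a)"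
    using q_Lucas[OF \<omega>, of 0 m "2 * a"] by simp
  have "1 \<le> 2 * a + 1" "2 * a + 1 \<le> 2 * m" using am by linarith+
  from forest_q_mult[OF this, of \<omega>] show ?thesis
    unfolding D 1 2 by simp
qed

lemma forest_q_1:
  assumes "1 \<le> k" "k \<le> n"
  shows "forest_q 1 n k * of_nat (2*n - k) = of_nat ((n choose (k - 1)) * ((3*n - 2*k - 1) choose (n - k)))"
  using forest_q_mult[OF assms, of 1] by (simp add: gauss_1 qn_def)

section \<open>Unimodality and nonnegativity\<close>

text \<open>Elimination: equation \<open>a\<close> is solved for the unknown \<open>b0\<close>. The
  result supplies a nonzero kernel vector for an operator from a larger level to a smaller
  one.\<close>

lemma homogeneous_system:
  fixes M :: "'a \<Rightarrow> 'b \<Rightarrow> 'c::field"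
  assumes "finite A" "finite B" "card A < card B"
  shows "\<exists>v. (\<exists>b\<in>B. v b \<noteq> 0) \<and> (\<forall>a\<in>A. (\<Sum>b\<in>B. M a b * v b) = 0)"
  using assms
proof (induction A arbitrary: B M rule: finite_induct)
  case empty
  then obtain b where "b \<in> B" by fastforce
  then show ?case by (intro exI[of _ "\<lambda>_. 1"]) auto
next
  case (insert a A)
  show ?case
  proof (cases "\<forall>b\<in>B. M a b = 0")
    case True
    then show ?thesis using insert.IH[of B M] insert.prems insert.hyps by auto
  next
    case False
    then obtain b0 where b0: "b0 \<in> B" "M a b0 \<noteq> 0" by blast
    define B' where "B' = B - {b0}"
    have B': "finite B'" "b0 \<notin> B'" "B = insert b0 B'" using insert.prems b0 by (auto simp: B'_def)
    have "card A < card B'" using insert.prems insert.hyps b0 by (simp add: B'_def)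
    from insert.IH[OF B'(1) this, of "\<lambda>i b. M i b - M i b0 * M a b / M a b0"]
    obtain v where v: "\<exists>b\<in>B'. v b \<noteq> 0"
      "\<And>i. i \<in> A \<Longrightarrow> (\<Sum>b\<in>B'. (M i b - M i b0 * M a b / M a b0) * v b) = 0" by blast
    define w where "w = v(b0 := - (\<Sum>b\<in>B'. M a b * v b) / M a b0)"
    have wv: "(\<Sum>b\<in>B'. M i b * w b) = (\<Sum>b\<in>B'. M i b * v b)" for i
      using B' by (intro sum.cong) (auto simp: w_def)
    have wB: "(\<Sum>b\<in>B. M i b * w b) = M i b0 * w b0 + (\<Sum>b\<in>B'. M i b * v b)" for i
      unfolding B'(3) using B' by (simp add: wv)
    have "(\<Sum>b\<in>B. M i b * w b) = 0" if "i \<in> insert a A" for i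
    proof (cases "i = a")
      case True
      then show ?thesis unfolding wB using b0 by (simp add: w_def)
    next
      case False
      have "(\<Sum>b\<in>B'. (M i b - M i b0 * M a b / M a b0) * v b)
          = (\<Sum>b\<in>B'. M i b * v b) - M i b0 / M a b0 * (\<Sum>b\<in>B'. M a b * v b)"
        by (simp add: sum_distrib_left sum_subtractf algebra_simps)
      then show ?thesis unfolding wB using v(2)[of i] False that by (simp add: w_def)
    qed
    moreover have "\<exists>b\<in>B. w b \<noteq> 0" using v(1) B' by (auto simp: w_def)
    ultimately show ?thesis by blast
  qed
qed

section \<open>Raising and lowering operators on subsets\<close>

definition swap_adjacent :: "nat \<Rightarrow> nat set \<Rightarrow> nat set" where
  "swap_adjacent i S = {x. (if x = i then Suc i else if x = Suc i then i else x) \<in> S}"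

lemma swap_adjacent_iff: "x \<in> swap_adjacent i S \<longleftrightarrow> (if x = i then Suc i else if x = Suc i then i else x) \<in> S"
  by (simp add: swap_adjacent_def)

lemma swap_adjacent_involution [simp]: "swap_adjacent i (swap_adjacent i S) = S"
  by (rule set_eqI) (auto simp: swap_adjacent_iff split: if_splits)

lemma swap_adjacent_commute: "Suc i < k \<or> Suc k < i \<Longrightarrow> swap_adjacent i (swap_adjacent k S) = swap_adjacent k (swap_adjacent i S)"
  by (rule set_eqI) (auto simp: swap_adjacent_iff)

lemma swap_adjacent_Pow: "i < N \<Longrightarrow> S \<subseteq> {..N} \<Longrightarrow> swap_adjacent i S \<subseteq> {..N}"
  by (auto simp: swap_adjacent_iff split: if_splits)

lemma bij_swap_adjacent: "i < N \<Longrightarrow> bij_betw (swap_adjacent i) (Pow {..N}) (Pow {..N})"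
  by (rule bij_betw_byWitness[where f' = "swap_adjacent i"]) (auto dest: swap_adjacent_Pow)

text \<open>The move of an element from \<open>i\<close> to \<open>i + 1\<close>, written as a
  matrix entry at its target; \<open>down\<close> is the opposite move. Both carry the same factor
  \<open>s i\<close>, later the square root of a chain weight: this makes them adjoint, and their
  commutator contains the weights themselves.\<close>

definition up :: "(nat \<Rightarrow> real) \<Rightarrow> nat \<Rightarrow> (nat set \<Rightarrow> real) \<Rightarrow> nat set \<Rightarrow> real" where
  "up s i v T = (if i \<notin> T \<and> Suc i \<in> T then s i * v (swap_adjacent i T) else 0)"

definition down :: "(nat \<Rightarrow> real) \<Rightarrow> nat \<Rightarrow> (nat set \<Rightarrow> real) \<Rightarrow> nat set \<Rightarrow> real" where
  "down s i v S = (if i \<in> S \<and> Suc i \<notin> S then s i * v (swap_adjacent i S) else 0)"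

lemma up_down_adjoint:
  assumes "i < N"
  shows "(\<Sum>T\<in>Pow {..N}. u T * up s i v T) = (\<Sum>S\<in>Pow {..N}. down s i u S * v S)"
proof -
  have "(\<Sum>T\<in>Pow {..N}. u T * up s i v T) = (\<Sum>S\<in>Pow {..N}. u (swap_adjacent i S) * up s i v (swap_adjacent i S))"
    by (rule sum.reindex_bij_betw[OF bij_swap_adjacent[OF assms], symmetric])
  also have "\<dots> = (\<Sum>S\<in>Pow {..N}. down s i u S * v S)"
    by (rule sum.cong) (auto simp: up_def down_def swap_adjacent_iff)
  finally show ?thesis .
qed

text \<open>For adjacent \<open>i\<close> and \<open>k\<close> both composites vanish, as one move
  demands an element where the other demands a hole. Distant moves commute. Only the diagonal terms
  remain.\<close>

lemma up_down_commutator: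
  "down s i (up s k v) S - up s k (down s i v) S
     = (if i = k then (s i)\<^sup>2 * (of_bool (i \<in> S) - of_bool (Suc i \<in> S)) * v S else 0)"
proof -
  consider "i = k" | "k = Suc i" | "i = Suc k" | "Suc i < k \<or> Suc k < i" by linarith
  then show ?thesis
  proof cases
    case 4
    then have "swap_adjacent i (swap_adjacent k S) = swap_adjacent k (swap_adjacent i S)" by (rule swap_adjacent_commute)
    with 4 show ?thesis by (auto simp: up_def down_def swap_adjacent_iff)
  qed (auto simp: up_def down_def swap_adjacent_iff power2_eq_square)
qed

text \<open>With \<open>U\<close>, \<open>D\<close> the sums of the operators: \<open>|Uv|^2 = <DUv,
  v> = <UDv, v> + <[D,U]v, v> = |Dv|^2 + <Hv, v>\<close>, where \<open>H = [D,U]\<close> is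
  diagonal.\<close>

lemma norm_up_down:
  "(\<Sum>T\<in>Pow {..N}. (\<Sum>i<N. up s i v T)\<^sup>2) = (\<Sum>S\<in>Pow {..N}. (\<Sum>i<N. down s i v S)\<^sup>2)
     + (\<Sum>S\<in>Pow {..N}. (\<Sum>i<N. (s i)\<^sup>2 * (of_bool (i \<in> S) - of_bool (Suc i \<in> S))) * (v S)\<^sup>2)"
proof -
  let ?P = "Pow {..N}"
  have sq: "(\<Sum>T\<in>?P. (\<Sum>i<N. g i T)\<^sup>2) = (\<Sum>i<N. \<Sum>k<N. \<Sum>T\<in>?P. g i T * g k T)" for g :: "nat \<Rightarrow> nat set \<Rightarrow> real"
    by (subst sum.swap[of _ ?P], subst sum.swap[of _ ?P])
      (simp add: power2_eq_square sum_product)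
  have "(\<Sum>T\<in>?P. (\<Sum>i<N. up s i v T)\<^sup>2) = (\<Sum>i<N. \<Sum>k<N. \<Sum>T\<in>?P. up s k v T * up s i v T)"
    unfolding sq by (simp add: mult.commute)
  also have "\<dots> = (\<Sum>i<N. \<Sum>k<N. \<Sum>S\<in>?P. down s i (up s k v) S * v S)"
    by (intro sum.cong refl up_down_adjoint) auto
  also have "\<dots> = (\<Sum>i<N. \<Sum>k<N. \<Sum>S\<in>?P. v S * up s k (down s i v) S
      + (if i = k then (s i)\<^sup>2 * (of_bool (i \<in> S) - of_bool (Suc i \<in> S)) * (v S)\<^sup>2 else 0))"
  proof (intro sum.cong refl)
    fix i k S
    have "down s i (up s k v) S = up s k (down s i v) S
        + (if i = k then (s i)\<^sup>2 * (of_bool (i \<in> S) - of_bool (Suc i \<in> S)) * v S else 0)"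
      using up_down_commutator[of s i k v S] by (simp add: algebra_simps)
    then show "down s i (up s k v) S * v S = v S * up s k (down s i v) S
      + (if i = k then (s i)\<^sup>2 * (of_bool (i \<in> S) - of_bool (Suc i \<in> S)) * (v S)\<^sup>2 else 0)"
      by (simp add: algebra_simps power2_eq_square)
  qed
  also have "\<dots> = (\<Sum>i<N. \<Sum>k<N. \<Sum>S\<in>?P. v S * up s k (down s i v) S)
      + (\<Sum>i<N. \<Sum>k<N. \<Sum>S\<in>?P. if i = k then (s i)\<^sup>2 * (of_bool (i \<in> S) - of_bool (Suc i \<in> S)) * (v S)\<^sup>2 else 0)"
    by (simp only: sum.distrib)
  also have "(\<Sum>i<N. \<Sum>k<N. \<Sum>S\<in>?P. v S * up s k (down s i v) S)
      = (\<Sum>i<N. \<Sum>k<N. \<Sum>S\<in>?P. down s k v S * down s i v S)"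
    by (intro sum.cong refl up_down_adjoint) auto
  also have "\<dots> = (\<Sum>S\<in>?P. (\<Sum>i<N. down s i v S)\<^sup>2)"
    unfolding sq by (simp add: mult.commute)
  also have "(\<Sum>i<N. \<Sum>k<N. \<Sum>S\<in>?P. if i = k then (s i)\<^sup>2 * (of_bool (i \<in> S) - of_bool (Suc i \<in> S)) * (v S)\<^sup>2 else 0)
      = (\<Sum>i<N. \<Sum>S\<in>?P. (s i)\<^sup>2 * (of_bool (i \<in> S) - of_bool (Suc i \<in> S)) * (v S)\<^sup>2)"
  proof (rule sum.cong[OF refl])
    fix i assume i: "i \<in> {..<N}"
    have "(\<Sum>k<N. \<Sum>S\<in>?P. if i = k then (s i)\<^sup>2 * (of_bool (i \<in> S) - of_bool (Suc i \<in> S)) * (v S)\<^sup>2 else 0)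
      = (\<Sum>k<N. if i = k then \<Sum>S\<in>?P. (s i)\<^sup>2 * (of_bool (i \<in> S) - of_bool (Suc i \<in> S)) * (v S)\<^sup>2 else 0)"
      by (rule sum.cong) auto
    then show "(\<Sum>k<N. \<Sum>S\<in>?P. if i = k then (s i)\<^sup>2 * (of_bool (i \<in> S) - of_bool (Suc i \<in> S)) * (v S)\<^sup>2 else 0)
      = (\<Sum>S\<in>?P. (s i)\<^sup>2 * (of_bool (i \<in> S) - of_bool (Suc i \<in> S)) * (v S)\<^sup>2)" using i by simp
  qed
  also have "\<dots> = (\<Sum>S\<in>?P. (\<Sum>i<N. (s i)\<^sup>2 * (of_bool (i \<in> S) - of_bool (Suc i \<in> S))) * (v S)\<^sup>2)"
    by (subst sum.swap) (simp add: sum_distrib_right)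
  finally show ?thesis .
qed

text \<open>Pairs of a \<open>j1\<close>-subset of a chain of length \<open>N1\<close> and a \<open>j2\<close>-subset of a chain of length \<open>N2\<close>,
  the second chain being placed after the first one.\<close>
definition pair_level :: "nat \<Rightarrow> nat \<Rightarrow> nat \<Rightarrow> nat \<Rightarrow> nat \<Rightarrow> nat set set" where
  "pair_level N1 j1 N2 j2 r = {S. S \<subseteq> {..<N1 + N2} \<and> card (S \<inter> {..<N1}) = j1 \<and>
     card (S \<inter> {N1..<N1 + N2}) = j2 \<and> \<Sum>S = r}"

text \<open>The weights of the \<open>sl\<^sub>2\<close>-action on the two chains; they vanish exactly at the last element of
  each chain, which blocks moves between the chains.\<close>
definition chain_weight :: "nat \<Rightarrow> nat \<Rightarrow> nat \<Rightarrow> real" where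
  "chain_weight N1 N2 i = (if i < N1 then (real i + 1) * (real N1 - 1 - real i)
     else (real i - real N1 + 1) * (real N1 + real N2 - 1 - real i))"

lemma finite_pair_level: "finite (pair_level N1 j1 N2 j2 r)"
  by (rule finite_subset[of _ "Pow {..<N1 + N2}"]) (auto simp: pair_level_def)

text \<open>\<open>H\<close> is a scalar on each level. Summation by parts leaves the differences of
  consecutive weights, which on either chain are linear in \<open>i\<close> with slope -2; so only
  the two cardinalities and the element sum matter.\<close>

lemma sum_chain_weight:
  assumes "S \<in> pair_level N1 j1 N2 j2 r"
  shows "(\<Sum>i<N1 + N2. chain_weight N1 N2 i * (of_bool (i \<in> S) - of_bool (Suc i \<in> S)))
    = real j1 * (real N1 - 1) + real j2 * (real N2 - 1 + 2 * real N1) - 2 * real r"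
proof -
  let ?w = "chain_weight N1 N2" and ?N = "N1 + N2"
  have S: "S \<subseteq> {..<?N}" "card (S \<inter> {..<N1}) = j1" "card (S \<inter> {N1..<?N}) = j2" "\<Sum>S = r"
    using assms by (auto simp: pair_level_def)
  have fin: "finite S" using S(1) finite_subset by blast
  \<comment> \<open>The value 0 at the left end agrees with the product formula continued to
    position -1.\<close>
  let ?w' = "\<lambda>i. if i = 0 then 0 else ?w (i - 1)"
  have 1: "(\<Sum>i<?N. ?w i * of_bool (i \<in> S)) = (\<Sum>i\<in>S. ?w i)"
    using S(1) by (simp add: sum.If_cases of_bool_def Int_absorb1 if_distrib[of "\<lambda>x. _ * x"] cong: if_cong)
  have "(\<Sum>i<?N. ?w i * of_bool (Suc i \<in> S)) = (\<Sum>i\<in>Suc ` {..<?N}. ?w' i * of_bool (i \<in> S))"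
    by (rule sum.reindex_cong[of Suc, symmetric]) auto
  also have "\<dots> = (\<Sum>i\<in>{..?N}. ?w' i * of_bool (i \<in> S))"
    by (rule sum.mono_neutral_left) (auto simp: image_iff less_Suc_eq_le[symmetric] gr0_conv_Suc)
  also have "\<dots> = (\<Sum>i\<in>S. ?w' i * of_bool (i \<in> S))"
    using S(1) by (intro sum.mono_neutral_right) auto
  also have "\<dots> = (\<Sum>i\<in>S. ?w' i)" by (rule sum.cong) auto
  finally have 2: "(\<Sum>i<?N. ?w i * of_bool (Suc i \<in> S)) = (\<Sum>i\<in>S. ?w' i)" .
  have "(\<Sum>i<?N. ?w i * (of_bool (i \<in> S) - of_bool (Suc i \<in> S))) = (\<Sum>i\<in>S. ?w i - ?w' i)"
    unfolding right_diff_distrib sum_subtractf 1 2 ..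
  also have "\<dots> = (\<Sum>i\<in>S. (if i < N1 then real N1 - 1 else real N2 - 1 + 2 * real N1) - 2 * real i)"
  proof (rule sum.cong[OF refl])
    fix i assume "i \<in> S"
    then show "?w i - ?w' i = (if i < N1 then real N1 - 1 else real N2 - 1 + 2 * real N1) - 2 * real i"
    proof (cases i)
      case (Suc j)
      then show ?thesis by (cases "N1 = Suc j") (auto simp: chain_weight_def algebra_simps)
    qed (auto simp: chain_weight_def algebra_simps)
  qed
  also have "\<dots> = (\<Sum>i\<in>S. if i < N1 then real N1 - 1 else real N2 - 1 + 2 * real N1) - 2 * real r"
    unfolding sum_subtractf by (simp add: S(4)[symmetric] sum_distrib_left)
  also have "(\<Sum>i\<in>S. if i < N1 then real N1 - 1 else real N2 - 1 + 2 * real N1)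
      = real j1 * (real N1 - 1) + real j2 * (real N2 - 1 + 2 * real N1)"
  proof -
    have "S \<inter> {i. i < N1} = S \<inter> {..<N1}" "S \<inter> - {i. i < N1} = S \<inter> {N1..<?N}" using S(1) by auto
    then show ?thesis using fin S(2,3) by (simp add: sum.If_cases)
  qed
  finally show ?thesis .
qed

lemma swap_adjacent_conv: "i \<notin> T \<Longrightarrow> Suc i \<in> T \<Longrightarrow> T = insert (Suc i) (swap_adjacent i T - {i}) \<and> i \<in> swap_adjacent i T \<and> Suc i \<notin> swap_adjacent i T"
  by (auto simp: swap_adjacent_iff split: if_splits)

lemma pair_level_up:
  assumes T: "i \<notin> T" "Suc i \<in> T" and S: "swap_adjacent i T \<in> pair_level N1 j1 N2 j2 r"
    and i: "i < N1 + N2" "chain_weight N1 N2 i \<noteq> 0"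
  shows "T \<in> pair_level N1 j1 N2 j2 (Suc r)"
proof -
  let ?S = "swap_adjacent i T"
  have c: "T = insert (Suc i) (?S - {i})" "i \<in> ?S" "Suc i \<notin> ?S" using swap_adjacent_conv[OF T] by auto
  have iN1: "Suc i \<noteq> N1" using i by (auto simp: chain_weight_def)
  have "Suc i \<noteq> N1 + N2"
  proof
    assume e: "Suc i = N1 + N2"
    then have "real i = real N1 + real N2 - 1" by linarith
    then show False using i(2) e iN1 by (auto simp: chain_weight_def split: if_splits)
  qed
  note iN = iN1 this
  have S': "?S \<subseteq> {..<N1 + N2}" "card (?S \<inter> {..<N1}) = j1" "card (?S \<inter> {N1..<N1 + N2}) = j2" "\<Sum>?S = r"
    using S by (auto simp: pair_level_def)
  have fin: "finite ?S" using S'(1) finite_subset by blast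
  have "\<Sum>?S = i + \<Sum>(?S - {i})" using fin c(2) by (rule sum.remove)
  moreover have "\<Sum>T = \<Sum>(insert (Suc i) (?S - {i}))" by (rule arg_cong[OF c(1)])
  moreover have "\<Sum>(insert (Suc i) (?S - {i})) = Suc i + \<Sum>(?S - {i})"
    using fin c(3) by simp
  ultimately have sum: "\<Sum>T = Suc r" using S'(4) by simp
  have sub: "T \<subseteq> {..<N1 + N2}" by (subst c(1)) (use S' iN i in auto)
  have "card (T \<inter> {..<N1}) = j1 \<and> card (T \<inter> {N1..<N1 + N2}) = j2"
  proof (cases "i < N1")
    case True
    then have "T \<inter> {..<N1} = insert (Suc i) (?S \<inter> {..<N1} - {i})"
      by (subst c(1)) (use iN in auto)
    moreover have "T \<inter> {N1..<N1 + N2} = ?S \<inter> {N1..<N1 + N2}"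
      by (subst c(1)) (use iN True in auto)
    moreover have "card (insert (Suc i) (?S \<inter> {..<N1} - {i})) = card (?S \<inter> {..<N1})"
    proof -
      have "i \<in> ?S \<inter> {..<N1}" using c(2) \<open>i < N1\<close> by simp
      then have "0 < card (?S \<inter> {..<N1})" using fin by (auto simp: card_gt_0_iff)
      then show ?thesis using fin c(2,3) \<open>i < N1\<close> by simp
    qed
    ultimately show ?thesis using S' by simp
  next
    case False
    then have "T \<inter> {N1..<N1 + N2} = insert (Suc i) (?S \<inter> {N1..<N1 + N2} - {i})"
      by (subst c(1)) (use iN i in auto)
    moreover have "T \<inter> {..<N1} = ?S \<inter> {..<N1}"
      by (subst c(1)) (use iN False in auto)
    moreover have "card (insert (Suc i) (?S \<inter> {N1..<N1 + N2} - {i})) = card (?S \<inter> {N1..<N1 + N2})"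
    proof -
      have "i \<in> ?S \<inter> {N1..<N1 + N2}" using c(2) \<open>\<not> i < N1\<close> i(1) by simp
      then have "0 < card (?S \<inter> {N1..<N1 + N2})" using fin by (auto simp: card_gt_0_iff)
      then show ?thesis using fin c(2,3) \<open>\<not> i < N1\<close> i(1) by simp
    qed
    ultimately show ?thesis using S' by simp
  qed
  then show ?thesis using sub sum by (simp add: pair_level_def)
qed

text \<open>If level \<open>r\<close> were the larger one, \<open>U\<close> would kill a nonzero
  \<open>v\<close> supported there. With \<open>H\<close> acting as a scalar \<open>c > 0\<close>
  the norm identity becomes \<open>0 = |Dv|^2 + c |v|^2\<close>, a contradiction.\<close>

lemma card_pair_level_mono:
  assumes pos: "real j1 * (real N1 - 1) + real j2 * (real N2 - 1 + 2 * real N1) - 2 * real r > 0"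
  shows "card (pair_level N1 j1 N2 j2 r) \<le> card (pair_level N1 j1 N2 j2 (Suc r))"
proof (rule ccontr)
  let ?L = "pair_level N1 j1 N2 j2" and ?N = "N1 + N2"
  let ?c = "real j1 * (real N1 - 1) + real j2 * (real N2 - 1 + 2 * real N1) - 2 * real r"
  define s where "s i = sqrt (chain_weight N1 N2 i)" for i
  assume "\<not> card (?L r) \<le> card (?L (Suc r))"
  then have "card (?L (Suc r)) < card (?L r)" by simp
  define M where "M T S = (\<Sum>i<?N. if i \<notin> T \<and> Suc i \<in> T \<and> swap_adjacent i T = S then s i else 0)" for T S
  obtain v0 where v0: "\<exists>S\<in>?L r. v0 S \<noteq> 0" "\<And>T. T \<in> ?L (Suc r) \<Longrightarrow> (\<Sum>S\<in>?L r. M T S * v0 S) = 0"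
    using homogeneous_system[OF finite_pair_level finite_pair_level \<open>card (?L (Suc r)) < card (?L r)\<close>, of M]
    by blast
  define v where "v S = (if S \<in> ?L r then v0 S else 0)" for S
  have s2: "(s i)\<^sup>2 = chain_weight N1 N2 i" if "i < ?N" for i
    using that unfolding s_def chain_weight_def by (intro real_sqrt_pow2) (auto intro!: mult_nonneg_nonneg)
  \<comment> \<open>The linear system covers the targets in level \<open>r + 1\<close>; no other
    target is reached from level \<open>r\<close> by a move of nonzero weight.\<close>
  have up0: "(\<Sum>i<?N. up s i v T) = 0" for T
  proof (cases "T \<in> ?L (Suc r)")
    case True
    have "(\<Sum>S\<in>?L r. M T S * v0 S) = (\<Sum>S\<in>?L r. \<Sum>i<?N. if i \<notin> T \<and> Suc i \<in> T \<and> swap_adjacent i T = S then s i * v S else 0)"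
      unfolding M_def sum_distrib_right by (intro sum.cong refl) (auto simp: v_def)
    also have "\<dots> = (\<Sum>i<?N. \<Sum>S\<in>?L r. if i \<notin> T \<and> Suc i \<in> T \<and> swap_adjacent i T = S then s i * v S else 0)"
      by (rule sum.swap)
    also have "\<dots> = (\<Sum>i<?N. up s i v T)"
    proof (rule sum.cong[OF refl])
      fix i
      show "(\<Sum>S\<in>?L r. if i \<notin> T \<and> Suc i \<in> T \<and> swap_adjacent i T = S then s i * v S else 0) = up s i v T"
      proof (cases "i \<notin> T \<and> Suc i \<in> T")
        case True
        then have "(\<Sum>S\<in>?L r. if i \<notin> T \<and> Suc i \<in> T \<and> swap_adjacent i T = S then s i * v S else 0)
            = (\<Sum>S\<in>?L r. if swap_adjacent i T = S then s i * v S else 0)" by (intro sum.cong) auto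
        also have "\<dots> = (if swap_adjacent i T \<in> ?L r then s i * v (swap_adjacent i T) else 0)"
          using finite_pair_level by (simp add: sum.delta')
        finally show ?thesis using True by (simp add: up_def v_def)
      qed (auto simp: up_def)
    qed
    finally show ?thesis using v0(2)[OF True] by simp
  next
    case False
    have "up s i v T = 0" if i: "i < ?N" for i
    proof (rule ccontr)
      assume "up s i v T \<noteq> 0"
      then have "i \<notin> T" "Suc i \<in> T" "s i \<noteq> 0" "swap_adjacent i T \<in> ?L r"
        by (auto simp: up_def v_def split: if_splits)
      moreover have "chain_weight N1 N2 i \<noteq> 0" using calculation(3) by (auto simp: s_def)
      ultimately show False using pair_level_up[of i T] i False by blast
    qed
    then show ?thesis by simp
  qed
  have key: "(\<Sum>i<?N. (s i)\<^sup>2 * (of_bool (i \<in> S) - of_bool (Suc i \<in> S))) * (v S)\<^sup>2 = ?c * (v S)\<^sup>2" for S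
  proof (cases "S \<in> ?L r")
    case True
    have "(\<Sum>i<?N. (s i)\<^sup>2 * (of_bool (i \<in> S) - of_bool (Suc i \<in> S)))
        = (\<Sum>i<?N. chain_weight N1 N2 i * (of_bool (i \<in> S) - of_bool (Suc i \<in> S)))"
      by (rule sum.cong) (auto simp: s2)
    then show ?thesis using sum_chain_weight[OF True] by simp
  qed (simp add: v_def)
  have "(\<Sum>S\<in>Pow {..?N}. (\<Sum>i<?N. down s i v S)\<^sup>2) + (\<Sum>S\<in>Pow {..?N}. ?c * (v S)\<^sup>2) = 0"
    using norm_up_down[where N = ?N and s = s and v = v] unfolding up0 key by simp
  moreover have "(\<Sum>S\<in>Pow {..?N}. (\<Sum>i<?N. down s i v S)\<^sup>2) \<ge> 0" by (intro sum_nonneg) auto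
  moreover have nn: "\<And>S. ?c * (v S)\<^sup>2 \<ge> 0" using pos by simp
  moreover have "(\<Sum>S\<in>Pow {..?N}. ?c * (v S)\<^sup>2) \<ge> 0" using nn by (intro sum_nonneg) auto
  ultimately have "(\<Sum>S\<in>Pow {..?N}. ?c * (v S)\<^sup>2) = 0" by linarith
  then have z: "\<forall>S\<in>Pow {..?N}. ?c * (v S)\<^sup>2 = 0"
    using nn by (subst (asm) sum_nonneg_eq_0_iff) auto
  obtain S where S: "S \<in> ?L r" "v0 S \<noteq> 0" using v0(1) by blast
  have "S \<in> Pow {..?N}" using S by (auto simp: pair_level_def)
  then have "?c * (v S)\<^sup>2 = 0" using z by blast
  then show False using pos S by (simp add: v_def)
qed

section \<open>Gaussian coefficients as generating functions of subset sums\<close>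

definition subset_sum :: "'a::comm_ring_1 \<Rightarrow> nat \<Rightarrow> nat \<Rightarrow> nat \<Rightarrow> 'a" where
  "subset_sum q a b j = (\<Sum>S | S \<subseteq> {a..<b} \<and> card S = j. q ^ \<Sum>S)"

lemma subset_sum_0: "subset_sum q a b 0 = 1"
proof -
  have "{S. S \<subseteq> {a..<b} \<and> card S = 0} = {{}}" by (auto dest: finite_subset)
  then show ?thesis by (simp add: subset_sum_def)
qed

lemma subset_sum_Suc:
  assumes "a < b"
  shows "subset_sum q a b (Suc j) = subset_sum q (Suc a) b (Suc j) + q ^ a * subset_sum q (Suc a) b j"
proof -
  let ?F = "\<lambda>a j. {S. S \<subseteq> {a..<b} \<and> card S = j}"
  have fin: "finite (?F a j)" for a j by (rule finite_subset[of _ "Pow {a..<b}"]) auto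
  have eq: "?F a (Suc j) = ?F (Suc a) (Suc j) \<union> insert a ` ?F (Suc a) j"
  proof (intro equalityI subsetI)
    fix S assume S: "S \<in> ?F a (Suc j)"
    then have fS: "finite S" using finite_subset by blast
    show "S \<in> ?F (Suc a) (Suc j) \<union> insert a ` ?F (Suc a) j"
    proof (cases "a \<in> S")
      case True
      have "S - {a} \<subseteq> {Suc a..<b}" using S by (auto simp: Suc_le_eq le_less)
      moreover have "card (S - {a}) = j" using S True fS by simp
      ultimately show ?thesis using True by (intro UnI2 image_eqI[of _ _ "S - {a}"]) auto
    next
      case False
      have "S \<subseteq> {Suc a..<b}"
      proof
        fix x assume x: "x \<in> S"
        then have "x \<noteq> a" "a \<le> x" "x < b" using S False by auto
        then show "x \<in> {Suc a..<b}" by simp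
      qed
      then show ?thesis using S by simp
    qed
  next
    fix S assume "S \<in> ?F (Suc a) (Suc j) \<union> insert a ` ?F (Suc a) j"
    then show "S \<in> ?F a (Suc j)"
    proof
      assume "S \<in> ?F (Suc a) (Suc j)"
      then show ?thesis by force
    next
      assume "S \<in> insert a ` ?F (Suc a) j"
      then obtain R where R: "S = insert a R" "R \<subseteq> {Suc a..<b}" "card R = j" by blast
      have "finite R" "a \<notin> R" using R finite_subset by auto
      then show ?thesis using R assms by force
    qed
  qed
  have disj: "?F (Suc a) (Suc j) \<inter> insert a ` ?F (Suc a) j = {}" by force
  have inj: "inj_on (insert a) (?F (Suc a) j)"
    by (rule inj_onI) (force dest: insert_ident[THEN iffD1, rotated 2])
  have s: "q ^ \<Sum>(insert a R) = q ^ a * q ^ \<Sum>R" if "R \<in> ?F (Suc a) j" for R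
  proof -
    have "finite R" "a \<notin> R" using that finite_subset by auto
    then show ?thesis by (simp add: power_add)
  qed
  have "subset_sum q a b (Suc j) = subset_sum q (Suc a) b (Suc j) + (\<Sum>S\<in>insert a ` ?F (Suc a) j. q ^ \<Sum>S)"
    unfolding subset_sum_def eq using disj fin by (intro sum.union_disjoint) auto
  also have "(\<Sum>S\<in>insert a ` ?F (Suc a) j. q ^ \<Sum>S) = (\<Sum>R\<in>?F (Suc a) j. q ^ a * q ^ \<Sum>R)"
    unfolding sum.reindex[OF inj] comp_def by (rule sum.cong[OF refl]) (rule s)
  finally show ?thesis by (simp add: subset_sum_def sum_distrib_left)
qed

text \<open>The exponent is the sum of \<open>a, ..., a+j-1\<close>. Distinguishing whether a subset
  contains \<open>a\<close> reproduces the q-Pascal rule.\<close>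

lemma subset_sum_gauss:
  "subset_sum q a (a + n) j = q ^ (a * j + (j choose 2)) * gauss q n j"
proof (induction n arbitrary: a j)
  case 0
  show ?case
  proof (cases j)
    case 0
    then show ?thesis by (simp add: subset_sum_0 binomial_eq_0)
  next
    case (Suc i)
    have "{S :: nat set. S \<subseteq> {a..<a + 0} \<and> card S = j} = {}" using Suc by auto
    then show ?thesis using Suc by (simp only: subset_sum_def) simp
  qed
next
  case (Suc n)
  show ?case
  proof (cases j)
    case 0
    then show ?thesis by (simp add: subset_sum_0 binomial_eq_0)
  next
    case (Suc i)
    have c: "Suc i choose 2 = (i choose 2) + i" by (simp add: numeral_2_eq_2)
    have IH: "subset_sum q (Suc a) (a + Suc n) j = q ^ (Suc a * j + (j choose 2)) * gauss q n j" for j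
      using Suc.IH[of "Suc a" j] by simp
    have "subset_sum q a (a + Suc n) (Suc i) = q ^ (Suc a * Suc i + (Suc i choose 2)) * gauss q n (Suc i)
        + q ^ a * (q ^ (Suc a * i + (i choose 2)) * gauss q n i)"
      using subset_sum_Suc[of a "a + Suc n" q i] unfolding IH by simp
    also have "\<dots> = q ^ (a * Suc i + (Suc i choose 2)) * (gauss q n i + q ^ Suc i * gauss q n (Suc i))"
      unfolding c by (simp add: algebra_simps power_add)
    finally show ?thesis using Suc by simp
  qed
qed

lemma sum_pair_family:
  fixes q :: "'a::comm_ring_1"
  shows "(\<Sum>S | S \<subseteq> {..<N1 + N2} \<and> card (S \<inter> {..<N1}) = j1 \<and> card (S \<inter> {N1..<N1 + N2}) = j2. q ^ \<Sum>S)
    = subset_sum q 0 N1 j1 * subset_sum q N1 (N1 + N2) j2"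
proof -
  let ?A = "{S. S \<subseteq> {0..<N1} \<and> card S = j1}" and ?B = "{S. S \<subseteq> {N1..<N1 + N2} \<and> card S = j2}"
  let ?C = "{S. S \<subseteq> {..<N1 + N2} \<and> card (S \<inter> {..<N1}) = j1 \<and> card (S \<inter> {N1..<N1 + N2}) = j2}"
  have "bij_betw (\<lambda>(S, R). S \<union> R) (?A \<times> ?B) ?C"
  proof (rule bij_betw_byWitness[where f' = "\<lambda>S. (S \<inter> {..<N1}, S \<inter> {N1..<N1 + N2})"])
    have i: "(S \<union> R) \<inter> {..<N1} = S" "(S \<union> R) \<inter> {N1..<N1 + N2} = R"
      if "S \<subseteq> {0..<N1}" "R \<subseteq> {N1..<N1 + N2}" for S R using that by force+
    show "\<forall>x\<in>?A \<times> ?B. (\<lambda>S. (S \<inter> {..<N1}, S \<inter> {N1..<N1 + N2})) (case x of (S, R) \<Rightarrow> S \<union> R) = x"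
      using i by auto
    show "\<forall>S\<in>?C. (case (S \<inter> {..<N1}, S \<inter> {N1..<N1 + N2}) of (S, R) \<Rightarrow> S \<union> R) = S" by force
    show "(\<lambda>(S, R). S \<union> R) ` (?A \<times> ?B) \<subseteq> ?C" using i by force
    show "(\<lambda>S. (S \<inter> {..<N1}, S \<inter> {N1..<N1 + N2})) ` ?C \<subseteq> ?A \<times> ?B" by auto
  qed
  then have "(\<Sum>S\<in>?C. q ^ \<Sum>S) = (\<Sum>x\<in>?A \<times> ?B. q ^ \<Sum>(case x of (S, R) \<Rightarrow> S \<union> R))"
    by (rule sum.reindex_bij_betw[symmetric])
  also have "\<dots> = (\<Sum>(S, R)\<in>?A \<times> ?B. q ^ \<Sum>S * q ^ \<Sum>R)"
  proof (rule sum.cong[OF refl], clarify)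
    fix S R assume "S \<subseteq> {0..<N1}" "R \<subseteq> {N1..<N1 + N2}"
    then have "finite S" "finite R" "S \<inter> R = {}" by (auto dest: finite_subset) force
    then show "q ^ \<Sum>(S \<union> R) = q ^ \<Sum>S * q ^ \<Sum>R" by (simp add: sum.union_disjoint power_add)
  qed
  also have "\<dots> = subset_sum q 0 N1 j1 * subset_sum q N1 (N1 + N2) j2"
    by (simp add: subset_sum_def sum_product sum.cartesian_product)
  finally show ?thesis .
qed

text \<open>The offset is the sum of the first \<open>j1\<close> places of the first chain and the
  first \<open>j2\<close> places of the second one.\<close>

lemma coeff_gauss_product:
  "coeff (gauss (monom 1 1) N1 j1 * gauss (monom 1 1) N2 j2 :: int poly) i
    = int (card (pair_level N1 j1 N2 j2 (i + ((j1 choose 2) + N1 * j2 + (j2 choose 2)))))"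
proof -
  let ?q = "monom 1 1 :: int poly"
  let ?c = "(j1 choose 2) + N1 * j2 + (j2 choose 2)"
  let ?C = "{S. S \<subseteq> {..<N1 + N2} \<and> card (S \<inter> {..<N1}) = j1 \<and> card (S \<inter> {N1..<N1 + N2}) = j2}"
  have fin: "finite ?C" by (rule finite_subset[of _ "Pow {..<N1 + N2}"]) auto
  have "(\<Sum>S\<in>?C. ?q ^ \<Sum>S) = subset_sum ?q 0 (0 + N1) j1 * subset_sum ?q N1 (N1 + N2) j2"
    using sum_pair_family[of ?q N1 N2 j1 j2] by simp
  also have "\<dots> = ?q ^ ?c * (gauss ?q N1 j1 * gauss ?q N2 j2)"
    unfolding subset_sum_gauss by (simp add: power_add mult_ac)
  also have "?q ^ ?c = monom 1 ?c" by (simp add: monom_power)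
  finally have "coeff (monom 1 ?c * (gauss ?q N1 j1 * gauss ?q N2 j2)) (i + ?c) = coeff (\<Sum>S\<in>?C. ?q ^ \<Sum>S) (i + ?c)"
    by simp
  also have "\<dots> = (\<Sum>S\<in>?C. if \<Sum>S = i + ?c then 1 else 0)"
    by (simp add: coeff_sum monom_power)
  also have "\<dots> = int (card {S \<in> ?C. \<Sum>S = i + ?c})"
    using fin by (simp add: sum.If_cases Int_def)
  also have "{S \<in> ?C. \<Sum>S = i + ?c} = pair_level N1 j1 N2 j2 (i + ?c)"
    by (auto simp: pair_level_def)
  finally show ?thesis by (simp add: coeff_monom_mult)
qed

lemma real_choose_two: "2 * real (j choose 2) = real j * (real j - 1)"
  by (induction j) (simp_all add: numeral_2_eq_2 algebra_simps)

text \<open>Once the offset of the levels is inserted, the bound on \<open>i\<close> is precisely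
  the positivity of the scalar in \<open>card_pair_level_mono\<close>; it says that \<open>i\<close>
  lies below half the degree.\<close>

lemma gauss_product_unimodal:
  assumes "j1 \<le> N1" "j2 \<le> N2" "2 * i < j1 * (N1 - j1) + j2 * (N2 - j2)"
  shows "coeff (gauss (monom 1 1) N1 j1 * gauss (monom 1 1) N2 j2 :: int poly) i
    \<le> coeff (gauss (monom 1 1) N1 j1 * gauss (monom 1 1) N2 j2) (Suc i)"
proof -
  let ?c = "(j1 choose 2) + N1 * j2 + (j2 choose 2)"
  have "2 * real i < real j1 * (real N1 - real j1) + real j2 * (real N2 - real j2)"
  proof -
    have "real (2 * i) < real (j1 * (N1 - j1) + j2 * (N2 - j2))" using assms(3) by (simp only: of_nat_less_iff)
    then show ?thesis using assms(1,2) by (simp add: of_nat_diff)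
  qed
  then have "real j1 * (real N1 - 1) + real j2 * (real N2 - 1 + 2 * real N1) - 2 * real (i + ?c) > 0"
    using real_choose_two[of j1] real_choose_two[of j2] by (simp add: algebra_simps)
  from card_pair_level_mono[OF this] show ?thesis
    unfolding coeff_gauss_product by simp
qed

section \<open>Nonnegative coefficients of the quotient\<close>

lemma degree_gauss_le: "k \<le> n \<Longrightarrow> degree (gauss (monom 1 1) n k :: 'a::comm_ring_1 poly) \<le> k * (n - k)"
proof (induction n arbitrary: k)
  case (Suc n)
  show ?case
  proof (cases k)
    case (Suc i)
    have 1: "degree (gauss (monom 1 1) n i :: 'a poly) \<le> Suc i * (n - i)"
      using Suc.IH[of i] Suc Suc.prems by (simp add: le_trans[OF _ le_add2])
    have 2: "degree (monom 1 1 ^ Suc i * gauss (monom 1 1) n (Suc i) :: 'a poly) \<le> Suc i * (n - i)"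
    proof (cases "Suc i \<le> n")
      case True
      have m: "monom 1 1 ^ Suc i = (monom 1 (Suc i) :: 'a poly)"
        by (simp add: monom_power del: power_Suc)
      have "degree (monom 1 1 ^ Suc i * gauss (monom 1 1) n (Suc i) :: 'a poly) \<le> Suc i + Suc i * (n - Suc i)"
        unfolding m
        using Suc.IH[OF True] degree_mult_le[of "monom 1 (Suc i) :: 'a poly" "gauss (monom 1 1) n (Suc i)"]
        degree_monom_le[of "1::'a" "Suc i"] by linarith
      also have "\<dots> = Suc i * (n - i)" using True
        by (metis Suc_diff_Suc Suc_le_eq mult_Suc_right)
      finally show ?thesis .
    next
      case False
      then show ?thesis by (simp add: gauss_eq_0)
    qed
    have "degree (gauss (monom 1 1) (Suc n) (Suc i) :: 'a poly) \<le> Suc i * (n - i)"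
      using degree_add_le[OF 1 2] by simp
    then show ?thesis using Suc by simp
  qed simp
qed simp

text \<open>Multiplying by \<open>1 - q\<close> settles the lower half of the coefficients; the upper half follows by
  symmetry.\<close>
lemma quotient_nonneg:
  fixes P R :: "int poly"
  assumes PR: "P * qint D = R" and D: "0 < D" and refl: "reflect_poly P = P"
    and uni: "\<And>i. 2 * i < degree R \<Longrightarrow> coeff R i \<le> coeff R (Suc i)" and R0: "0 \<le> coeff R 0"
  shows "0 \<le> coeff P i"
proof (cases "P = 0")
  case False
  have "(1 - monom 1 1) * qint D = (1 - monom 1 D :: int poly)"
    unfolding qint_eq_qn qn_geometric by (simp add: monom_power)
  then have "(1 - monom 1 1) * R = P * (1 - monom 1 D)" using PR by (metis mult.left_commute)
  then have "R - monom 1 1 * R = P - monom 1 D * P" by (simp add: algebra_simps)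
  then have eq: "coeff (R - monom 1 1 * R) i = coeff (P - monom 1 D * P) i" for i by simp
  \<comment> \<open>Induction along \<open>P_i = (R_i - R_(i-1)) + P_(i-D)\<close>. The bound on
    \<open>i\<close> is what \<open>uni\<close> needs at \<open>i - 1\<close>, and it reaches far
    enough: one of \<open>i\<close> and \<open>degree P - i\<close> always satisfies it.\<close>
  have low: "0 \<le> coeff P i" if "2 * i \<le> Suc (degree R)" for i
    using that
  proof (induction i rule: less_induct)
    case (less i)
    have "0 \<le> coeff (R - monom 1 1 * R) i"
    proof (cases i)
      case 0
      then show ?thesis using R0 by (simp add: coeff_monom_mult)
    next
      case (Suc j)
      then show ?thesis using uni[of j] less.prems by (simp add: coeff_monom_mult)
    qed
    moreover have "0 \<le> coeff (monom 1 D * P) i"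
      using less.IH[of "i - D"] less.prems D by (auto simp: coeff_monom_mult)
    ultimately show ?case using eq[of i] by simp
  qed
  show ?thesis
  proof (cases "i \<le> degree P")
    case True
    have "degree R = degree P + degree (qint D :: int poly)"
      using PR False qint_nonzero[OF D] by (metis degree_mult_eq)
    then have le: "degree P \<le> degree R" by simp
    have "coeff P i = coeff P (degree P - i)"
      using refl True coeff_reflect_poly[of P i] by simp
    then show ?thesis using low[of i] low[of "degree P - i"] le by (cases "2 * i \<le> degree R") auto
  next
    case False
    then show ?thesis by (simp add: coeff_eq_0)
  qed
qed simp

lemma reflect_qint: "reflect_poly (qint m :: int poly) = qint m"
proof (cases "m = 0")
  case False
  have co: "coeff (qint m :: int poly) i = (if i < m then 1 else 0)" for i
    by (simp add: qint_def coeff_sum)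
  have deg: "degree (qint m :: int poly) = m - 1"
  proof (rule antisym)
    show "degree (qint m :: int poly) \<le> m - 1" by (rule degree_le) (use False in \<open>auto simp: co\<close>)
    show "m - 1 \<le> degree (qint m :: int poly)" by (rule le_degree) (use False in \<open>simp add: co\<close>)
  qed
  show ?thesis
    by (rule poly_eqI) (use False in \<open>auto simp: coeff_reflect_poly deg co\<close>)
qed (simp add: qint_def)

lemma reflect_qfact: "reflect_poly (qfact m :: int poly) = qfact m"
  by (simp add: qfact_def reflect_poly_prod reflect_qint)

text \<open>\<open>reflect_poly\<close> is multiplicative over an integral domain, so a quotient of
  palindromic polynomials is palindromic.\<close>

lemma reflect_gauss:
  assumes "k \<le> n"
  shows "reflect_poly (gauss (monom 1 1) n k :: int poly) = gauss (monom 1 1) n k"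
proof -
  let ?f = "qfact k * qfact (n - k) :: int poly"
  have "reflect_poly (gauss (monom 1 1) n k) * ?f = gauss (monom 1 1) n k * ?f"
    by (metis gauss_mult_qfact[OF assms] reflect_poly_mult reflect_qfact)
  moreover have "?f \<noteq> 0" by (simp add: qfact_nonzero)
  ultimately show ?thesis by simp
qed

lemma forest_q_nonneg:
  assumes "1 \<le> k" "k \<le> n"
  shows "0 \<le> coeff (forest_q (monom 1 1) n k :: int poly) i"
proof (rule quotient_nonneg)
  let ?R = "gauss (monom 1 1) n (k - 1) * gauss (monom 1 1) (3*n - 2*k - 1) (n - k) :: int poly"
  have le: "k - 1 \<le> n" "n - k \<le> 3*n - 2*k - 1" using assms by auto
  show PR: "forest_q (monom 1 1) n k * qint (2*n - k) = ?R"
    using forest_q_mult[OF assms, of "monom 1 1 :: int poly"] by (simp add: qint_eq_qn)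
  show D: "0 < 2*n - k" using assms by simp
  have "reflect_poly (forest_q (monom 1 1) n k) * qint (2*n - k) = forest_q (monom 1 1) n k * (qint (2*n - k) :: int poly)"
    by (metis PR reflect_poly_mult reflect_qint reflect_gauss[OF le(1)] reflect_gauss[OF le(2)])
  then show "reflect_poly (forest_q (monom 1 1) n k) = (forest_q (monom 1 1) n k :: int poly)"
    using qint_nonzero[OF D, where 'a = int] by simp
  have deg: "degree ?R \<le> (k - 1) * (n - (k - 1)) + (n - k) * (3*n - 2*k - 1 - (n - k))"
    using degree_mult_le add_mono[OF degree_gauss_le[OF le(1)] degree_gauss_le[OF le(2)]] by (rule order_trans)
  show "coeff ?R i \<le> coeff ?R (Suc i)" if "2 * i < degree ?R" for i
    using that deg by (intro gauss_product_unimodal le) linarith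
  show "0 \<le> coeff ?R 0" unfolding coeff_gauss_product by simp
qed

section \<open>Acyclic graphs\<close>

text \<open>Every edge is a bridge. Unlike lists of cycle vertices, this form passes easily through
  gluing, injective images and the counting of components. A one-element edge violates it by
  reflexivity; for two-element edges it is equivalent to the absence of cycles.\<close>

definition acyc :: "nat set set \<Rightarrow> bool" where
  "acyc F \<longleftrightarrow> (\<forall>u v. {u, v} \<in> F \<longrightarrow> (u, v) \<notin> (adj (F - {{u, v}}))\<^sup>*)"

lemma adj_mono: "F \<subseteq> G \<Longrightarrow> adj F \<subseteq> adj G"
  by (auto simp: adj_def)

lemma sym_adj: "sym (adj F)"
  by (auto simp: adj_def sym_def insert_commute)

lemma adj_rtrancl_sym: "(u, v) \<in> (adj F)\<^sup>* \<Longrightarrow> (v, u) \<in> (adj F)\<^sup>*"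
  by (meson sym_adj sym_rtrancl symD)

lemma adj_rtrancl_mono: "F \<subseteq> G \<Longrightarrow> (u, v) \<in> (adj F)\<^sup>* \<Longrightarrow> (u, v) \<in> (adj G)\<^sup>*"
  using rtrancl_mono[OF adj_mono] by blast

lemma acyc_subset: "acyc G \<Longrightarrow> F \<subseteq> G \<Longrightarrow> acyc F"
  unfolding acyc_def using adj_rtrancl_mono[of "F - _" "G - _"]
  by (meson Diff_mono subset_iff order_refl)

lemma acyc_empty [simp]: "acyc {}"
  by (simp add: acyc_def)

lemma acyc_singleton: "u \<noteq> v \<Longrightarrow> acyc {{u, v}}"
proof -
  assume "u \<noteq> v"
  moreover have "adj {} = {}" by (auto simp: adj_def)
  ultimately show ?thesis by (auto simp: acyc_def doubleton_eq_iff insert_commute)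
qed

text \<open>Collapsing \<open>W1\<close> onto the common vertex maps a walk in the union to a walk in \<open>F2\<close>.\<close>
lemma retract_walk:
  assumes "\<And>e. e \<in> F1 \<Longrightarrow> e \<subseteq> W1" "\<And>e. e \<in> F2 \<Longrightarrow> e \<subseteq> W2" "W1 \<inter> W2 \<subseteq> {x}"
    and "(u, v) \<in> (adj (F1 \<union> F2))\<^sup>*"
  shows "(if u \<in> W2 then u else x, if v \<in> W2 then v else x) \<in> (adj F2)\<^sup>*"
  using assms(4)
proof (induction rule: rtrancl_induct)
  case base
  then show ?case by simp
next
  case (step y z)
  have "{y, z} \<in> F1 \<or> {y, z} \<in> F2"
    using step(2) by (auto simp: adj_def)
  then show ?case
  proof
    assume "{y, z} \<in> F1"
    with assms(1) have "{y, z} \<subseteq> W1" by blast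
    then have "(if y \<in> W2 then y else x) = x" "(if z \<in> W2 then z else x) = x"
      using assms(3) by auto
    with step.IH show ?thesis by metis
  next
    assume e: "{y, z} \<in> F2"
    with assms(2) have "{y, z} \<subseteq> W2" by blast
    then show ?thesis
      using step.IH e by (auto simp: adj_def intro: rtrancl_into_rtrancl)
  qed
qed

text \<open>A detour around an edge of \<open>F2\<close> would be retracted by
  \<open>retract_walk\<close> to a detour inside \<open>F2\<close>.\<close>

lemma acyc_glue_aux:
  assumes "acyc F2" "\<And>e. e \<in> F1 \<Longrightarrow> e \<subseteq> W1" "\<And>e. e \<in> F2 \<Longrightarrow> e \<subseteq> W2" "W1 \<inter> W2 \<subseteq> {x}"
    and "{u, v} \<in> F2"
  shows "(u, v) \<notin> (adj (F1 \<union> F2 - {{u, v}}))\<^sup>*"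
proof
  assume "(u, v) \<in> (adj (F1 \<union> F2 - {{u, v}}))\<^sup>*"
  then have "(u, v) \<in> (adj (F1 \<union> (F2 - {{u, v}})))\<^sup>*"
    by (rule adj_rtrancl_mono[rotated]) auto
  then have "(if u \<in> W2 then u else x, if v \<in> W2 then v else x) \<in> (adj (F2 - {{u, v}}))\<^sup>*"
    using retract_walk[of F1 W1 "F2 - {{u, v}}" W2 x u v] assms by blast
  moreover have "{u, v} \<subseteq> W2" using assms by blast
  ultimately show False using assms(1,5) by (auto simp: acyc_def)
qed

lemma acyc_glue:
  assumes "acyc F1" "acyc F2" "\<And>e. e \<in> F1 \<Longrightarrow> e \<subseteq> W1" "\<And>e. e \<in> F2 \<Longrightarrow> e \<subseteq> W2" "W1 \<inter> W2 \<subseteq> {x}"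
  shows "acyc (F1 \<union> F2)"
  unfolding acyc_def
proof (intro allI impI)
  fix u v assume "{u, v} \<in> F1 \<union> F2"
  then show "(u, v) \<notin> (adj (F1 \<union> F2 - {{u, v}}))\<^sup>*"
    using acyc_glue_aux[of F2 F1 W1 W2 x u v] acyc_glue_aux[of F1 F2 W2 W1 x u v] assms
    by (metis Un_commute Int_commute Un_iff)
qed

text \<open>Loop erasure: when the walk returns to a vertex of the path, the path is truncated
  there.\<close>

lemma walk_imp_distinct_path:
  assumes "(u, v) \<in> R\<^sup>*"
  shows "\<exists>vs. vs \<noteq> [] \<and> hd vs = u \<and> last vs = v \<and> distinct vs \<and>
    (\<forall>i. Suc i < length vs \<longrightarrow> (vs ! i, vs ! Suc i) \<in> R)"
  using assms
proof (induction rule: rtrancl_induct)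
  case base
  then show ?case by (intro exI[of _ "[u]"]) auto
next
  case (step y z)
  then obtain vs where vs: "vs \<noteq> []" "hd vs = u" "last vs = y" "distinct vs"
    "\<forall>i. Suc i < length vs \<longrightarrow> (vs ! i, vs ! Suc i) \<in> R" by blast
  show ?case
  proof (cases "z \<in> set vs")
    case True
    then obtain j where j: "j < length vs" "vs ! j = z" by (metis in_set_conv_nth)
    show ?thesis
      using vs j
      by (intro exI[of _ "take (Suc j) vs"]) (auto simp: hd_conv_nth last_conv_nth min_absorb2)
  next
    case False
    have "(\<forall>i. Suc i < length (vs @ [z]) \<longrightarrow> ((vs @ [z]) ! i, (vs @ [z]) ! Suc i) \<in> R)"
    proof (intro allI impI)
      fix i assume i: "Suc i < length (vs @ [z])"
      show "((vs @ [z]) ! i, (vs @ [z]) ! Suc i) \<in> R"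
      proof (cases "Suc i < length vs")
        case True
        then show ?thesis using vs by (auto simp: nth_append)
      next
        case F: False
        with i have "Suc i = length vs" by simp
        moreover have "i = length vs - 1" using calculation by simp
        then have "vs ! i = y" using vs(1,3) by (simp add: last_conv_nth)
        ultimately show ?thesis using step(2) by (auto simp: nth_append)
      qed
    qed
    then show ?thesis
      using vs False by (intro exI[of _ "vs @ [z]"]) auto
  qed
qed

lemma not_has_cycle_if_acyc:
  assumes "acyc F"
  shows "\<not> has_cycle F"
proof
  assume "has_cycle F"
  then obtain vs where vs: "length vs \<ge> 3" "distinct vs"
    "\<And>i. i < length vs \<Longrightarrow> {vs ! i, vs ! ((i + 1) mod length vs)} \<in> F"
    unfolding has_cycle_def by blast
  define l where "l = length vs - 1"
  have l: "l \<ge> 2" "length vs = Suc l" using vs(1) by (auto simp: l_def)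
  let ?e = "{vs ! 0, vs ! l}"
  have e: "?e \<in> F" using vs(3)[of l] l by (simp add: insert_commute)
  have "(vs ! 0, vs ! i) \<in> (adj (F - {?e}))\<^sup>*" if "i \<le> l" for i
    using that
  proof (induction i)
    case 0
    then show ?case by simp
  next
    case (Suc i)
    have "{vs ! i, vs ! Suc i} \<in> F" using vs(3)[of i] Suc.prems l by simp
    moreover have "{vs ! i, vs ! Suc i} \<noteq> ?e"
      using vs(2) Suc.prems l by (auto simp: doubleton_eq_iff nth_eq_iff_index_eq)
    ultimately have "(vs ! i, vs ! Suc i) \<in> adj (F - {?e})" by (auto simp: adj_def)
    with Suc show ?case by (meson Suc_leD rtrancl_into_rtrancl)
  qed
  then show False using assms e by (auto simp: acyc_def)
qed

lemma acyc_if_not_has_cycle: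
  assumes "\<not> has_cycle F" and card2: "\<And>e. e \<in> F \<Longrightarrow> card e = 2"
  shows "acyc F"
  unfolding acyc_def
proof (intro allI impI notI)
  fix u v assume e: "{u, v} \<in> F" and w: "(u, v) \<in> (adj (F - {{u, v}}))\<^sup>*"
  have uv: "u \<noteq> v" using card2[OF e] by auto
  obtain vs where vs: "vs \<noteq> []" "hd vs = u" "last vs = v" "distinct vs"
    "\<And>i. Suc i < length vs \<Longrightarrow> (vs ! i, vs ! Suc i) \<in> adj (F - {{u, v}})"
    using walk_imp_distinct_path[OF w] by blast
  have ends: "vs ! 0 = u" "vs ! (length vs - 1) = v"
    using vs by (auto simp: hd_conv_nth last_conv_nth)
  have "length vs \<noteq> 0" "length vs \<noteq> 1" using vs ends uv by auto
  moreover have "length vs \<noteq> 2"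
  proof
    assume l2: "length vs = 2"
    then have "(u, v) \<in> adj (F - {{u, v}})" using vs(5)[of 0] ends by simp
    then show False by (auto simp: adj_def)
  qed
  ultimately have l: "length vs \<ge> 3" by linarith
  have "{vs ! i, vs ! ((i + 1) mod length vs)} \<in> F" if "i < length vs" for i
  proof (cases "Suc i < length vs")
    case True
    then show ?thesis using vs(5)[of i] by (auto simp: adj_def)
  next
    case False
    then have "i + 1 = length vs" using that by linarith
    then have "i = length vs - 1" "(i + 1) mod length vs = 0"
      by simp_all
    then show ?thesis using ends e by (simp add: insert_commute)
  qed
  then show False using assms(1) l vs(4) unfolding has_cycle_def by blast
qed

text \<open>A walk can be shortened until it uses the new edge at most once, in one of its two
  directions.\<close>

lemma rtrancl_insert_adj:
  assumes "{u, v} \<notin> F"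
  shows "(a, b) \<in> (adj (insert {u, v} F))\<^sup>* \<longleftrightarrow> (a, b) \<in> (adj F)\<^sup>* \<or>
     (a, u) \<in> (adj F)\<^sup>* \<and> (v, b) \<in> (adj F)\<^sup>* \<or> (a, v) \<in> (adj F)\<^sup>* \<and> (u, b) \<in> (adj F)\<^sup>*"
    (is "?L \<longleftrightarrow> ?R")
proof
  assume ?L
  then show ?R
  proof (induction rule: rtrancl_induct)
    case base
    then show ?case by simp
  next
    case (step y z)
    have "(y, z) \<in> adj F \<or> (y = u \<and> z = v) \<or> (y = v \<and> z = u)"
      using step(2) by (auto simp: adj_def doubleton_eq_iff)
    then show ?case
      using step.IH
      by (metis rtrancl.rtrancl_refl rtrancl.rtrancl_into_rtrancl)
  qed
next
  assume R: ?R
  have m: "(x, y) \<in> (adj F)\<^sup>* \<Longrightarrow> (x, y) \<in> (adj (insert {u, v} F))\<^sup>*" for x y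
    by (rule adj_rtrancl_mono[rotated]) auto
  have "(u, v) \<in> (adj (insert {u, v} F))\<^sup>*" "(v, u) \<in> (adj (insert {u, v} F))\<^sup>*"
    by (auto simp: adj_def insert_commute)
  then show ?L using R m by (meson rtrancl_trans)
qed

lemma card_quotient_insert:
  assumes W: "finite W" "u \<in> W" "v \<in> W" and nc: "(u, v) \<notin> (adj F)\<^sup>*"
  shows "Suc (card (W // (adj (insert {u, v} F))\<^sup>*)) = card (W // (adj F)\<^sup>*)"
proof -
  let ?R = "(adj F)\<^sup>*" and ?S = "(adj (insert {u, v} F))\<^sup>*"
  let ?U = "?R `` {u}" and ?V = "?R `` {v}"
  have nF: "{u, v} \<notin> F" using nc by (auto simp: adj_def)
  note ins = rtrancl_insert_adj[OF nF]
  have uvne: "?U \<noteq> ?V" using nc by auto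
  have S1: "?S `` {w} = ?R `` {w}" if "(w, u) \<notin> ?R" "(w, v) \<notin> ?R" for w
    using that by (auto simp: ins)
  have S2: "?S `` {w} = ?U \<union> ?V" if "(w, u) \<in> ?R \<or> (w, v) \<in> ?R" for w
    using that by (auto simp: ins) (meson adj_rtrancl_sym rtrancl_trans)+
  have cls: "?R `` {w} = ?U" if "(w, u) \<in> ?R" for w
    using that by (auto intro: rtrancl_trans dest: adj_rtrancl_sym)
  have cls': "?R `` {w} = ?V" if "(w, v) \<in> ?R" for w
    using that by (auto intro: rtrancl_trans dest: adj_rtrancl_sym)
  have eq: "W // ?S = insert (?U \<union> ?V) (W // ?R - {?U, ?V})"
  proof (intro equalityI subsetI)
    fix X assume "X \<in> W // ?S"
    then obtain w where w: "w \<in> W" "X = ?S `` {w}" by (auto simp: quotient_def)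
    show "X \<in> insert (?U \<union> ?V) (W // ?R - {?U, ?V})"
    proof (cases "(w, u) \<in> ?R \<or> (w, v) \<in> ?R")
      case True
      then show ?thesis using S2 w by auto
    next
      case False
      then have "X = ?R `` {w}" using S1 w by auto
      moreover have "?R `` {w} \<noteq> ?U" "?R `` {w} \<noteq> ?V" using False by blast+
      ultimately show ?thesis using w by (auto simp: quotient_def)
    qed
  next
    fix X assume "X \<in> insert (?U \<union> ?V) (W // ?R - {?U, ?V})"
    then consider "X = ?U \<union> ?V" | w where "w \<in> W" "X = ?R `` {w}" "X \<noteq> ?U" "X \<noteq> ?V"
      by (auto simp: quotient_def)
    then show "X \<in> W // ?S"
    proof cases
      case 1
      then show ?thesis using S2[of u] W by (auto simp: quotient_def)
    next
      case 2
      then have "?S `` {w} = X" using S1[of w] cls[of w] cls'[of w] by blast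
      then show ?thesis using 2 by (auto simp: quotient_def)
    qed
  qed
  have fin: "finite (W // ?R)" using W(1) by (simp add: quotient_def)
  have mem: "?U \<in> W // ?R" "?V \<in> W // ?R" using W by (auto simp: quotient_def)
  have new: "?U \<union> ?V \<notin> W // ?R - {?U, ?V}"
  proof
    assume "?U \<union> ?V \<in> W // ?R - {?U, ?V}"
    then obtain w where w: "?U \<union> ?V = ?R `` {w}" "?R `` {w} \<noteq> ?U" by (auto simp: quotient_def)
    then have "(w, u) \<in> ?R" by blast
    then show False using cls w by blast
  qed
  have "card (W // ?R) \<ge> card {?U, ?V}"
    using mem fin by (intro card_mono) auto
  then have "card (W // ?R) \<ge> 2" using uvne by simp
  then show ?thesis
    unfolding eq using new fin mem uvne by (simp add: card_Diff_subset)
qed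

text \<open>Edges are added one at a time; being a bridge, each one merges exactly two components
  (\<open>card_quotient_insert\<close>).\<close>

lemma acyc_card_components:
  assumes "finite F" "finite W" "\<And>e. e \<in> F \<Longrightarrow> e \<subseteq> W \<and> card e = 2" "acyc F"
  shows "card F + card (W // (adj F)\<^sup>*) = card W"
  using assms
proof (induction F rule: finite_induct)
  case empty
  have "adj {} = {}" by (auto simp: adj_def)
  then have "W // (adj {})\<^sup>* = (\<lambda>x. {x}) ` W" by (auto simp: quotient_def)
  then show ?case by (simp add: card_image)
next
  case (insert e F)
  obtain u v where e: "e = {u, v}" "u \<in> W" "v \<in> W"
    using insert.prems(2)[of e] by (auto simp: card_2_iff)
  have "(u, v) \<notin> (adj F)\<^sup>*"
    using insert.prems(3) insert.hyps(2) e unfolding acyc_def by (metis Diff_insert_absorb insertI1)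
  moreover have "acyc F" using insert.prems(3) acyc_subset by blast
  ultimately show ?case
    using insert card_quotient_insert[of W u v F] e by auto
qed

section \<open>Decomposition of non-crossing forests on an interval\<close>

definition ncf :: "nat \<Rightarrow> nat \<Rightarrow> nat \<Rightarrow> nat set set set" where
  "ncf a b e = {F. (\<forall>x\<in>F. x \<subseteq> {a..<b} \<and> card x = 2) \<and> non_crossing F \<and> acyc F \<and> card F = e}"

text \<open>The number \<open>q\<close> stands for the gap between the vertices \<open>q - 1\<close>
  and \<open>q\<close>.\<close>

definition splits_at :: "nat \<Rightarrow> nat set set \<Rightarrow> bool" where
  "splits_at q F \<longleftrightarrow> (\<forall>x\<in>F. x \<subseteq> {..<q} \<or> x \<subseteq> {q..})"

definition irr_ncf :: "nat \<Rightarrow> nat \<Rightarrow> nat \<Rightarrow> nat set set set" where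
  "irr_ncf a b e = {F \<in> ncf a b e. \<forall>q. a < q \<and> q < b \<longrightarrow> \<not> splits_at q F}"

text \<open>For a forest on a nonempty interval the left end \<open>a\<close> is a trivial cut, so
  the maximum exists, and the last indecomposable block has \<open>b - last_cut a b F\<close>
  vertices.\<close>

definition last_cut :: "nat \<Rightarrow> nat \<Rightarrow> nat set set \<Rightarrow> nat" where
  "last_cut a b F = Max {q \<in> {a..<b}. splits_at q F}"

lemma edgeE:
  assumes "card (x :: nat set) = 2"
  obtains u v where "x = {u, v}" "u < v"
proof -
  obtain u v where "x = {u, v}" "u \<noteq> v" using assms by (auto simp: card_2_iff)
  then show ?thesis using that[of u v] that[of v u] by (cases "u < v") (auto simp: insert_commute)
qed

lemma ncf_edge:
  assumes "F \<in> ncf a b e" "x \<in> F"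
  shows "x \<subseteq> {a..<b}" "card x = 2"
  using assms by (auto simp: ncf_def)

lemma ncf_non_crossing: "F \<in> ncf a b e \<Longrightarrow> non_crossing F"
  and ncf_acyc: "F \<in> ncf a b e \<Longrightarrow> acyc F"
  and ncf_card: "F \<in> ncf a b e \<Longrightarrow> card F = e"
  by (auto simp: ncf_def)

lemma ncf_finite:
  assumes "F \<in> ncf a b e"
  shows "finite F"
proof -
  have "F \<subseteq> Pow {a..<b}" using assms by (auto simp: ncf_def)
  then show ?thesis by (rule finite_subset) simp
qed

lemma finite_ncf: "finite (ncf a b e)"
proof -
  have "ncf a b e \<subseteq> Pow (Pow {a..<b})" by (auto simp: ncf_def)
  then show ?thesis by (rule finite_subset) simp
qed

lemma finite_irr_ncf: "finite (irr_ncf a b e)"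
  by (rule finite_subset[OF _ finite_ncf]) (auto simp: irr_ncf_def)

lemma non_crossing_subset: "non_crossing F \<Longrightarrow> G \<subseteq> F \<Longrightarrow> non_crossing G"
  unfolding non_crossing_def by blast

lemma ncf_restrict:
  assumes "F \<in> ncf a b e" "G \<subseteq> F" "\<And>x. x \<in> G \<Longrightarrow> x \<subseteq> I" "{a..<b} \<inter> I \<subseteq> {a'..<b'}"
  shows "G \<in> ncf a' b' (card G)"
  using assms non_crossing_subset[of F G] acyc_subset[of F G] unfolding ncf_def by blast

lemma non_crossing_glue:
  assumes "non_crossing F1" "non_crossing F2"
    and "\<And>x. x \<in> F1 \<Longrightarrow> x \<subseteq> {..j}" "\<And>x. x \<in> F2 \<Longrightarrow> x \<subseteq> {j..}"
  shows "non_crossing (F1 \<union> F2)"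
  unfolding non_crossing_def
proof
  assume "\<exists>a b c d. {a, b} \<in> F1 \<union> F2 \<and> {c, d} \<in> F1 \<union> F2 \<and> a < c \<and> c < b \<and> b < d"
  then obtain a b c d where *: "{a, b} \<in> F1 \<union> F2" "{c, d} \<in> F1 \<union> F2" "a < c" "c < b" "b < d"
    by blast
  have "{a, b} \<in> F1 \<and> {c, d} \<in> F1 \<or> {a, b} \<in> F2 \<and> {c, d} \<in> F2"
    using *(1,2) assms(3)[of "{a, b}"] assms(3)[of "{c, d}"] assms(4)[of "{a, b}"] assms(4)[of "{c, d}"] *(3-5)
    by auto
  then show False using assms(1,2) *(3-5) unfolding non_crossing_def by blast
qed

text \<open>The bound \<open>q1 \<le> Suc q2\<close> admits disjoint intervals as well as intervals
  sharing the vertex \<open>q2\<close>, so juxtaposition and gluing at a vertex are treated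
  together.\<close>

lemma ncf_glue:
  assumes "F1 \<in> ncf a q1 e1" "F2 \<in> ncf q2 b e2" "q1 \<le> Suc q2" "a \<le> q2" "q1 \<le> b"
  shows "F1 \<union> F2 \<in> ncf a b (e1 + e2)" "F1 \<inter> F2 = {}"
proof -
  show disj: "F1 \<inter> F2 = {}"
  proof (rule ccontr)
    assume "F1 \<inter> F2 \<noteq> {}"
    then obtain x where x: "x \<in> F1" "x \<in> F2" by blast
    then have "x \<subseteq> {q2}" using ncf_edge(1)[OF assms(1) x(1)] ncf_edge(1)[OF assms(2) x(2)] assms(3)
      by force
    then have "card x \<le> card {q2}" by (intro card_mono) auto
    then show False using ncf_edge(2)[OF assms(1) x(1)] by simp
  qed
  have "non_crossing (F1 \<union> F2)"
  proof (rule non_crossing_glue[of _ _ q2])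
    show "x \<subseteq> {..q2}" if "x \<in> F1" for x using ncf_edge(1)[OF assms(1) that] assms(3) by force
    show "x \<subseteq> {q2..}" if "x \<in> F2" for x using ncf_edge(1)[OF assms(2) that] by force
  qed (use assms ncf_non_crossing in blast)+
  moreover have "acyc (F1 \<union> F2)"
  proof (rule acyc_glue[of _ _ "{a..<q1}" "{q2..<b}" q2])
    show "{a..<q1} \<inter> {q2..<b} \<subseteq> {q2}" using assms(3) by auto
  qed (use assms ncf_acyc ncf_edge in blast)+
  moreover have "card (F1 \<union> F2) = e1 + e2"
    using card_Un_disjoint[OF ncf_finite[OF assms(1)] ncf_finite[OF assms(2)] disj] assms ncf_card by metis
  moreover have "x \<subseteq> {a..<b} \<and> card x = 2" if "x \<in> F1 \<union> F2" for x
  proof -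
    have "{a..<q1} \<subseteq> {a..<b}" "{q2..<b} \<subseteq> {a..<b}" using assms by auto
    then show ?thesis using that ncf_edge[OF assms(1), of x] ncf_edge[OF assms(2), of x] by blast
  qed
  ultimately show "F1 \<union> F2 \<in> ncf a b (e1 + e2)" by (auto simp: ncf_def)
qed

lemma ncf_degenerate:
  assumes "b \<le> Suc a"
  shows "ncf a b e = (if e = 0 then {{}} else {})"
proof -
  have *: "F = {}" if "F \<in> ncf a b e" for F
  proof (rule ccontr)
    assume "F \<noteq> {}"
    then obtain x where x: "x \<in> F" by blast
    have "x \<subseteq> {a}" using ncf_edge(1)[OF that x] assms by force
    then have "card x \<le> card {a}" by (intro card_mono) auto
    then show False using ncf_edge(2)[OF that x] by simp
  qed
  have "{} \<in> ncf a b 0" by (auto simp: ncf_def non_crossing_def)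
  moreover have "e = 0" if "F \<in> ncf a b e" for F using *[OF that] ncf_card[OF that] by simp
  ultimately show ?thesis using * by auto
qed

lemma last_cut_glue:
  assumes "F1 \<in> ncf a q e1" "F2 \<in> irr_ncf q b e2" "a \<le> q" "q < b"
  shows "last_cut a b (F1 \<union> F2) = q" "splits_at q (F1 \<union> F2)"
proof -
  have F2: "F2 \<in> ncf q b e2" using assms by (simp add: irr_ncf_def)
  show c: "splits_at q (F1 \<union> F2)"
    unfolding splits_at_def using ncf_edge(1)[OF assms(1)] ncf_edge(1)[OF F2] by force
  have "\<not> splits_at p (F1 \<union> F2)" if "q < p" "p < b" for p
    using assms(2) that by (auto simp: irr_ncf_def splits_at_def)
  then show "last_cut a b (F1 \<union> F2) = q"
    unfolding last_cut_def using c assms by (intro Max_eqI) (auto simp: not_less[symmetric])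
qed

lemma last_cut:
  assumes "\<And>x. x \<in> F \<Longrightarrow> x \<subseteq> {a..<b}" "a < b"
  shows "a \<le> last_cut a b F" "last_cut a b F < b" "splits_at (last_cut a b F) F"
    and "last_cut a b F < q \<Longrightarrow> q < b \<Longrightarrow> \<not> splits_at q F"
proof -
  let ?S = "{q \<in> {a..<b}. splits_at q F}"
  have "splits_at a F" using assms(1) by (force simp: splits_at_def)
  then have "a \<in> ?S" using assms by auto
  then have *: "last_cut a b F \<in> ?S" unfolding last_cut_def by (intro Max_in) auto
  then show "a \<le> last_cut a b F" "last_cut a b F < b" "splits_at (last_cut a b F) F" by auto
  show "\<not> splits_at q F" if "last_cut a b F < q" "q < b"
  proof
    assume "splits_at q F"
    then have "q \<in> ?S" using that * by auto
    then have "q \<le> last_cut a b F" unfolding last_cut_def by (intro Max_ge) auto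
    then show False using that by simp
  qed
qed

text \<open>The combinatorial form of \<open>A = 1 + zAU\<close>. The inverse cuts at
  \<open>last_cut\<close>, leaving an arbitrary forest before it and an indecomposable one after
  it.\<close>

lemma ncf_decompose:
  assumes "a < b"
  shows "bij_betw (\<lambda>(p, F1, F2). F1 \<union> F2)
    (SIGMA p : {a..<b} \<times> {..e}. ncf a (fst p) (snd p) \<times> irr_ncf (fst p) b (e - snd p)) (ncf a b e)"
proof (rule bij_betwI')
  let ?D = "SIGMA p : {a..<b} \<times> {..e}. ncf a (fst p) (snd p) \<times> irr_ncf (fst p) b (e - snd p)"
  fix z z' assume zz: "z \<in> ?D" "z' \<in> ?D"
  obtain q e1 F1 F2 where z: "z = ((q, e1), F1, F2)" by (cases z) auto
  obtain q' e1' F1' F2' where z': "z' = ((q', e1'), F1', F2')" by (cases z') auto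
  have q: "a \<le> q" "q < b" "F1 \<in> ncf a q e1" "F2 \<in> irr_ncf q b (e - e1)" using zz z by auto
  have q': "a \<le> q'" "q' < b" "F1' \<in> ncf a q' e1'" "F2' \<in> irr_ncf q' b (e - e1')" using zz z' by auto
  have split: "G1 = {x \<in> G1 \<union> G2. x \<subseteq> {..<p}} \<and> G2 = (G1 \<union> G2) - {x \<in> G1 \<union> G2. x \<subseteq> {..<p}}"
    if "G1 \<in> ncf a p e1" "G2 \<in> irr_ncf p b e2" for G1 G2 p e1 e2
  proof -
    have G2: "G2 \<in> ncf p b e2" using that by (simp add: irr_ncf_def)
    have *: "x \<subseteq> {..<p}" if "x \<in> G1" for x using ncf_edge(1)[OF \<open>G1 \<in> ncf a p e1\<close> that] by force
    have **: "\<not> x \<subseteq> {..<p}" if "x \<in> G2" for x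
    proof
      assume "x \<subseteq> {..<p}"
      then have "x = {}" using ncf_edge(1)[OF G2 that] by force
      then show False using ncf_edge(2)[OF G2 that] by simp
    qed
    show ?thesis using * ** by blast
  qed
  show "((case z of (p, F1, F2) \<Rightarrow> F1 \<union> F2) = (case z' of (p, F1, F2) \<Rightarrow> F1 \<union> F2)) = (z = z')"
  proof
    assume "(case z of (p, F1, F2) \<Rightarrow> F1 \<union> F2) = (case z' of (p, F1, F2) \<Rightarrow> F1 \<union> F2)"
    then have eq: "F1 \<union> F2 = F1' \<union> F2'" using z z' by simp
    have qq: "q = q'" using last_cut_glue(1)[OF q(3,4,1,2)] last_cut_glue(1)[OF q'(3,4,1,2)] eq by simp
    have "F1 = F1'" "F2 = F2'" using split[OF q(3,4)] split[OF q'(3,4)] eq qq by metis+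
    moreover have "e1 = e1'" using ncf_card[OF q(3)] ncf_card[OF q'(3)] calculation by simp
    ultimately show "z = z'" using z z' qq by simp
  qed simp
next
  fix z assume "z \<in> (SIGMA p : {a..<b} \<times> {..e}. ncf a (fst p) (snd p) \<times> irr_ncf (fst p) b (e - snd p))"
  then obtain q e1 F1 F2 where z: "z = ((q, e1), F1, F2)" "a \<le> q" "q < b" "e1 \<le> e"
    "F1 \<in> ncf a q e1" "F2 \<in> ncf q b (e - e1)" by (auto simp: irr_ncf_def)
  then show "(case z of (p, F1, F2) \<Rightarrow> F1 \<union> F2) \<in> ncf a b e"
    using ncf_glue(1)[of F1 a q e1 F2 q b "e - e1"] by simp
next
  fix F assume F: "F \<in> ncf a b e"
  define q where "q = last_cut a b F"
  have q: "a \<le> q" "q < b" "splits_at q F" "\<And>p. q < p \<Longrightarrow> p < b \<Longrightarrow> \<not> splits_at p F"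
    using last_cut[of F a b] ncf_edge(1)[OF F] assms unfolding q_def by blast+
  define F1 where "F1 = {x \<in> F. x \<subseteq> {..<q}}"
  define F2 where "F2 = F - F1"
  have F2: "F2 \<subseteq> F" "x \<subseteq> {q..}" if "x \<in> F2" for x
    using q(3) that unfolding F2_def F1_def splits_at_def by auto
  have n1: "F1 \<in> ncf a q (card F1)"
    by (rule ncf_restrict[OF F, of _ "{..<q}"]) (auto simp: F1_def)
  have n2: "F2 \<in> ncf q b (card F2)"
    by (rule ncf_restrict[OF F, of _ "{q..}"]) (use F2 in auto)
  have U: "F = F1 \<union> F2" by (auto simp: F1_def F2_def)
  have "card F = card F1 + card F2"
    unfolding F2_def using ncf_finite[OF F] by (subst card_Diff_subset) (auto simp: F1_def card_mono)
  then have c: "card F1 \<le> e" "card F2 = e - card F1" using ncf_card[OF F] by auto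
  have "\<not> splits_at p F2" if p: "q < p" "p < b" for p
  proof
    assume "splits_at p F2"
    moreover have "splits_at p F1" using p by (auto simp: splits_at_def F1_def)
    ultimately have "splits_at p F" using U by (auto simp: splits_at_def)
    then show False using q(4) p by blast
  qed
  then have "F2 \<in> irr_ncf q b (e - card F1)" using n2 c by (auto simp: irr_ncf_def)
  then show "\<exists>z\<in>SIGMA p : {a..<b} \<times> {..e}. ncf a (fst p) (snd p) \<times> irr_ncf (fst p) b (e - snd p).
      F = (case z of (p, F1, F2) \<Rightarrow> F1 \<union> F2)"
    using q n1 c U by (intro bexI[of _ "((q, card F1), F1, F2)"]) auto
qed

text \<open>As \<open>a + 1\<close> is not a cut, some edge starts at \<open>a\<close>;
  \<open>j\<close> is the farthest neighbour. An edge passing over \<open>j\<close> would cross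
  \<open>{a, j}\<close> or, starting at \<open>a\<close>, contradict the choice of \<open>j\<close>.
  A cut of the part beyond \<open>j\<close> would therefore cut all of \<open>F\<close>.\<close>

lemma irr_ncf_neighbour:
  assumes F: "\<And>x. x \<in> F \<Longrightarrow> x \<subseteq> {a..<b} \<and> card x = 2" and nc: "non_crossing F"
    and irr: "\<And>q. a < q \<Longrightarrow> q < b \<Longrightarrow> \<not> splits_at q F" and ab: "Suc a < b"
  obtains j where "a < j" "j < b" "{a, j} \<in> F" "\<And>i. {a, i} \<in> F \<Longrightarrow> i \<le> j"
    "\<And>x. x \<in> F \<Longrightarrow> x \<subseteq> {..j} \<or> x \<subseteq> {j..}"
    "\<And>q. j < q \<Longrightarrow> q < b \<Longrightarrow> \<not> splits_at q {x \<in> F. x \<subseteq> {j..}}"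
proof -
  let ?N = "{i. {a, i} \<in> F}"
  have "\<not> splits_at (Suc a) F" using irr[of "Suc a"] ab by simp
  then obtain x where x: "x \<in> F" "\<not> x \<subseteq> {..<Suc a}" "\<not> x \<subseteq> {Suc a..}" by (auto simp: splits_at_def)
  obtain u v where uv: "x = {u, v}" "u < v" using F[OF x(1)] edgeE by blast
  have "u = a" using uv x F[OF x(1)] by (auto simp: not_less_eq_eq)
  then have v: "v \<in> ?N" using uv x by simp
  have N: "?N \<subseteq> {a..<b}" using F by blast
  then have fin: "finite ?N" using finite_subset by blast
  define j where "j = Max ?N"
  have j: "{a, j} \<in> F" using Max_in[OF fin] v unfolding j_def by blast
  have jm: "i \<le> j" if "{a, i} \<in> F" for i using Max_ge[OF fin] that unfolding j_def by blast
  have aj: "a < j" using jm[of v] v uv \<open>u = a\<close> by simp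
  have jb: "j < b" using F[OF j] by simp
  have side: "x \<subseteq> {..j} \<or> x \<subseteq> {j..}" if xF: "x \<in> F" for x
  proof (rule ccontr)
    assume A: "\<not> (x \<subseteq> {..j} \<or> x \<subseteq> {j..})"
    obtain u v where uv: "x = {u, v}" "u < v" using F[OF xF] edgeE by blast
    then have uj: "u < j" "j < v" using A by auto
    have "u \<ge> a" using F[OF that] uv by simp
    moreover have "u \<noteq> a" using jm[of v] that uv uj by auto
    ultimately show False using nc j that uv uj unfolding non_crossing_def
      by (metis order_le_less)
  qed
  have "\<not> splits_at q {x \<in> F. x \<subseteq> {j..}}" if q: "j < q" "q < b" for q
  proof
    assume c: "splits_at q {x \<in> F. x \<subseteq> {j..}}"
    have "splits_at q F" unfolding splits_at_def
    proof
      fix x assume "x \<in> F"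
      then show "x \<subseteq> {..<q} \<or> x \<subseteq> {q..}" using side[of x] c q by (force simp: splits_at_def)
    qed
    then show False using irr[of q] q aj by simp
  qed
  then show ?thesis using that[of j] aj jb j jm side by blast
qed

text \<open>Longest edges followed one after the other lead from the first vertex to the
  last.\<close>

lemma irr_ncf_connected:
  assumes "\<And>x. x \<in> F \<Longrightarrow> x \<subseteq> {a..<b} \<and> card x = 2" "non_crossing F"
    "\<And>q. a < q \<Longrightarrow> q < b \<Longrightarrow> \<not> splits_at q F" "a < b"
  shows "(a, b - 1) \<in> (adj F)\<^sup>*"
  using assms
proof (induction "b - a" arbitrary: a F rule: less_induct)
  case less
  show ?case
  proof (cases "Suc a < b")
    case False
    then have "b - 1 = a" using less.prems(4) by simp
    then show ?thesis by simp
  next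
    case True
    obtain j where j: "a < j" "j < b" "{a, j} \<in> F"
      "\<And>q. j < q \<Longrightarrow> q < b \<Longrightarrow> \<not> splits_at q {x \<in> F. x \<subseteq> {j..}}"
      using irr_ncf_neighbour[OF less.prems(1-3) True] by metis
    let ?R = "{x \<in> F. x \<subseteq> {j..}}"
    have "(j, b - 1) \<in> (adj ?R)\<^sup>*"
    proof (rule less.hyps)
      show "b - j < b - a" using j by simp
      show "x \<subseteq> {j..<b} \<and> card x = 2" if "x \<in> ?R" for x
        using that less.prems(1)[of x] by force
      show "non_crossing ?R" by (rule non_crossing_subset[OF less.prems(2)]) auto
    qed (use j in auto)
    then have "(j, b - 1) \<in> (adj F)\<^sup>*" by (rule adj_rtrancl_mono[rotated]) auto
    moreover have "(a, j) \<in> adj F" using j by (simp add: adj_def)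
    ultimately show ?thesis by (rule converse_rtrancl_into_rtrancl[rotated])
  qed
qed

definition red_ncf :: "nat \<Rightarrow> nat \<Rightarrow> nat \<Rightarrow> nat set set set" where
  "red_ncf a b e = {F \<in> ncf a b e. \<exists>q. a < q \<and> q < b \<and> splits_at q F}"

lemma finite_red_ncf: "finite (red_ncf a b e)"
  by (rule finite_subset[OF _ finite_ncf]) (auto simp: red_ncf_def)

lemma card_red_ncf: "card (red_ncf a b e) + card (irr_ncf a b e) = card (ncf a b e)"
proof -
  have "ncf a b e = red_ncf a b e \<union> irr_ncf a b e" "red_ncf a b e \<inter> irr_ncf a b e = {}"
    by (auto simp: red_ncf_def irr_ncf_def)
  then show ?thesis using card_Un_disjoint[OF finite_red_ncf finite_irr_ncf] by metis
qed

lemma cut_split_ncf: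
  assumes M: "M \<in> ncf a b e" and c: "splits_at q M"
  defines "M1 \<equiv> {x \<in> M. x \<subseteq> {..<q}}" and "M2 \<equiv> {x \<in> M. x \<subseteq> {q..}}"
  shows "M = M1 \<union> M2" "M1 \<in> ncf a q (card M1)" "M2 \<in> ncf q b (card M2)"
proof -
  show "M = M1 \<union> M2" using c by (auto simp: M1_def M2_def splits_at_def)
  show "M1 \<in> ncf a q (card M1)"
    by (rule ncf_restrict[OF M, of _ "{..<q}"]) (auto simp: M1_def)
  show "M2 \<in> ncf q b (card M2)"
    by (rule ncf_restrict[OF M, of _ "{q..}"]) (auto simp: M2_def)
qed

text \<open>With \<open>M\<close> cut into \<open>M1\<close> and \<open>M2\<close>, the new edge
  meets \<open>M1\<close> only in \<open>a\<close>, and the result meets \<open>M2\<close> only in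
  \<open>j\<close>: two gluings at a vertex show acyclicity.\<close>

lemma red_ncf_close_ncf:
  assumes M: "M \<in> red_ncf a (Suc j) e" and aj: "a < j"
  shows "insert {a, j} M \<in> ncf a (Suc j) (Suc e)" "{a, j} \<notin> M"
proof -
  obtain q where q: "a < q" "q \<le> j" "splits_at q M" and N: "M \<in> ncf a (Suc j) e"
    using M by (auto simp: red_ncf_def)
  show nin: "{a, j} \<notin> M" using q by (auto simp: splits_at_def)
  obtain M1 M2 where M12: "M = M1 \<union> M2" "M1 \<in> ncf a q (card M1)" "M2 \<in> ncf q (Suc j) (card M2)"
    using cut_split_ncf[OF N q(3)] by blast
  have "acyc (M1 \<union> {{a, j}})"
  proof (rule acyc_glue[of _ _ "{a..<q}" "{a, j}" a])
    show "{a..<q} \<inter> {a, j} \<subseteq> {a}" using q by auto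
    show "acyc {{a, j}}" using aj by (intro acyc_singleton) simp
  qed (use ncf_acyc[OF M12(2)] ncf_edge[OF M12(2)] in auto)
  then have "acyc ((M1 \<union> {{a, j}}) \<union> M2)"
  proof (rule acyc_glue[of _ _ "{a..<q} \<union> {j}" "{q..<Suc j}" j])
    show "({a..<q} \<union> {j}) \<inter> {q..<Suc j} \<subseteq> {j}" by auto
    show "x \<subseteq> {a..<q} \<union> {j}" if "x \<in> M1 \<union> {{a, j}}" for x
      using that ncf_edge(1)[OF M12(2), of x] q by auto
  qed (use ncf_acyc[OF M12(3)] ncf_edge[OF M12(3)] in auto)
  then have ac: "acyc (insert {a, j} M)" using M12(1) by (simp add: Un_commute insert_commute)
  have "non_crossing (insert {a, j} M)"
    unfolding non_crossing_def
  proof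
    assume "\<exists>s t u v. {s, t} \<in> insert {a, j} M \<and> {u, v} \<in> insert {a, j} M \<and> s < u \<and> u < t \<and> t < v"
    then obtain s t u v where *: "{s, t} \<in> insert {a, j} M" "{u, v} \<in> insert {a, j} M"
      "s < u" "u < t" "t < v" by blast
    have b: "a \<le> s" "v \<le> j"
      using * ncf_edge(1)[OF N, of "{s, t}"] ncf_edge(1)[OF N, of "{u, v}"] aj
      by (auto simp: doubleton_eq_iff)
    then have "{s, t} \<in> M" "{u, v} \<in> M" using * by (auto simp: doubleton_eq_iff)
    then show False using ncf_non_crossing[OF N] * unfolding non_crossing_def by blast
  qed
  moreover have "card (insert {a, j} M) = Suc e"
    using nin ncf_finite[OF N] ncf_card[OF N] by simp
  moreover have "x \<subseteq> {a..<Suc j} \<and> card x = 2" if "x \<in> insert {a, j} M" for x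
    using that ncf_edge[OF N, of x] aj by auto
  ultimately show "insert {a, j} M \<in> ncf a (Suc j) (Suc e)" using ac by (auto simp: ncf_def)
qed

text \<open>Were there no cut below \<open>{a, j}\<close>, the remaining edges would connect
  \<open>a\<close> with \<open>j\<close> by \<open>irr_ncf_connected\<close>, and
  \<open>{a, j}\<close> would not be a bridge.\<close>

lemma ncf_open_red_ncf:
  assumes F: "F \<in> ncf a b e" and e: "{a, j} \<in> F" "a < j"
  shows "{x \<in> F. x \<subseteq> {..j}} - {{a, j}} \<in> red_ncf a (Suc j) (card ({x \<in> F. x \<subseteq> {..j}} - {{a, j}}))"
proof -
  let ?M = "{x \<in> F. x \<subseteq> {..j}} - {{a, j}}"
  have N: "?M \<in> ncf a (Suc j) (card ?M)"
    by (rule ncf_restrict[OF F, of _ "{..j}"]) auto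
  have "\<exists>q. a < q \<and> q < Suc j \<and> splits_at q ?M"
  proof (rule ccontr)
    assume "\<not> ?thesis"
    then have "(a, Suc j - 1) \<in> (adj ?M)\<^sup>*"
      using ncf_edge[OF N] ncf_non_crossing[OF N] e(2)
      by (intro irr_ncf_connected[where b = "Suc j"]) auto
    then have "(a, j) \<in> (adj (F - {{a, j}}))\<^sup>*"
      by (intro adj_rtrancl_mono[of ?M "F - {{a, j}}"]) auto
    then show False using ncf_acyc[OF F] e by (auto simp: acyc_def)
  qed
  then show ?thesis using N by (simp add: red_ncf_def)
qed

text \<open>The combinatorial form of \<open>U = 1 + yzAU^3\<close>: \<open>j\<close> is the
  farthest neighbour of \<open>a\<close>, \<open>M\<close> stands below \<open>{a, j}\<close> and
  \<open>R\<close> beyond it. The two pieces share the vertex \<open>j\<close>; the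
  \<open>Suc\<close> pays for the edge \<open>{a, j}\<close>.\<close>

lemma irr_ncf_decompose:
  assumes "Suc a < b"
  shows "bij_betw (\<lambda>(p, M, R). insert {a, fst p} (M \<union> R))
    (SIGMA p : {p \<in> {a<..<b} \<times> {..e}. Suc (snd p) \<le> e}.
       red_ncf a (Suc (fst p)) (snd p) \<times> irr_ncf (fst p) b (e - Suc (snd p))) (irr_ncf a b e)"
proof (rule bij_betwI')
  let ?D = "SIGMA p : {p \<in> {a<..<b} \<times> {..e}. Suc (snd p) \<le> e}.
       red_ncf a (Suc (fst p)) (snd p) \<times> irr_ncf (fst p) b (e - Suc (snd p))"
  fix z z' assume zz: "z \<in> ?D" "z' \<in> ?D"
  obtain j e1 M R where z: "z = ((j, e1), M, R)" by (cases z) auto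
  obtain j' e1' M' R' where z': "z' = ((j', e1'), M', R')" by (cases z') auto
  have j: "a < j" "j < b" "M \<in> red_ncf a (Suc j) e1" "R \<in> irr_ncf j b (e - Suc e1)" using zz z by auto
  have j': "a < j'" "j' < b" "M' \<in> red_ncf a (Suc j') e1'" "R' \<in> irr_ncf j' b (e - Suc e1')" using zz z' by auto
  have split: "j = Max {i. {a, i} \<in> G} \<and> M = {x \<in> G. x \<subseteq> {..j}} - {{a, j}} \<and> R = {x \<in> G. x \<subseteq> {j..}}"
    if "a < j" "j < b" "M \<in> red_ncf a (Suc j) e1" "R \<in> irr_ncf j b e2" "G = insert {a, j} (M \<union> R)"
    for j M R e1 e2 G
  proof -
    have M: "M \<in> ncf a (Suc j) e1" and R: "R \<in> ncf j b e2" using that by (auto simp: red_ncf_def irr_ncf_def)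
    have Mx: "x \<subseteq> {a..j}" "card x = 2" if "x \<in> M" for x using ncf_edge[OF M that] by force+
    have Rx: "x \<subseteq> {j..<b}" "card x = 2" if "x \<in> R" for x using ncf_edge[OF R that] by auto
    have nM: "{a, j} \<notin> M" using red_ncf_close_ncf(2)[OF that(3,1)] .
    have 1: "Max {i. {a, i} \<in> G} = j"
    proof (rule Max_eqI)
      have "{i. {a, i} \<in> G} \<subseteq> {..b}" using that(2,5) Mx Rx by fastforce
      then show "finite {i. {a, i} \<in> G}" using finite_subset by blast
      show "i \<le> j" if "i \<in> {i. {a, i} \<in> G}" for i
        using that \<open>G = _\<close> Mx(1)[of "{a, i}"] Rx(1)[of "{a, i}"] \<open>a < j\<close> by (auto simp: doubleton_eq_iff)
    qed (use that in simp)
    have excl: "\<not> (x \<subseteq> {..j} \<and> x \<subseteq> {j..})" if "card x = 2" for x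
    proof
      assume "x \<subseteq> {..j} \<and> x \<subseteq> {j..}"
      then have "x \<subseteq> {j}" by force
      then have "card x \<le> card {j}" by (intro card_mono) auto
      then show False using that by simp
    qed
    have "x \<subseteq> {..j}" "\<not> x \<subseteq> {j..}" if "x \<in> M" for x using Mx[OF that] excl[of x] by force+
    moreover have "x \<subseteq> {j..}" "\<not> x \<subseteq> {..j}" if "x \<in> R" for x using Rx[OF that] excl[of x] by force+
    moreover have "\<not> {a, j} \<subseteq> {j..}" using that(1) by simp
    moreover have "{a, j} \<notin> R" using Rx(1)[of "{a, j}"] that(1) by auto
    ultimately show ?thesis using 1 nM that(5) by blast
  qed
  show "((case z of (p, M, R) \<Rightarrow> insert {a, fst p} (M \<union> R)) = (case z' of (p, M, R) \<Rightarrow> insert {a, fst p} (M \<union> R))) = (z = z')"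
  proof
    assume "(case z of (p, M, R) \<Rightarrow> insert {a, fst p} (M \<union> R)) = (case z' of (p, M, R) \<Rightarrow> insert {a, fst p} (M \<union> R))"
    then have eq: "insert {a, j} (M \<union> R) = insert {a, j'} (M' \<union> R')" using z z' by simp
    have "j = j'" "M = M'" "R = R'"
      using split[OF j refl] split[OF j' refl] unfolding eq by metis+
    moreover have "e1 = e1'"
      using j(3) j'(3) calculation by (auto simp: red_ncf_def ncf_def)
    ultimately show "z = z'" using z z' by simp
  qed simp
next
  fix z assume "z \<in> (SIGMA p : {p \<in> {a<..<b} \<times> {..e}. Suc (snd p) \<le> e}.
       red_ncf a (Suc (fst p)) (snd p) \<times> irr_ncf (fst p) b (e - Suc (snd p)))"
  then obtain j e1 M R where z: "z = ((j, e1), M, R)" "a < j" "j < b" "Suc e1 \<le> e"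
    "M \<in> red_ncf a (Suc j) e1" "R \<in> irr_ncf j b (e - Suc e1)" by auto
  have R: "R \<in> ncf j b (e - Suc e1)" using z by (simp add: irr_ncf_def)
  have "insert {a, j} M \<union> R \<in> ncf a b (Suc e1 + (e - Suc e1))"
    using z by (intro ncf_glue(1)[OF red_ncf_close_ncf(1)[OF z(5,2)] R]) auto
  then have N: "insert {a, j} (M \<union> R) \<in> ncf a b e" using z(4) by simp
  have "\<not> splits_at q (insert {a, j} (M \<union> R))" if q: "a < q" "q < b" for q
  proof (cases "q \<le> j")
    case True
    then show ?thesis using q by (auto simp: splits_at_def)
  next
    case False
    then have "\<not> splits_at q R" using z(6) q by (auto simp: irr_ncf_def)
    then show ?thesis by (auto simp: splits_at_def)
  qed
  then show "(case z of (p, M, R) \<Rightarrow> insert {a, fst p} (M \<union> R)) \<in> irr_ncf a b e"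
    using N z by (auto simp: irr_ncf_def)
next
  fix F assume F: "F \<in> irr_ncf a b e"
  then have N: "F \<in> ncf a b e" by (simp add: irr_ncf_def)
  obtain j where j: "a < j" "j < b" "{a, j} \<in> F" "\<And>x. x \<in> F \<Longrightarrow> x \<subseteq> {..j} \<or> x \<subseteq> {j..}"
    "\<And>q. j < q \<Longrightarrow> q < b \<Longrightarrow> \<not> splits_at q {x \<in> F. x \<subseteq> {j..}}"
  proof (rule irr_ncf_neighbour[OF _ ncf_non_crossing[OF N] _ assms])
    show "x \<subseteq> {a..<b} \<and> card x = 2" if "x \<in> F" for x using ncf_edge[OF N that] by simp
    show "\<not> splits_at q F" if "a < q" "q < b" for q using F that by (simp add: irr_ncf_def)
  qed blast+
  define M where "M = {x \<in> F. x \<subseteq> {..j}} - {{a, j}}"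
  define R where "R = {x \<in> F. x \<subseteq> {j..}}"
  have M: "M \<in> red_ncf a (Suc j) (card M)" unfolding M_def by (rule ncf_open_red_ncf[OF N j(3,1)])
  have "R \<in> ncf j b (card R)"
    by (rule ncf_restrict[OF N, of _ "{j..}"]) (auto simp: R_def)
  then have R: "R \<in> irr_ncf j b (card R)" using j(5) by (simp add: irr_ncf_def R_def)
  have U: "F = insert {a, j} (M \<union> R)" using j(3,4) by (auto simp: M_def R_def)
  have "insert {a, j} M \<inter> R = {}"
    using ncf_glue(2)[OF red_ncf_close_ncf(1)[OF M j(1)], of R j b "card R"] R j by (simp add: irr_ncf_def)
  then have "card F = card (insert {a, j} M) + card R"
    unfolding U using ncf_finite[OF N] U by (subst card_Un_disjoint[symmetric]) auto
  then have "e = Suc (card M) + card R"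
    using ncf_card[OF N] ncf_card[OF red_ncf_close_ncf(1)[OF M j(1)]] by simp
  then show "\<exists>z\<in>SIGMA p : {p \<in> {a<..<b} \<times> {..e}. Suc (snd p) \<le> e}.
       red_ncf a (Suc (fst p)) (snd p) \<times> irr_ncf (fst p) b (e - Suc (snd p)).
      F = (case z of (p, M, R) \<Rightarrow> insert {a, fst p} (M \<union> R))"
    using j M R U by (intro bexI[of _ "((j, card M), M, R)"]) auto
qed

section \<open>Transport along injective and monotone maps\<close>

lemma walk_in_image:
  assumes inj: "inj_on f W" and FW: "\<And>x. x \<in> F \<Longrightarrow> x \<subseteq> W" and u: "u \<in> W"
    and "(f u, y) \<in> (adj ((`) f ` F))\<^sup>*"
  shows "\<exists>v\<in>W. y = f v \<and> (u, v) \<in> (adj F)\<^sup>*"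
  using assms(4)
proof (induction rule: rtrancl_induct)
  case base
  then show ?case using u by blast
next
  case (step y z)
  then obtain v where v: "v \<in> W" "y = f v" "(u, v) \<in> (adj F)\<^sup>*" by blast
  obtain x where x: "x \<in> F" "{y, z} = f ` x" using step(2) by (auto simp: adj_def)
  obtain w where w: "w \<in> x" "z = f w" using x by blast
  have xW: "x \<subseteq> W" using FW x by blast
  have "f ` x = f ` {v, w}" using x v w by simp
  then have "x = {v, w}" using inj_on_image_eq_iff[OF inj xW, of "{v, w}"] v w xW by blast
  then have "(v, w) \<in> adj F" using x by (simp add: adj_def)
  then have "(u, w) \<in> (adj F)\<^sup>*" using v by (meson rtrancl_into_rtrancl)
  then show ?case using w xW by blast
qed

lemma acyc_image:
  assumes inj: "inj_on f W" and FW: "\<And>x. x \<in> F \<Longrightarrow> x \<subseteq> W" and ac: "acyc F"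
  shows "acyc ((`) f ` F)"
  unfolding acyc_def
proof (intro allI impI notI)
  fix u' v' assume e: "{u', v'} \<in> (`) f ` F" and w: "(u', v') \<in> (adj ((`) f ` F - {{u', v'}}))\<^sup>*"
  obtain x where x: "x \<in> F" "{u', v'} = f ` x" using e by blast
  obtain u v where uv: "u \<in> x" "u' = f u" "v \<in> x" "v' = f v" using x(2) by blast
  have xW: "x \<subseteq> W" using FW x by blast
  have "f ` x = f ` {u, v}" using x uv by simp
  then have xe: "x = {u, v}" using inj_on_image_eq_iff[OF inj xW, of "{u, v}"] uv xW by blast
  have "(`) f ` F - {{u', v'}} \<subseteq> (`) f ` (F - {x})" using x by auto
  from adj_rtrancl_mono[OF this w] have "(f u, f v) \<in> (adj ((`) f ` (F - {x})))\<^sup>*"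
    using uv by simp
  then obtain v2 where v2: "v2 \<in> W" "f v = f v2" "(u, v2) \<in> (adj (F - {x}))\<^sup>*"
    using walk_in_image[OF inj, of "F - {x}" u "f v"] FW uv xW by blast
  then have "v2 = v" using inj uv xW by (metis inj_onD subsetD)
  then show False using v2 ac x xe by (auto simp: acyc_def)
qed

lemma card_image_edges:
  assumes inj: "inj_on f W" and FW: "\<And>x. x \<in> F \<Longrightarrow> x \<subseteq> W"
  shows "card ((`) f ` F) = card F"
  by (rule card_image, rule inj_on_subset[OF inj_on_image_Pow[OF inj]]) (use FW in auto)

lemma ncf_image:
  assumes F: "F \<in> ncf a b e" and f: "strict_mono_on {a..<b} f" "f ` {a..<b} \<subseteq> {a'..<b'}"
  shows "(`) f ` F \<in> ncf a' b' e"
proof -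
  have inj: "inj_on f {a..<b}" using f(1) by (rule strict_mono_on_imp_inj_on)
  have less: "p < q" if "f p < f q" "p \<in> {a..<b}" "q \<in> {a..<b}" for p q
    using that strict_mono_onD[OF f(1)] by (metis linorder_neqE_nat not_less_iff_gr_or_eq)
  have "non_crossing ((`) f ` F)"
    unfolding non_crossing_def
  proof
    assume "\<exists>s t u v. {s, t} \<in> (`) f ` F \<and> {u, v} \<in> (`) f ` F \<and> s < u \<and> u < t \<and> t < v"
    then obtain s t u v where st: "{s, t} \<in> (`) f ` F" "{u, v} \<in> (`) f ` F"
      and o: "s < u" "u < t" "t < v" by blast
    obtain x where x: "{s, t} = f ` x" "x \<in> F" using st(1) by blast
    obtain y where y: "{u, v} = f ` y" "y \<in> F" using st(2) by blast
    note * = x(1) y(1) x(2) y(2) o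
    have xy: "x \<subseteq> {a..<b}" "y \<subseteq> {a..<b}" using ncf_edge(1)[OF F] * by auto
    obtain s' t' where s': "s' \<in> x" "t' \<in> x" "s = f s'" "t = f t'" using *(1) by blast
    obtain u' v' where u': "u' \<in> y" "v' \<in> y" "u = f u'" "v = f v'" using *(2) by blast
    have "f ` x = f ` {s', t'}" "f ` y = f ` {u', v'}" using s' u' *(1,2) by simp_all
    then have "x = {s', t'}" "y = {u', v'}"
      using inj_on_image_eq_iff[OF inj xy(1), of "{s', t'}"] inj_on_image_eq_iff[OF inj xy(2), of "{u', v'}"]
        s' u' xy by blast+
    moreover have "s' < u'" "u' < t'" "t' < v'" using less s' u' xy * by blast+
    ultimately show False using ncf_non_crossing[OF F] * unfolding non_crossing_def by blast
  qed
  moreover have "acyc ((`) f ` F)"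
    using acyc_image[OF inj, of F] ncf_edge(1)[OF F] ncf_acyc[OF F] by blast
  moreover have "card ((`) f ` F) = e"
    using card_image_edges[OF inj, of F] ncf_edge(1)[OF F] ncf_card[OF F] by simp
  moreover have "x \<subseteq> {a'..<b'} \<and> card x = 2" if xF: "x \<in> (`) f ` F" for x
  proof -
    obtain y where y: "y \<in> F" "x = f ` y" using xF by blast
    have "inj_on f y" using inj_on_subset[OF inj] ncf_edge(1)[OF F y(1)] by blast
    then show ?thesis using ncf_edge[OF F y(1)] y f(2) by (auto simp: card_image)
  qed
  ultimately show ?thesis by (auto simp: ncf_def)
qed

definition shift :: "nat \<Rightarrow> nat set set \<Rightarrow> nat set set" where
  "shift s F = (`) (\<lambda>i. i + s) ` F"

definition unshift :: "nat \<Rightarrow> nat set set \<Rightarrow> nat set set" where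
  "unshift s F = (`) (\<lambda>i. i - s) ` F"

lemma unshift_shift: "unshift s (shift s F) = F"
  by (simp add: shift_def unshift_def image_image)

lemma shift_unshift:
  assumes "\<And>x. x \<in> F \<Longrightarrow> x \<subseteq> {s..}"
  shows "shift s (unshift s F) = F"
proof -
  have "(\<lambda>i. i + s) ` (\<lambda>i. i - s) ` x = x" if "x \<in> F" for x
  proof -
    have "i - s + s = i" if "i \<in> x" for i using assms[OF \<open>x \<in> F\<close>] that by auto
    then show ?thesis by (simp add: image_image)
  qed
  then show ?thesis by (simp add: shift_def unshift_def image_image)
qed

lemma shift_ncf: "F \<in> ncf a b e \<Longrightarrow> shift s F \<in> ncf (a + s) (b + s) e"
  unfolding shift_def by (rule ncf_image) (auto intro: strict_mono_onI)

lemma unshift_ncf: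
  assumes "F \<in> ncf (a + s) (b + s) e"
  shows "unshift s F \<in> ncf a b e"
  unfolding unshift_def
proof (rule ncf_image[OF assms])
  show "(\<lambda>i. i - s) ` {a + s..<b + s} \<subseteq> {a..<b}" by auto
qed (auto intro!: strict_mono_onI)

lemma splits_at_shift: "splits_at (q + s) (shift s F) \<longleftrightarrow> splits_at q F"
proof -
  have "(\<lambda>i. i + s) ` x \<subseteq> {..<q + s} \<longleftrightarrow> x \<subseteq> {..<q}" "(\<lambda>i. i + s) ` x \<subseteq> {q + s..} \<longleftrightarrow> x \<subseteq> {q..}" for x
    by auto
  then show ?thesis by (simp add: splits_at_def shift_def)
qed

lemma bij_shift_ncf: "bij_betw (shift s) (ncf a b e) (ncf (a + s) (b + s) e)"
proof (rule bij_betw_byWitness[where f' = "unshift s"])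
  show "\<forall>F\<in>ncf (a + s) (b + s) e. shift s (unshift s F) = F"
  proof
    fix F assume "F \<in> ncf (a + s) (b + s) e"
    then have "x \<subseteq> {s..}" if "x \<in> F" for x using ncf_edge(1)[of F "a + s" "b + s" e x] that by force
    then show "shift s (unshift s F) = F" by (rule shift_unshift)
  qed
qed (auto simp: unshift_shift shift_ncf unshift_ncf)

lemma card_irr_ncf_shift: "card (irr_ncf (a + s) (b + s) e) = card (irr_ncf a b e)"
proof -
  have "shift s ` irr_ncf a b e = irr_ncf (a + s) (b + s) e"
  proof (intro equalityI subsetI)
    fix G assume "G \<in> shift s ` irr_ncf a b e"
    then obtain F where F: "F \<in> irr_ncf a b e" "G = shift s F" by blast
    have "\<not> splits_at q G" if q: "a + s < q" "q < b + s" for q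
    proof -
      have "a < q - s" "q - s < b" using q by auto
      then have "\<not> splits_at (q - s) F" using F by (auto simp: irr_ncf_def)
      then show ?thesis using F q splits_at_shift[of "q - s" s F] by simp
    qed
    then show "G \<in> irr_ncf (a + s) (b + s) e" using F shift_ncf by (auto simp: irr_ncf_def)
  next
    fix G assume G: "G \<in> irr_ncf (a + s) (b + s) e"
    then have "G \<in> shift s ` ncf a b e"
      using bij_betw_imp_surj_on[OF bij_shift_ncf, of s a b e] by (simp add: irr_ncf_def)
    then obtain F where F: "F \<in> ncf a b e" "G = shift s F" by blast
    have "\<not> splits_at q F" if "a < q" "q < b" for q
      using G that splits_at_shift[of q s F] F by (auto simp: irr_ncf_def)
    then show "G \<in> shift s ` irr_ncf a b e" using F by (auto simp: irr_ncf_def)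
  qed
  moreover have "inj_on (shift s) (irr_ncf a b e)"
    by (rule inj_onI) (metis unshift_shift)
  ultimately show ?thesis using card_image by fastforce
qed

section \<open>Numerical recurrences\<close>

definition num_ncf :: "nat \<Rightarrow> nat \<Rightarrow> nat" where "num_ncf n e = card (ncf 0 n e)"
text \<open>The empty forest on no vertices satisfies the condition of \<open>irr_ncf\<close>
  vacuously. The value 0 discards it, because the blocks of a sequence must be nonempty.\<close>

definition num_irr_ncf :: "nat \<Rightarrow> nat \<Rightarrow> nat" where "num_irr_ncf n e = (if n = 0 then 0 else card (irr_ncf 0 n e))"

lemma card_irr_ncf: "a < b \<Longrightarrow> card (irr_ncf a b e) = num_irr_ncf (b - a) e"
  using card_irr_ncf_shift[of 0 a "b - a" e] by (simp add: num_irr_ncf_def)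

lemma num_ncf_0: "num_ncf 0 e = (if e = 0 then 1 else 0)"
  by (simp add: num_ncf_def ncf_degenerate)

lemma num_ncf_1: "num_ncf (Suc 0) e = (if e = 0 then 1 else 0)"
  by (simp add: num_ncf_def ncf_degenerate)

lemma num_irr_ncf_0: "num_irr_ncf 0 e = 0"
  by (simp add: num_irr_ncf_def)

lemma num_irr_ncf_1: "num_irr_ncf (Suc 0) e = (if e = 0 then 1 else 0)"
proof -
  have "irr_ncf 0 (Suc 0) e = ncf 0 (Suc 0) e" by (auto simp: irr_ncf_def)
  then show ?thesis by (simp add: num_irr_ncf_def ncf_degenerate)
qed

lemma num_ncf_rec:
  assumes "0 < n"
  shows "num_ncf n e = (\<Sum>q<n. \<Sum>i\<le>e. num_ncf q i * num_irr_ncf (n - q) (e - i))"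
proof -
  have "num_ncf n e = card (SIGMA p : {0..<n} \<times> {..e}. ncf 0 (fst p) (snd p) \<times> irr_ncf (fst p) n (e - snd p))"
    unfolding num_ncf_def using bij_betw_same_card[OF ncf_decompose[OF assms]] by simp
  also have "\<dots> = (\<Sum>p\<in>{0..<n} \<times> {..e}. card (ncf 0 (fst p) (snd p) \<times> irr_ncf (fst p) n (e - snd p)))"
    by (rule card_SigmaI) (auto simp: finite_ncf finite_irr_ncf)
  also have "\<dots> = (\<Sum>(q, i)\<in>{..<n} \<times> {..e}. num_ncf q i * num_irr_ncf (n - q) (e - i))"
    by (rule sum.cong) (auto simp: card_cartesian_product num_ncf_def card_irr_ncf)
  finally show ?thesis by (simp add: sum.cartesian_product)
qed

text \<open>Each forest is weighted by the size of its last block; this weight will be the number of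
  admissible rotations in \<open>card_sym_set\<close>.\<close>

lemma sum_last_cut:
  assumes "0 < n"
  shows "(\<Sum>F\<in>ncf 0 n e. n - last_cut 0 n F) = (\<Sum>q<n. \<Sum>i\<le>e. (n - q) * (num_ncf q i * num_irr_ncf (n - q) (e - i)))"
proof -
  let ?D = "SIGMA p : {0..<n} \<times> {..e}. ncf 0 (fst p) (snd p) \<times> irr_ncf (fst p) n (e - snd p)"
  have "(\<Sum>F\<in>ncf 0 n e. n - last_cut 0 n F) = (\<Sum>z\<in>?D. n - last_cut 0 n (case z of (p, F1, F2) \<Rightarrow> F1 \<union> F2))"
    by (rule sum.reindex_bij_betw[OF ncf_decompose[OF assms], symmetric])
  also have "\<dots> = (\<Sum>z\<in>?D. n - fst (fst z))"
  proof (rule sum.cong[OF refl])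
    fix z assume "z \<in> ?D"
    then obtain q i F1 F2 where z: "z = ((q, i), F1, F2)" "q < n" "F1 \<in> ncf 0 q i" "F2 \<in> irr_ncf q n (e - i)"
      by auto
    then show "n - last_cut 0 n (case z of (p, F1, F2) \<Rightarrow> F1 \<union> F2) = n - fst (fst z)"
      using last_cut_glue(1)[of F1 0 q i F2 n "e - i"] by simp
  qed
  also have "\<dots> = (\<Sum>p\<in>{0..<n} \<times> {..e}. \<Sum>z\<in>ncf 0 (fst p) (snd p) \<times> irr_ncf (fst p) n (e - snd p). n - fst p)"
    by (subst sum.Sigma) (auto simp: finite_ncf finite_irr_ncf intro!: sum.cong)
  also have "\<dots> = (\<Sum>(q, i)\<in>{..<n} \<times> {..e}. (n - q) * (num_ncf q i * num_irr_ncf (n - q) (e - i)))"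
    by (rule sum.cong) (auto simp: card_cartesian_product num_ncf_def card_irr_ncf)
  finally show ?thesis by (simp add: sum.cartesian_product)
qed

lemma num_irr_ncf_rec:
  assumes "2 \<le> n"
  shows "num_irr_ncf n e = (\<Sum>j\<in>{0<..<n}. \<Sum>i<e. card (red_ncf 0 (Suc j) i) * num_irr_ncf (n - j) (e - Suc i))"
proof -
  let ?I = "{p \<in> {0<..<n} \<times> {..e}. Suc (snd p) \<le> e}"
  have n: "Suc 0 < n" using assms by simp
  have "num_irr_ncf n e = card (SIGMA p : ?I. red_ncf 0 (Suc (fst p)) (snd p) \<times> irr_ncf (fst p) n (e - Suc (snd p)))"
    unfolding num_irr_ncf_def using bij_betw_same_card[OF irr_ncf_decompose[OF n]] assms by simp
  also have "\<dots> = (\<Sum>p\<in>?I. card (red_ncf 0 (Suc (fst p)) (snd p) \<times> irr_ncf (fst p) n (e - Suc (snd p))))"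
    by (rule card_SigmaI) (auto simp: finite_red_ncf finite_irr_ncf)
  also have "\<dots> = (\<Sum>(j, i)\<in>{0<..<n} \<times> {..<e}. card (red_ncf 0 (Suc j) i) * num_irr_ncf (n - j) (e - Suc i))"
    by (rule sum.cong) (auto simp: card_cartesian_product card_irr_ncf)
  finally show ?thesis by (simp add: sum.cartesian_product)
qed

section \<open>Generating functions\<close>

unbundle fps_syntax

text \<open>The partial derivative in the inner variable \<open>y\<close>, which marks edges;
  \<open>fps_deriv\<close> differentiates in the outer variable \<open>z\<close>, which marks
  vertices.\<close>

definition fps_deriv_coeffs :: "'a::comm_ring_1 fps fps \<Rightarrow> 'a fps fps" where
  "fps_deriv_coeffs f = Abs_fps (\<lambda>n. fps_deriv (f $ n))"

lemma fps_deriv_coeffs_nth [simp]: "fps_deriv_coeffs f $ n = fps_deriv (f $ n)"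
  by (simp add: fps_deriv_coeffs_def)

lemma fps_deriv_coeffs_add: "fps_deriv_coeffs (f + g) = fps_deriv_coeffs f + fps_deriv_coeffs g"
  by (rule fps_ext) simp

lemma fps_deriv_coeffs_1: "fps_deriv_coeffs 1 = 0"
  by (rule fps_ext) simp

lemma fps_deriv_coeffs_mult:
  "fps_deriv_coeffs (f * g) = f * fps_deriv_coeffs g + fps_deriv_coeffs f * g"
  by (rule fps_ext) (simp add: fps_mult_nth fps_deriv_sum sum.distrib)

section \<open>The system for \<open>A\<close> and \<open>U\<close>: closed coefficients and a
  differential relation\<close>

locale forest_series =
  fixes A U :: "'a::field_char_0 fps fps"
  assumes A_eq: "A = 1 + fps_X * A * U"
    and U_eq: "U = 1 + fps_const fps_X * fps_X * A * U ^ 3"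
begin


abbreviation z :: "'a fps fps" where "z \<equiv> fps_X"
abbreviation y :: "'a fps fps" where "y \<equiv> fps_const fps_X"

text \<open>One factor is replaced by the right-hand side of its equation. In the coefficient form
  each new term has a smaller exponent or a smaller index, so these recurrences determine all mixed
  powers.\<close>

lemma power_rec_A: "A ^ Suc r * U ^ s = A ^ r * U ^ s + z * (A ^ Suc r * U ^ Suc s)"
proof -
  have "A ^ Suc r * U ^ s = A ^ r * U ^ s * A" by (simp add: mult_ac)
  also have "\<dots> = A ^ r * U ^ s * (1 + z * A * U)" by (rule arg_cong[OF A_eq, where f = "\<lambda>x. A ^ r * U ^ s * x"])
  also have "\<dots> = A ^ r * U ^ s + z * (A ^ Suc r * U ^ Suc s)" by (simp add: algebra_simps)
  finally show ?thesis .
qed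

lemma power_rec_U: "A ^ r * U ^ Suc s = A ^ r * U ^ s + y * (z * (A ^ Suc r * U ^ (s + 3)))"
proof -
  have "A ^ r * U ^ Suc s = A ^ r * U ^ s * U" by (simp add: mult_ac)
  also have "\<dots> = A ^ r * U ^ s * (1 + y * z * A * U ^ 3)" by (rule arg_cong[OF U_eq, where f = "\<lambda>x. A ^ r * U ^ s * x"])
  also have "\<dots> = A ^ r * U ^ s + y * (z * (A ^ Suc r * U ^ (s + 3)))"
    by (simp add: algebra_simps power_add)
  finally show ?thesis .
qed

lemma nth_rec_A:
  "(A ^ Suc r * U ^ s) $ Suc n $ e = (A ^ r * U ^ s) $ Suc n $ e + (A ^ Suc r * U ^ Suc s) $ n $ e"
  unfolding power_rec_A[of r s] by simp

lemma nth_rec_U: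
  "(A ^ r * U ^ Suc s) $ Suc n $ e =
     (A ^ r * U ^ s) $ Suc n $ e + (if e = 0 then 0 else (A ^ Suc r * U ^ (s + 3)) $ n $ (e - 1))"
  unfolding power_rec_U[of r s] by simp

lemma A_nth_0: "A $ 0 = 1"
  by (subst A_eq) (simp add: mult.assoc)

lemma U_nth_0: "U $ 0 = 1"
  by (subst U_eq) (simp add: mult.assoc)

text \<open>Obtained from Lagrange inversion; the recurrences only serve to verify it.\<close>
definition lagrange_coeff :: "nat \<Rightarrow> nat \<Rightarrow> nat \<Rightarrow> nat \<Rightarrow> 'a" where
  "lagrange_coeff r s n e = (of_nat r * (of_nat s + of_nat n - of_nat e) + of_nat s * of_nat e) *
     of_nat ((n + r) choose (e + r)) * of_nat ((s + n + 2*e) choose e) /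
     (of_nat (n + r) * of_nat (s + n + 2*e))"


text \<open>Absorption reduces the three upper binomials to the single one \<open>c\<close>; after
  cancelling \<open>d * c\<close> a rational identity in the parameters is left.\<close>

lemma lagrange_coeff_rec_U:
  assumes n: "0 < n" and e: "0 < e"
  shows "lagrange_coeff 0 (Suc s) n e = lagrange_coeff 0 s n e + lagrange_coeff 1 (s + 3) (n - 1) (e - 1)"
proof -
  obtain m where m: "n = Suc m" using n gr0_implies_Suc by blast
  obtain f where f: "e = Suc f" using e gr0_implies_Suc by blast
  define P where "P = s + n + 2 * f + 1"
  define c where "c = (of_nat (Suc P choose f) :: 'a)"
  define d where "d = (of_nat (n choose e) :: 'a)"
  have P: "s + n + 2 * e = Suc P" "Suc s + n + 2 * e = Suc (Suc P)" "s + 3 + (n - 1) + 2 * (e - 1) = Suc P"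
    by (auto simp: P_def f m)
  have PR: "(of_nat P :: 'a) = of_nat s + of_nat m + 2 * of_nat f + 2"
    by (simp add: P_def m)
  have 1: "of_nat e * of_nat (Suc (Suc P) choose e) = of_nat (Suc (Suc P)) * c"
    unfolding c_def f using Suc_times_binomial_eq[of "Suc P" f] by (metis of_nat_mult mult.commute)
  have 2: "of_nat e * of_nat (Suc P choose e) = of_nat (Suc P) * (of_nat (P choose f) :: 'a)"
    unfolding f using Suc_times_binomial_eq[of P f] by (metis of_nat_mult mult.commute)
  have le: "f \<le> Suc P" by (simp add: P_def)
  have "(Suc P - f) * (Suc P choose f) = Suc P * (P choose f)"
    using binomial_absorb_comp[of "Suc P" f] by simp
  then have 3: "of_nat (Suc P) * (of_nat (P choose f) :: 'a) = (of_nat (Suc P) - of_nat f) * c"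
    unfolding c_def using le by (metis of_nat_diff of_nat_mult)
  have nz: "(of_nat (Suc P) :: 'a) \<noteq> 0" "(of_nat (Suc (Suc P)) :: 'a) \<noteq> 0" "(of_nat n :: 'a) \<noteq> 0"
    using n by (simp_all only: of_nat_eq_0_iff)
  have "lagrange_coeff 0 (Suc s) n e = of_nat (Suc s) * d * (of_nat e * of_nat (Suc (Suc P) choose e)) / (of_nat n * of_nat (Suc (Suc P)))"
    by (simp add: lagrange_coeff_def P d_def del: of_nat_Suc binomial_Suc_Suc)
  also have "\<dots> = of_nat (Suc s) * d * c / of_nat n"
    unfolding 1 using nz by (simp del: of_nat_Suc)
  finally have L: "lagrange_coeff 0 (Suc s) n e = of_nat (Suc s) * d * c / of_nat n" .
  have "lagrange_coeff 0 s n e = of_nat s * d * (of_nat e * of_nat (Suc P choose e)) / (of_nat n * of_nat (Suc P))"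
    by (simp add: lagrange_coeff_def P d_def del: of_nat_Suc binomial_Suc_Suc)
  also have "\<dots> = of_nat s * d * (of_nat (Suc P) - of_nat f) * c / (of_nat n * of_nat (Suc P))"
    unfolding 2 3 by (simp del: of_nat_Suc)
  finally have R1: "lagrange_coeff 0 s n e = of_nat s * d * (of_nat (Suc P) - of_nat f) * c / (of_nat n * of_nat (Suc P))" .
  have "lagrange_coeff 1 (s + 3) (n - 1) (e - 1) = (of_nat (s + 3) + of_nat m - of_nat f + of_nat (s + 3) * of_nat f) * d * c / (of_nat n * of_nat (Suc P))"
    unfolding lagrange_coeff_def P d_def c_def by (simp add: m f del: of_nat_Suc binomial_Suc_Suc)
  then show ?thesis
    unfolding L R1 using nz by (simp add: divide_simps del: of_nat_Suc) (simp add: PR m algebra_simps)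
qed

text \<open>The sum \<open>s + n\<close> is the same in all three terms, hence the common factor
  \<open>D\<close>; the other binomials are reduced to \<open>c\<close>.\<close>

lemma lagrange_coeff_rec_A:
  assumes n: "0 < n"
  shows "lagrange_coeff (Suc r) s n e = lagrange_coeff r s n e + lagrange_coeff (Suc r) (Suc s) (n - 1) e"
proof -
  obtain m where m: "n = Suc m" using n gr0_implies_Suc by blast
  define N where "N = s + n + 2 * e"
  define p where "p = n + r"
  define x where "x = e + r"
  define c where "c = (of_nat (p choose x) :: 'a)"
  define D where "D = (of_nat (N choose e) :: 'a) / of_nat N"
  have N: "Suc s + (n - 1) + 2 * e = N" by (simp add: N_def m)
  have xs: "(of_nat (Suc x) :: 'a) \<noteq> 0" "(of_nat p :: 'a) \<noteq> 0" "(of_nat (Suc p) :: 'a) \<noteq> 0"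
    by (simp_all only: of_nat_eq_0_iff) (simp_all add: p_def m)
  have "of_nat (Suc x) * of_nat (Suc p choose Suc x) = of_nat (Suc p) * c"
    unfolding c_def using Suc_times_binomial_eq[of p x] by (metis of_nat_mult mult.commute)
  then have 1: "of_nat (Suc p choose Suc x) / of_nat (Suc p) = c / of_nat (Suc x)"
    using xs by (simp add: field_simps del: of_nat_Suc binomial_Suc_Suc)
  have 2: "of_nat (p choose Suc x) = (of_nat p - of_nat x) * c / of_nat (Suc x)"
  proof (cases "x \<le> p")
    case True
    have "Suc x * (p choose Suc x) = (p - x) * (p choose x)"
    proof -
      have "Suc x * (p choose Suc x) = p * ((p - 1) choose x)"
        using binomial_absorption[of x p] .
      then show ?thesis using binomial_absorb_comp[of p x] by simp
    qed
    then have "of_nat (Suc x) * of_nat (p choose Suc x) = (of_nat p - of_nat x) * c"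
      unfolding c_def using True by (metis of_nat_diff of_nat_mult)
    then show ?thesis using xs by (simp add: field_simps del: of_nat_Suc)
  next
    case False
    then show ?thesis by (simp add: c_def binomial_eq_0)
  qed
  let ?K = "of_nat s + of_nat n - of_nat e :: 'a"
  have L: "lagrange_coeff (Suc r) s n e = (of_nat (Suc r) * ?K + of_nat s * of_nat e) * (c / of_nat (Suc x)) * D"
    unfolding 1[symmetric] lagrange_coeff_def N_def[symmetric] D_def by (simp add: p_def x_def del: of_nat_Suc binomial_Suc_Suc)
  have R1: "lagrange_coeff r s n e = (of_nat r * ?K + of_nat s * of_nat e) * c / of_nat p * D"
    unfolding lagrange_coeff_def N_def[symmetric] D_def by (simp add: p_def x_def c_def)
  have R2: "lagrange_coeff (Suc r) (Suc s) (n - 1) e = (of_nat (Suc r) * ?K + of_nat (Suc s) * of_nat e) * ((of_nat p - of_nat x) * c / of_nat (Suc x)) / of_nat p * D"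
    unfolding lagrange_coeff_def N D_def 2[symmetric] by (simp add: p_def x_def m del: binomial_Suc_Suc)
  show ?thesis
    unfolding L R1 R2 using xs
    by (simp add: divide_simps del: of_nat_Suc) (simp add: p_def x_def algebra_simps)
qed

text \<open>If \<open>n = 0\<close> and \<open>r\<close> or \<open>s\<close> is 0, a denominator
  vanishes at \<open>e = 0\<close> and the formula gives 0 instead of 1. The recurrences respect the
  hypothesis: they refer to a smaller \<open>n\<close> only with both exponents positive.\<close>

lemma nth_closed:
  assumes "0 < n \<or> 0 < r \<and> 0 < s"
  shows "(A ^ r * U ^ s) $ n $ e = lagrange_coeff r s n e"
  using assms
proof (induction n arbitrary: r s e)
  case 0
  then show ?case by (cases "e = 0") (auto simp: fps_nth_power_0 A_nth_0 U_nth_0 lagrange_coeff_def binomial_eq_0)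
next
  case (Suc n)
  note IH = Suc.IH
  have base: "U ^ s $ Suc n $ e = lagrange_coeff 0 s (Suc n) e" for s e
  proof (induction s)
    case 0
    then show ?case by (simp add: lagrange_coeff_def)
  next
    case (Suc s)
    show ?case
    proof (cases "e = 0")
      case True
      then show ?thesis using nth_rec_U[of 0 s n e] Suc by (simp add: lagrange_coeff_def)
    next
      case False
      then show ?thesis
        using nth_rec_U[of 0 s n e] Suc lagrange_coeff_rec_U[of "Suc n" e s] Suc.IH IH[of 1 "s + 3" "e - 1"] by simp
    qed
  qed
  show ?case
  proof (induction r)
    case 0
    show ?case using base by simp
  next
    case (Suc r)
    then show ?case
      using nth_rec_A[of r s n e] lagrange_coeff_rec_A[of "Suc n" r s e] IH[of "Suc r" "Suc s" e] by simp
  qed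
qed


text \<open>The Euler derivatives in \<open>z\<close> and in \<open>y\<close> both satisfy linear
  systems obtained from the two equations; after eliminating the derivative of \<open>A\<close>,
  that of \<open>U\<close> has the same coefficient \<kappa> in both. Comparing gives
  \<open>Uz = A * Uy\<close>, and the relation follows. In coefficients: the last blocks of all
  forests with \<open>m > 0\<close> vertices and \<open>e\<close> edges have together
  \<open>e + 1\<close> times as many vertices as there are such forests.\<close>

lemma deriv_relation:
  "z * fps_deriv (z * U) * A = A - 1 + y * fps_deriv_coeffs A"
proof -
  define Az where "Az = z * fps_deriv A"
  define Uz where "Uz = z * fps_deriv U"
  define Ay where "Ay = y * fps_deriv_coeffs A"
  define Uy where "Uy = y * fps_deriv_coeffs U"
  define \<kappa> where "\<kappa> = 1 - y * z * (3 * A * U ^ 2 + z * A ^ 2 * U ^ 3)"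
  have y1: "fps_deriv_coeffs y = (1 :: 'a fps fps)"
    by (rule fps_ext) simp
  have z0: "fps_deriv_coeffs z = (0 :: 'a fps fps)"
    by (rule fps_ext) (simp add: fps_X_def)
  have A1: "z * A * U = A - 1" using A_eq by (metis add_diff_cancel_left')
  have U1: "y * z * A * U ^ 3 = U - 1" using U_eq by (metis add_diff_cancel_left')
  have U3: "U ^ 3 = U * U * U" by (simp add: power3_eq_cube)
  have "fps_deriv A = fps_deriv (1 + z * A * U)" using A_eq by metis
  then have "Az = z * fps_deriv (1 + z * A * U)" by (simp add: Az_def)
  also have "\<dots> = z * A * U + z * (Az * U + A * Uz)"
    by (simp add: Az_def Uz_def algebra_simps)
  finally have Az: "Az = z * A * U + z * (Az * U + A * Uz)" .
  have "fps_deriv U = fps_deriv (1 + y * z * A * U ^ 3)" using U_eq by metis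
  then have "Uz = z * fps_deriv (1 + y * z * A * U ^ 3)" by (simp add: Uz_def)
  also have "\<dots> = y * z * A * U ^ 3 + y * z * (Az * U ^ 3 + 3 * A * U ^ 2 * Uz)"
    unfolding U3 power2_eq_square by (simp add: Az_def Uz_def algebra_simps)
  finally have Uz: "Uz = y * z * A * U ^ 3 + y * z * (Az * U ^ 3 + 3 * A * U ^ 2 * Uz)" .
  have "fps_deriv_coeffs A = fps_deriv_coeffs (1 + z * A * U)" using A_eq by metis
  then have "Ay = y * fps_deriv_coeffs (1 + z * A * U)" by (simp add: Ay_def)
  also have "\<dots> = z * (Ay * U + A * Uy)"
    by (simp add: Ay_def Uy_def fps_deriv_coeffs_add fps_deriv_coeffs_mult fps_deriv_coeffs_1 z0 algebra_simps)
  finally have Ay: "Ay = z * (Ay * U + A * Uy)" .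
  have "fps_deriv_coeffs U = fps_deriv_coeffs (1 + y * z * A * U ^ 3)" using U_eq by metis
  then have "Uy = y * fps_deriv_coeffs (1 + y * z * A * U ^ 3)" by (simp add: Uy_def)
  also have "\<dots> = y * z * A * U ^ 3 + y * z * (Ay * U ^ 3 + 3 * A * U ^ 2 * Uy)"
    unfolding U3 power2_eq_square
    by (simp add: Ay_def Uy_def fps_deriv_coeffs_add fps_deriv_coeffs_mult fps_deriv_coeffs_1 z0 y1 algebra_simps)
  finally have Uy: "Uy = y * z * A * U ^ 3 + y * z * (Ay * U ^ 3 + 3 * A * U ^ 2 * Uy)" .
  have Az': "Az = z * A ^ 2 * U + z * A ^ 2 * Uz" using Az A1 by algebra
  have Ay': "Ay = z * A ^ 2 * Uy" using Ay A1 by algebra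
  have "\<kappa> * Uz = \<kappa> * (A * Uy)" unfolding \<kappa>_def using Uz Uy Az' Ay' A1 by algebra
  moreover have "\<kappa> \<noteq> 0"
  proof -
    have "\<kappa> $ 0 = 1" by (simp add: \<kappa>_def mult.assoc)
    then show ?thesis by auto
  qed
  ultimately have "Uz = A * Uy" by simp
  moreover have "z * fps_deriv (z * U) * A = z * A * U + z * A * Uz"
    by (simp add: Uz_def algebra_simps)
  ultimately have "z * fps_deriv (z * U) * A = A - 1 + Ay" using A1 Ay' by algebra
  then show ?thesis by (simp add: Ay_def)
qed

end

section \<open>The series of the non-crossing forests\<close>

definition forest_fps :: "real fps fps" where
  "forest_fps = Abs_fps (\<lambda>n. Abs_fps (\<lambda>e. real (num_ncf n e)))"

definition irr_fps :: "real fps fps" where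
  "irr_fps = Abs_fps (\<lambda>n. Abs_fps (\<lambda>e. real (num_irr_ncf n e)))"

lemma forest_fps_nth: "forest_fps $ n $ e = real (num_ncf n e)"
  and irr_fps_nth: "irr_fps $ n $ e = real (num_irr_ncf n e)"
  by (simp_all add: forest_fps_def irr_fps_def)

lemma forest_fps_eq: "forest_fps = 1 + forest_fps * irr_fps"
proof (intro fps_ext)
  fix n e
  show "forest_fps $ n $ e = (1 + forest_fps * irr_fps) $ n $ e"
  proof (cases "n = 0")
    case True
    then show ?thesis
      by (simp add: forest_fps_nth irr_fps_nth num_ncf_0 fps_mult_nth num_irr_ncf_0)
  next
    case False
    have "(forest_fps * irr_fps) $ n $ e
        = (\<Sum>q=0..n. \<Sum>i=0..e. real (num_ncf q i) * real (num_irr_ncf (n - q) (e - i)))"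
      by (simp add: fps_mult_nth fps_sum_nth forest_fps_nth irr_fps_nth)
    also have "\<dots> = (\<Sum>q\<in>insert n {..<n}. \<Sum>i\<le>e. real (num_ncf q i) * real (num_irr_ncf (n - q) (e - i)))"
      by (rule sum.cong) (auto simp: atMost_atLeast0)
    also have "\<dots> = real (num_ncf n e)"
      using False by (simp add: num_ncf_rec num_irr_ncf_0)
    finally show ?thesis using False by (simp add: forest_fps_nth)
  qed
qed

definition red_fps :: "real fps fps" where
  "red_fps = forest_fps - 1 - irr_fps"

lemma red_fps_nth: "0 < n \<Longrightarrow> red_fps $ n $ e = real (card (red_ncf 0 n e))"
  using card_red_ncf[of 0 n e] by (simp add: red_fps_def forest_fps_nth irr_fps_nth num_ncf_def num_irr_ncf_def)

lemma red_fps_0: "red_fps $ 0 = 0" and red_fps_1: "red_fps $ Suc 0 = 0"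
  by (rule fps_ext; simp add: red_fps_def forest_fps_nth irr_fps_nth num_ncf_0 num_ncf_1 num_irr_ncf_0 num_irr_ncf_1)+

text \<open>The factor \<open>fps_X\<close> on the left makes up for the vertex \<open>j\<close>
  that occurs in both pieces; \<open>fps_X ^ 2\<close> comes from the single vertex.\<close>

lemma irr_fps_eq: "fps_X * irr_fps = fps_X ^ 2 + fps_const fps_X * (red_fps * irr_fps)"
proof (intro fps_ext)
  fix n e
  show "(fps_X * irr_fps) $ n $ e = (fps_X ^ 2 + fps_const fps_X * (red_fps * irr_fps)) $ n $ e"
  proof (cases "n \<ge> 3")
    case False
    have i0: "irr_fps $ 0 = 0" by (rule fps_ext) (simp add: irr_fps_nth num_irr_ncf_0)
    have i1: "irr_fps $ Suc 0 = 1" by (rule fps_ext) (simp add: irr_fps_nth num_irr_ncf_1)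
    from False consider "n = 0" | "n = 1" | "n = 2" by linarith
    then show ?thesis
      by cases (auto simp: fps_mult_nth fps_X_power_iff red_fps_0 red_fps_1 i0 i1 atLeast0_atMost_Suc numeral_2_eq_2)
  next
    case True
    then obtain m where m: "n = Suc m" "2 \<le> m" by (cases n) auto
    have conv: "(red_fps * irr_fps) $ n $ f = (\<Sum>j\<in>{0<..<m}. \<Sum>i\<le>f. real (card (red_ncf 0 (Suc j) i)) * real (num_irr_ncf (m - j) (f - i)))" for f
    proof -
      have "(red_fps * irr_fps) $ n = (\<Sum>k=0..n. red_fps $ k * irr_fps $ (n - k))"
        by (simp add: fps_mult_nth)
      also have "\<dots> = (\<Sum>k\<in>Suc ` {0<..<m}. red_fps $ k * irr_fps $ (n - k))"
      proof (rule sum.mono_neutral_right)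
        show "\<forall>i\<in>{0..n} - Suc ` {0<..<m}. red_fps $ i * irr_fps $ (n - i) = 0"
        proof
          fix i assume i: "i \<in> {0..n} - Suc ` {0<..<m}"
          have "i = 0 \<or> i = Suc 0 \<or> i = n"
          proof (rule ccontr)
            assume "\<not> ?thesis"
            then have "i - 1 \<in> {0<..<m}" "i = Suc (i - 1)" using i m by auto
            then show False using i by blast
          qed
          moreover have "irr_fps $ 0 = 0" by (rule fps_ext) (simp add: irr_fps_nth num_irr_ncf_0)
          ultimately show "red_fps $ i * irr_fps $ (n - i) = 0" by (auto simp: red_fps_0 red_fps_1)
        qed
      qed (use m in auto)
      also have "\<dots> = (\<Sum>j\<in>{0<..<m}. red_fps $ Suc j * irr_fps $ (m - j))"
        by (simp add: sum.reindex m)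
      finally show ?thesis
        by (simp add: fps_sum_nth fps_mult_nth red_fps_nth irr_fps_nth atMost_atLeast0)
    qed
    show ?thesis
    proof (cases e)
      case 0
      then show ?thesis using m num_irr_ncf_rec[of m e] by (simp add: irr_fps_nth fps_X_power_iff)
    next
      case (Suc f)
      then show ?thesis
        using m num_irr_ncf_rec[of m e] conv[of f] by (simp add: irr_fps_nth fps_X_power_iff lessThan_Suc_atMost)
    qed
  qed
qed

definition U_fps :: "real fps fps" where
  "U_fps = fps_shift 1 irr_fps"

lemma irr_fps_U: "irr_fps = fps_X * U_fps"
proof (rule fps_ext)
  fix n
  have "irr_fps $ 0 = 0" by (rule fps_ext) (simp add: irr_fps_nth num_irr_ncf_0)
  then show "irr_fps $ n = (fps_X * U_fps) $ n" by (cases n) (simp_all add: U_fps_def)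
qed

interpretation gf: forest_series forest_fps U_fps
proof
  show A: "forest_fps = 1 + fps_X * forest_fps * U_fps"
    using forest_fps_eq unfolding irr_fps_U by (simp add: mult_ac)
  have "fps_X * (fps_X * U_fps) = fps_X ^ 2 + fps_const fps_X * ((forest_fps - 1 - irr_fps) * (fps_X * U_fps))"
    using irr_fps_eq by (simp add: red_fps_def irr_fps_U)
  also have "forest_fps - 1 - irr_fps = forest_fps * (fps_X * U_fps) * (fps_X * U_fps)"
    using A unfolding irr_fps_U by algebra
  finally have "fps_X ^ 2 * U_fps = fps_X ^ 2 * (1 + fps_const fps_X * fps_X * forest_fps * U_fps ^ 3)"
    by (simp add: algebra_simps power2_eq_square power3_eq_cube)
  then show "U_fps = 1 + fps_const fps_X * fps_X * forest_fps * U_fps ^ 3"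
    by (simp del: mult_cancel_left add: mult_left_cancel)
qed

lemma num_ncf_closed: "0 < n \<Longrightarrow> real (num_ncf n e) = gf.lagrange_coeff 1 0 n e"
  using gf.nth_closed[of n 1 0 e] by (simp add: forest_fps_nth)

lemma card_red_ncf_closed:
  assumes "0 < m"
  shows "real (card (red_ncf 0 (Suc m) e)) = gf.lagrange_coeff 1 2 (m - 1) e"
proof -
  obtain i where i: "m = Suc i" using assms gr0_implies_Suc by blast
  have eq: "red_fps = fps_X * (fps_X * (forest_fps ^ 1 * U_fps ^ 2))"
    unfolding red_fps_def irr_fps_U using gf.A_eq by algebra
  have "red_fps $ Suc m $ e = (forest_fps ^ 1 * U_fps ^ 2) $ i $ e"
    unfolding eq i by simp
  then show ?thesis using gf.nth_closed[of i 1 2 e] red_fps_nth[of "Suc m" e] i by simp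
qed

text \<open>Coefficient extraction from \<open>deriv_relation\<close>: \<open>z (zU)'\<close> counts
  a block with its size as weight.\<close>

lemma sum_last_cut_num_ncf:
  assumes "0 < m"
  shows "(\<Sum>F\<in>ncf 0 m e. m - last_cut 0 m F) = Suc e * num_ncf m e"
proof -
  have X: "(fps_X * fps_deriv irr_fps) $ i = of_nat i * irr_fps $ i" for i
    by (cases i) (simp_all add: mult.commute)
  have ofn: "(of_nat i * f) $ j = real i * (f :: real fps) $ j" for i f j
    by (simp flip: fps_of_nat)
  have "(fps_X * fps_deriv irr_fps * forest_fps) $ m $ e = (forest_fps * (fps_X * fps_deriv irr_fps)) $ m $ e"
    by (simp add: mult.commute)
  also have "\<dots> = (\<Sum>q=0..m. \<Sum>i=0..e. real (num_ncf q i) * (real (m - q) * real (num_irr_ncf (m - q) (e - i))))"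
    unfolding fps_mult_nth[of forest_fps] X
    by (simp add: fps_sum_nth fps_mult_nth[of "forest_fps $ _"] ofn forest_fps_nth irr_fps_nth del: of_nat_diff)
  also have "\<dots> = (\<Sum>q\<in>insert m {..<m}. \<Sum>i\<le>e. real (m - q) * (real (num_ncf q i) * real (num_irr_ncf (m - q) (e - i))))"
    by (rule sum.cong) (auto simp: atMost_atLeast0 mult_ac)
  also have "\<dots> = real (\<Sum>F\<in>ncf 0 m e. m - last_cut 0 m F)"
    unfolding sum_last_cut[OF assms] by simp
  finally have L: "(fps_X * fps_deriv irr_fps * forest_fps) $ m $ e = real (\<Sum>F\<in>ncf 0 m e. m - last_cut 0 m F)" .
  have "(forest_fps - 1 + fps_const fps_X * fps_deriv_coeffs forest_fps) $ m $ e = real (Suc e * num_ncf m e)"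
    using assms by (cases e) (simp_all add: forest_fps_nth algebra_simps)
  then show ?thesis using L gf.deriv_relation unfolding irr_fps_U by (metis of_nat_eq_iff)
qed

section \<open>Rotations\<close>

text \<open>Adjacency on the universal cover of the circle: integers stand for vertices modulo \<open>n\<close>.\<close>
definition joined :: "nat \<Rightarrow> nat set set \<Rightarrow> int \<Rightarrow> int \<Rightarrow> bool" where
  "joined n F x y \<longleftrightarrow> {nat (x mod int n), nat (y mod int n)} \<in> F"

lemma joined_commute: "joined n F x y \<longleftrightarrow> joined n F y x"
  by (simp add: joined_def insert_commute)

lemma joined_add_n: "joined n F (x + int n) y = joined n F x y" "joined n F x (y + int n) = joined n F x y"
  by (simp_all add: joined_def)

lemma joined_nat: "u < n \<Longrightarrow> v < n \<Longrightarrow> joined n F (int u) (int v) \<longleftrightarrow> {u, v} \<in> F"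
  by (simp add: joined_def)

text \<open>The cases tell which of \<open>c\<close>, \<open>y\<close>, \<open>d\<close> have passed
  \<open>n\<close>. Reducing those permutes the four endpoints cyclically, and the two chords still
  alternate.\<close>

lemma cross_mod_base:
  assumes nc: "non_crossing F" and E: "joined n F x y" "joined n F c d"
    and o: "0 \<le> x" "x < int n" "x < c" "c < y" "y < d" "d < x + int n"
  shows False
proof -
  have lo: "nat (t mod int n) = nat t" if "0 \<le> t" "t < int n" for t using that by simp
  have hi: "nat (t mod int n) = nat (t - int n)" if "int n \<le> t" "t < 2 * int n" for t
  proof -
    have "t mod int n = (t - int n) mod int n" by simp
    also have "\<dots> = t - int n" using that by (intro mod_pos_pos_trivial) auto
    finally show ?thesis by simp
  qed
  have nc': "\<not> ({a, b} \<in> F \<and> {c, d} \<in> F \<and> a < c \<and> c < b \<and> b < d)" for a b c d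
    using nc unfolding non_crossing_def by blast
  consider "d < int n" | "y < int n" "int n \<le> d" | "c < int n" "int n \<le> y" | "int n \<le> c" by linarith
  then show False
  proof cases
    case 1
    then have "{nat x, nat y} \<in> F" "{nat c, nat d} \<in> F" using E o by (simp_all add: joined_def lo)
    then show False using nc'[of "nat x" "nat y" "nat c" "nat d"] o by auto
  next
    case 2
    then have "{nat x, nat y} \<in> F" "{nat (d - int n), nat c} \<in> F"
      using E o by (simp_all add: joined_def lo hi insert_commute)
    then show False using nc'[of "nat (d - int n)" "nat c" "nat x" "nat y"] o 2 by auto
  next
    case 3
    then have "{nat (y - int n), nat x} \<in> F" "{nat (d - int n), nat c} \<in> F"
      using E o by (simp_all add: joined_def lo hi insert_commute)
    then show False using nc'[of "nat (y - int n)" "nat x" "nat (d - int n)" "nat c"] o 3 by auto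
  next
    case 4
    then have "{nat (y - int n), nat x} \<in> F" "{nat (c - int n), nat (d - int n)} \<in> F"
      using E o by (simp_all add: joined_def lo hi insert_commute)
    then show False using nc'[of "nat (c - int n)" "nat (d - int n)" "nat (y - int n)" "nat x"] o 4 by auto
  qed
qed

lemma cross_mod:
  assumes nc: "non_crossing F" and E: "joined n F x y" "joined n F c d" and n: "0 < n"
    and o: "x < c" "c < y" "y < d" "d < x + int n"
  shows False
proof -
  define t where "t = int n * (x div int n)"
  have m: "(z - t) mod int n = z mod int n" for z
    unfolding t_def by (simp add: mod_diff_eq[symmetric, of z])
  have x: "x - t = x mod int n" unfolding t_def by (simp add: minus_mult_div_eq_mod)
  show False
  proof (rule cross_mod_base[OF nc])
    show "joined n F (x - t) (y - t)" "joined n F (c - t) (d - t)" using E by (simp_all add: joined_def m)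
    show "0 \<le> x - t" "x - t < int n" unfolding x using n by simp_all
  qed (use o in auto)
qed

lemma inj_on_rotate:
  fixes n g :: nat
  shows "0 < n \<Longrightarrow> inj_on (\<lambda>i. (i + g) mod n) {0..<n}"
proof (rule inj_onI)
  fix a b assume n: "0 < n" and ab: "a \<in> {0..<n}" "b \<in> {0..<n}" "(a + g) mod n = (b + g) mod n"
  have "(a + g + (n - g mod n)) mod n = (b + g + (n - g mod n)) mod n"
    using ab(3) by (metis mod_add_left_eq)
  moreover have "(c + g + (n - g mod n)) mod n = c" if "c < n" for c
  proof -
    have "c + g + (n - g mod n) = c + n * Suc (g div n)"
      using mod_less_divisor[OF n, of g] mult_div_mod_eq[of n g] unfolding mult_Suc_right by linarith
    then show ?thesis using that by (simp only: mod_mult_self2) simp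
  qed
  ultimately show "a = b" using ab by simp
qed

lemma joined_rotate:
  assumes n: "0 < n" and F: "\<And>x. x \<in> F \<Longrightarrow> x \<subseteq> {0..<n}"
  shows "joined n (rotate_graph n g F) x y \<longleftrightarrow> joined n F (x - int g) (y - int g)"
proof -
  let ?r = "\<lambda>i. (i + g) mod n"
  have r: "?r (nat ((z - int g) mod int n)) = nat (z mod int n)" for z
  proof -
    have "int (?r (nat ((z - int g) mod int n))) = ((z - int g) mod int n + int g) mod int n"
      using n by (simp add: zmod_int)
    also have "\<dots> = z mod int n" by (simp add: mod_add_left_eq)
    finally show ?thesis using n by (metis nat_int)
  qed
  let ?e = "{nat ((x - int g) mod int n), nat ((y - int g) mod int n)}"
  have e: "{nat (x mod int n), nat (y mod int n)} = ?r ` ?e" by (simp add: r)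
  have sub: "?e \<subseteq> {0..<n}" using n by (auto simp: nat_less_iff)
  have "?r ` ?e \<in> (`) ?r ` F \<longleftrightarrow> ?e \<in> F"
  proof
    assume "?r ` ?e \<in> (`) ?r ` F"
    then obtain x where x: "x \<in> F" "?r ` ?e = ?r ` x" by blast
    then have "?e = x" using inj_on_image_eq_iff[OF inj_on_rotate[OF n] sub F[OF x(1)]] by blast
    then show "?e \<in> F" using x by simp
  qed blast
  then show ?thesis by (simp only: joined_def rotate_graph_def e)
qed

lemma rotate_ncf:
  assumes F: "F \<in> ncf 0 n e" and n: "0 < n"
  shows "rotate_graph n g F \<in> ncf 0 n e"
proof -
  let ?r = "\<lambda>i. (i + g) mod n"
  have Fn: "\<And>x. x \<in> F \<Longrightarrow> x \<subseteq> {0..<n}" using ncf_edge(1)[OF F] by blast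
  have edge: "x \<subseteq> {0..<n} \<and> card x = 2" if xF: "x \<in> rotate_graph n g F" for x
  proof -
    obtain y where y: "y \<in> F" "x = ?r ` y" using xF by (auto simp: rotate_graph_def)
    have "inj_on ?r y" using inj_on_subset[OF inj_on_rotate[OF n]] Fn[OF y(1)] by blast
    then show ?thesis using ncf_edge(2)[OF F y(1)] y n by (auto simp: card_image)
  qed
  have "non_crossing (rotate_graph n g F)"
    unfolding non_crossing_def
  proof
    assume "\<exists>a b c d. {a, b} \<in> rotate_graph n g F \<and> {c, d} \<in> rotate_graph n g F \<and> a < c \<and> c < b \<and> b < d"
    then obtain a b c d where *: "{a, b} \<in> rotate_graph n g F" "{c, d} \<in> rotate_graph n g F" "a < c" "c < b" "b < d"
      by blast
    have lt: "b < n" "d < n" using edge[OF *(1)] edge[OF *(2)] by auto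
    then have j: "joined n (rotate_graph n g F) (int a) (int b)" "joined n (rotate_graph n g F) (int c) (int d)"
      using * by (auto simp: joined_nat)
    then have j': "joined n F (int a - int g) (int b - int g)" "joined n F (int c - int g) (int d - int g)"
      using joined_rotate[of n F g] n Fn by blast+
    show False
      by (rule cross_mod[OF ncf_non_crossing[OF F] j' n]) (use * lt in auto)
  qed
  moreover have "acyc (rotate_graph n g F)"
    unfolding rotate_graph_def by (rule acyc_image[OF inj_on_rotate[OF n] Fn ncf_acyc[OF F]])
  moreover have "card (rotate_graph n g F) = e"
    unfolding rotate_graph_def using card_image_edges[OF inj_on_rotate[OF n] Fn] ncf_card[OF F] by simp
  ultimately show ?thesis using edge by (auto simp: ncf_def)
qed

lemma rotate_rotate: "rotate_graph n a (rotate_graph n b F) = rotate_graph n (a + b) F"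
proof -
  have "((i + b) mod n + a) mod n = (i + (a + b)) mod n" for i
    by (metis add.assoc add.commute mod_add_left_eq)
  then have "(\<lambda>i. (i + a) mod n) ` (\<lambda>i. (i + b) mod n) ` x = (\<lambda>i. (i + (a + b)) mod n) ` x" for x
    by (simp add: image_image)
  then show ?thesis by (simp add: rotate_graph_def image_image)
qed

lemma rotate_multiple:
  assumes "\<And>x. x \<in> F \<Longrightarrow> x \<subseteq> {0..<n}"
  shows "rotate_graph n (n * t) F = F"
proof -
  have "(\<lambda>i. (i + n * t) mod n) ` x = x" if "x \<in> F" for x
  proof -
    have "(i + n * t) mod n = i" if "i \<in> x" for i using assms[OF \<open>x \<in> F\<close>] that by auto
    then show ?thesis by simp
  qed
  then show ?thesis by (simp add: rotate_graph_def)
qed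

lemma rotate_inverse:
  assumes "\<And>x. x \<in> F \<Longrightarrow> x \<subseteq> {0..<n}" "g \<le> n"
  shows "rotate_graph n g (rotate_graph n (n - g) F) = F" "rotate_graph n (n - g) (rotate_graph n g F) = F"
  using rotate_multiple[OF assms(1), of F 1] assms(2) by (simp_all add: rotate_rotate)

section \<open>Rotation-invariant forests without a diameter\<close>

text \<open>The rotated copies of such an edge form a closed polygon on \<open>d\<close> vertices, a
  cycle as soon as \<open>d \<ge> 3\<close>. Edges of length \<open>m\<close> can therefore occur
  only for \<open>d = 2\<close>, where they are the diameters.\<close>

lemma acyc_no_polygon:
  assumes F: "F \<in> ncf 0 n e" and n: "n = d * m" "0 < m" "3 \<le> d"
    and per: "\<And>x y. joined n F x y \<Longrightarrow> joined n F (x + int m) (y + int m)"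
  shows "\<not> joined n F x (x + int m)"
proof
  assume E: "joined n F x (x + int m)"
  define p where "p t = nat ((x + int t * int m) mod int n)" for t :: nat
  have edge: "{p t, p (Suc t)} \<in> F" for t
  proof -
    have "joined n F (x + int t * int m) (x + int t * int m + int m)"
    proof (induction t)
      case (Suc t)
      from per[OF this] show ?case by (simp add: algebra_simps)
    qed (use E in simp)
    then show ?thesis by (simp add: joined_def p_def algebra_simps)
  qed
  have pd: "p d = p 0" by (simp add: p_def n(1))
  have n0: "0 < int n" using n by simp
  have inj: "s = t" if "p s = p t" "s < d" "t < d" for s t
  proof -
    have "(x + int s * int m) mod int n = (x + int t * int m) mod int n"
      using that(1) n0 unfolding p_def by (simp add: eq_nat_nat_iff)
    then have "int n dvd (x + int s * int m) - (x + int t * int m)" by (simp add: mod_eq_dvd_iff)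
    then have "int d * int m dvd (int s - int t) * int m" by (simp add: n(1) algebra_simps)
    then have "int d dvd int s - int t" using n(2) by simp
    then have "int s mod int d = int t mod int d" by (simp add: mod_eq_dvd_iff)
    then show "s = t" using that by simp
  qed
  let ?vs = "map p [0..<d]"
  have "length ?vs \<ge> 3" using n by simp
  moreover have "distinct ?vs" by (auto simp: distinct_map inj_on_def intro: inj)
  moreover have "\<forall>i < length ?vs. {?vs ! i, ?vs ! ((i + 1) mod length ?vs)} \<in> F"
  proof (intro allI impI)
    fix i assume i: "i < length ?vs"
    have "p ((i + 1) mod d) = p (Suc i)"
    proof (cases "Suc i = d")
      case True
      then show ?thesis using pd by simp
    next
      case False
      then show ?thesis using i by simp
    qed
    then show "{?vs ! i, ?vs ! ((i + 1) mod length ?vs)} \<in> F"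
      using i edge[of i] by simp
  qed
  ultimately have "has_cycle F" unfolding has_cycle_def by blast
  then show False using not_has_cycle_if_acyc[OF ncf_acyc[OF F]] by blast
qed

text \<open>No edge, drawn along an arc of length less than \<open>m\<close>, passes over the gap between \<open>g - 1\<close>
  and \<open>g\<close>.\<close>
definition exposed :: "nat \<Rightarrow> nat \<Rightarrow> nat set set \<Rightarrow> int \<Rightarrow> bool" where
  "exposed n m F g \<longleftrightarrow> (\<forall>x y. joined n F x y \<and> x < y \<and> y < x + int m \<longrightarrow> \<not> (x < g \<and> g \<le> y))"

lemma exposedD: "exposed n m F g \<Longrightarrow> joined n F x y \<Longrightarrow> x < g \<Longrightarrow> g \<le> y \<Longrightarrow> y < x + int m \<Longrightarrow> False"
  unfolding exposed_def by (meson less_le_trans)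

locale sym_forest =
  fixes n m d e :: nat and F :: "nat set set"
  assumes F: "F \<in> ncf 0 n e" and n: "n = d * m" and m: "0 < m" and d: "2 \<le> d"
    and sym: "rotate_graph n m F = F" and no_diam: "\<And>x. \<not> joined n F x (x + int m)"
begin

lemma n0: "0 < n" and mn: "2 * int m \<le> int n"
proof -
  show "0 < n" using n m d by simp
  have "2 * m \<le> d * m" using d by simp
  then show "2 * int m \<le> int n" unfolding n by linarith
qed

lemma Fn: "x \<in> F \<Longrightarrow> x \<subseteq> {0..<n}"
  using ncf_edge(1)[OF F] by blast

lemma joined_shift: "joined n F (x + int m) (y + int m) \<longleftrightarrow> joined n F x y"
  using joined_rotate[of n F m "x + int m" "y + int m"] n0 Fn sym by simp

lemma joined_shifts: "joined n F (x + int t * int m) (y + int t * int m) \<longleftrightarrow> joined n F x y"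
proof (induction t)
  case (Suc t)
  then show ?case using joined_shift[of "x + int t * int m" "y + int t * int m"] by (simp add: algebra_simps)
qed simp

lemma cross: "joined n F x y \<Longrightarrow> joined n F c z \<Longrightarrow> x < c \<Longrightarrow> c < y \<Longrightarrow> y < z \<Longrightarrow> z < x + int n \<Longrightarrow> False"
  using cross_mod[OF ncf_non_crossing[OF F]] n0 by blast

text \<open>An edge with both arcs longer than \<open>m\<close> would cross its own image under
  rotation by \<open>m\<close>; arcs of length exactly \<open>m\<close> are excluded by
  \<open>no_diam\<close>.\<close>

lemma short:
  assumes "joined n F x y" "x < y" "y < x + int n"
  shows "y < x + int m \<or> x + int n < y + int m"
proof (rule ccontr)
  assume A: "\<not> ?thesis"
  have "y \<noteq> x + int m" using assms(1) no_diam by blast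
  moreover have "y + int m \<noteq> x + int n"
  proof
    assume "y + int m = x + int n"
    then have "joined n F y (y + int m)" using assms(1) joined_add_n(2)[of n F y x] by (simp add: joined_commute)
    then show False using no_diam by blast
  qed
  ultimately have "x + int m < y" "y + int m < x + int n" using A by auto
  then show False using cross[OF assms(1), of "x + int m" "y + int m"] joined_shift assms m by simp
qed

lemma exposed_shifts: "exposed n m F (g + int t * int m) \<longleftrightarrow> exposed n m F g"
proof
  assume A: "exposed n m F (g + int t * int m)"
  show "exposed n m F g" unfolding exposed_def
  proof (intro allI impI)
    fix x y assume "joined n F x y \<and> x < y \<and> y < x + int m"
    then show "\<not> (x < g \<and> g \<le> y)"
      using A[unfolded exposed_def, rule_format, of "x + int t * int m" "y + int t * int m"] joined_shifts by simp
  qed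
next
  assume A: "exposed n m F g"
  show "exposed n m F (g + int t * int m)" unfolding exposed_def
  proof (intro allI impI)
    fix x y assume xy: "joined n F x y \<and> x < y \<and> y < x + int m"
    have "joined n F (x - int t * int m) (y - int t * int m)"
      using joined_shifts[of "x - int t * int m" t "y - int t * int m"] xy by simp
    then show "\<not> (x < g + int t * int m \<and> g + int t * int m \<le> y)"
      using A[unfolded exposed_def, rule_format, of "x - int t * int m" "y - int t * int m"] xy by auto
  qed
qed

text \<open>The counterpart of \<open>exposed\<close> for vertices: seen from the centre,
  \<open>v\<close> is not hidden behind a short arc, although short arcs may end in it.\<close>

definition visible :: "int \<Rightarrow> bool" where
  "visible v \<longleftrightarrow> (\<forall>x y. joined n F x y \<and> x < y \<and> y < x + int m \<longrightarrow> \<not> (x < v \<and> v < y))"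

lemma visibleD: "visible v \<Longrightarrow> joined n F x y \<Longrightarrow> x < v \<Longrightarrow> v < y \<Longrightarrow> y < x + int m \<Longrightarrow> False"
  unfolding visible_def by (meson less_trans)

text \<open>The gap after \<open>v\<close> is covered but no short arc passes over \<open>v\<close>,
  so some arc starts at \<open>v\<close>. The far end of the longest one is again visible.\<close>

lemma visible_next:
  assumes v: "visible v" and cov: "\<not> exposed n m F (v + 1)"
  obtains w where "joined n F v w" "v < w" "w < v + int m" "visible w"
proof -
  obtain a b where ab: "joined n F a b" "a < b" "b < a + int m" "a < v + 1" "v + 1 \<le> b"
    using cov by (auto simp: exposed_def)
  have "a = v"
  proof (rule ccontr)
    assume "a \<noteq> v"
    then have "a < v" "v < b" using ab by auto
    then show False using visibleD[OF v ab(1)] ab by blast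
  qed
  let ?W = "{w. joined n F v w \<and> v < w \<and> w < v + int m}"
  have b: "b \<in> ?W" using ab \<open>a = v\<close> by auto
  have fin: "finite ?W" by (rule finite_subset[of _ "{v..v + int m}"]) auto
  define w where "w = Max ?W"
  have w: "w \<in> ?W" unfolding w_def using fin b by (intro Max_in) auto
  have wmax: "z \<le> w" if "z \<in> ?W" for z unfolding w_def using fin that by (rule Max_ge)
  have "visible w" unfolding visible_def
  proof (intro allI impI notI)
    fix c z assume cz: "joined n F c z \<and> c < z \<and> z < c + int m" and cw: "c < w \<and> w < z"
    consider "c < v" | "c = v" | "v < c" by linarith
    then show False
    proof cases
      case 1
      then show False using visibleD[OF v, of c z] cz cw w by auto
    next
      case 2
      then show False using wmax[of z] cz cw w by auto
    next
      case 3
      then show False using cross[of v w c z] cz cw w mn by auto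
    qed
  qed
  then show ?thesis using that w by auto
qed

text \<open>If every gap is covered, take a longest short arc from \<open>x\<close> to
  \<open>y\<close>; its ends are visible. Going on from \<open>y\<close> by
  \<open>visible_next\<close>, the walk cannot jump over the visible vertex \<open>x + n\<close>, so
  it comes back to \<open>x\<close> without using the edge from \<open>x\<close> to
  \<open>y\<close>, which is then not a bridge.\<close>

lemma ex_exposed: "\<exists>g. exposed n m F g"
proof (rule ccontr)
  assume none: "\<not> ?thesis"
  let ?Ls = "{l. 0 < l \<and> l < int m \<and> (\<exists>x. joined n F x (x + l))}"
  have fin: "finite ?Ls" by (rule finite_subset[of _ "{0..int m}"]) auto
  have "\<not> exposed n m F 0" using none by blast
  then obtain x0 y0 where "joined n F x0 y0" "x0 < y0" "y0 < x0 + int m" by (auto simp: exposed_def)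
  then have ne: "y0 - x0 \<in> ?Ls" by (auto intro!: exI[of _ x0])
  define l where "l = Max ?Ls"
  have "l \<in> ?Ls" unfolding l_def using fin ne by (intro Max_in) auto
  then obtain x where x: "0 < l" "l < int m" "joined n F x (x + l)" by auto
  have lmax: "b - a \<le> l" if "joined n F a b" "a < b" "b < a + int m" for a b
  proof -
    have "b - a \<in> ?Ls" using that by (auto intro!: exI[of _ a])
    then show ?thesis unfolding l_def using fin by (intro Max_ge)
  qed
  define y where "y = x + l"
  have y: "joined n F x y" "x < y" "y < x + int m" using x by (auto simp: y_def)
  have vx: "visible x" unfolding visible_def
  proof (intro allI impI notI)
    fix a b assume ab: "joined n F a b \<and> a < b \<and> b < a + int m" and "a < x \<and> x < b"
    then show False using lmax[of a b] cross[of a b x y] y mn by (cases "y \<le> b") (auto simp: y_def)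
  qed
  have vy: "visible y" unfolding visible_def
  proof (intro allI impI notI)
    fix a b assume ab: "joined n F a b \<and> a < b \<and> b < a + int m" and "a < y \<and> y < b"
    then show False using lmax[of a b] cross[of x y a b] y mn by (cases "a \<le> x") (auto simp: y_def)
  qed
  have vxn: "visible (x + int n)" unfolding visible_def
  proof (intro allI impI notI)
    fix a b assume ab: "joined n F a b \<and> a < b \<and> b < a + int m" and xb: "a < x + int n \<and> x + int n < b"
    have "joined n F (a - int n) (b - int n)"
      using ab joined_add_n[of n F "a - int n"] joined_add_n(2)[of n F _ "b - int n"] by simp
    then show False using visibleD[OF vx, of "a - int n" "b - int n"] ab xb by auto
  qed
  let ?nx = "nat (x mod int n)" and ?ny = "nat (y mod int n)"
  let ?G = "F - {{?nx, ?ny}}"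
  have "(nat (v mod int n), ?nx) \<in> (adj ?G)\<^sup>*" if "visible v" "y \<le> v" "v \<le> x + int n" for v
    using that
  proof (induction "nat (x + int n - v)" arbitrary: v rule: less_induct)
    case less
    show ?case
    proof (cases "v = x + int n")
      case True
      then show ?thesis by simp
    next
      case False
      then have vlt: "v < x + int n" using less.prems by simp
      obtain w where w: "joined n F v w" "v < w" "w < v + int m" "visible w"
        using visible_next[OF less.prems(1)] none by blast
      have wle: "w \<le> x + int n"
      proof (rule ccontr)
        assume "\<not> w \<le> x + int n"
        then show False using visibleD[OF vxn w(1) vlt] w by simp
      qed
      \<comment> \<open>Equality would force \<open>v = y\<close> and \<open>w = x + n\<close>, a
        step of length \<open>n - l > m\<close>, because \<open>l < m\<close> and
        \<open>2 * m \<le> n\<close>.\<close>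
      have "{nat (v mod int n), nat (w mod int n)} \<noteq> {?nx, ?ny}"
      proof
        assume eq: "{nat (v mod int n), nat (w mod int n)} = {?nx, ?ny}"
        have conv: "int n dvd s - t" if "nat (s mod int n) = nat (t mod int n)" for s t
          using that n0 by (simp add: eq_nat_nat_iff mod_eq_dvd_iff)
        have small: "z = 0" if "int n dvd z" "\<bar>z\<bar> < int n" for z
          using dvd_imp_le_int[of z "int n"] that by force
        from eq consider "nat (v mod int n) = ?nx" | "nat (v mod int n) = ?ny" "nat (w mod int n) = ?nx"
          by (auto simp: doubleton_eq_iff)
        then show False
        proof cases
          case 1
          then have "v - x = 0" using small[OF conv] less.prems vlt y by auto
          then show False using less.prems y by simp
        next
          case 2
          have "v - y = 0" using small[OF conv[OF 2(1)]] less.prems vlt y by auto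
          moreover have "w - (x + int n) = 0"
          proof (rule small)
            show "int n dvd w - (x + int n)" using conv[OF 2(2)] by (metis diff_diff_eq dvd_diff dvd_refl)
          qed (use w wle less.prems y in auto)
          ultimately show False using w x mn by (auto simp: y_def)
        qed
      qed
      then have "(nat (v mod int n), nat (w mod int n)) \<in> adj ?G"
        using w(1) by (simp add: adj_def joined_def)
      moreover have "(nat (w mod int n), ?nx) \<in> (adj ?G)\<^sup>*"
        using w wle less.prems vlt by (intro less.hyps) auto
      ultimately show ?thesis by (rule converse_rtrancl_into_rtrancl)
    qed
  qed
  from this[OF vy] have "(?ny, ?nx) \<in> (adj ?G)\<^sup>*" using y mn by simp
  then have "(?nx, ?ny) \<in> (adj ?G)\<^sup>*" by (rule adj_rtrancl_sym)
  then show False using ncf_acyc[OF F] y(1) by (simp add: acyc_def joined_def)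
qed

lemma exposed_mod: "exposed n m F g \<longleftrightarrow> exposed n m F (g mod int m)"
proof (cases "0 \<le> g div int m")
  case True
  then show ?thesis using exposed_shifts[of "g mod int m" "nat (g div int m)"] by simp
next
  case False
  then have "g + int (nat (- (g div int m))) * int m = g mod int m"
    by (simp add: minus_div_mult_eq_mod)
  then show ?thesis using exposed_shifts[of g "nat (- (g div int m))"] by simp
qed

end

section \<open>Copies of a forest on consecutive blocks\<close>

definition repl_blocks :: "nat \<Rightarrow> nat \<Rightarrow> nat set set \<Rightarrow> nat set set" where
  "repl_blocks d m L = (\<Union>t<d. shift (t * m) L)"

lemma repl_blocks_ncf:
  assumes L: "L \<in> ncf 0 m e"
  shows "repl_blocks d m L \<in> ncf 0 (d * m) (d * e)"
proof (induction d)
  case 0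
  then show ?case by (simp add: repl_blocks_def ncf_degenerate)
next
  case (Suc d)
  have "shift (d * m) L \<in> ncf (d * m) (m + d * m) e" using shift_ncf[OF L, of "d * m"] by simp
  from ncf_glue(1)[OF Suc this] have "repl_blocks d m L \<union> shift (d * m) L \<in> ncf 0 (m + d * m) (d * e + e)" by simp
  moreover have "repl_blocks (Suc d) m L = repl_blocks d m L \<union> shift (d * m) L"
    by (auto simp: repl_blocks_def lessThan_Suc)
  ultimately show ?case by (simp add: add.commute)
qed

lemma repl_blocks_block:
  assumes L: "L \<in> ncf 0 m e" and x: "x \<in> repl_blocks d m L"
  obtains t y where "t < d" "y \<in> L" "x = (\<lambda>i. i + t * m) ` y" "x \<subseteq> {t * m..<t * m + m}"
proof -
  obtain t y where ty: "t < d" "y \<in> L" "x = (\<lambda>i. i + t * m) ` y" using x by (auto simp: repl_blocks_def shift_def)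
  have "x \<subseteq> {t * m..<t * m + m}" using ncf_edge(1)[OF L ty(2)] ty(3) by auto
  then show ?thesis using that ty by blast
qed

lemma sub_repl_blocks: "0 < d \<Longrightarrow> L \<subseteq> repl_blocks d m L"
  by (force simp: repl_blocks_def shift_def)

lemma repl_blocks_restrict:
  assumes L: "L \<in> ncf 0 m e" and d: "0 < d"
  shows "{x \<in> repl_blocks d m L. x \<subseteq> {..<m}} = L"
proof (intro equalityI subsetI)
  fix x assume "x \<in> {x \<in> repl_blocks d m L. x \<subseteq> {..<m}}"
  then have x: "x \<in> repl_blocks d m L" "x \<subseteq> {..<m}" by auto
  obtain t y where ty: "t < d" "y \<in> L" "x = (\<lambda>i. i + t * m) ` y" "x \<subseteq> {t * m..<t * m + m}"
    by (rule repl_blocks_block[OF L x(1)])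
  have "card y = 2" using ncf_edge(2)[OF L ty(2)] .
  then obtain i where i: "i \<in> y" by fastforce
  then have "i + t * m < m" using ty x by auto
  then have "t = 0" by (cases t) auto
  then show "x \<in> L" using ty by simp
next
  fix x assume "x \<in> L"
  then show "x \<in> {x \<in> repl_blocks d m L. x \<subseteq> {..<m}}"
    using sub_repl_blocks[OF d, of L m] ncf_edge(1)[OF L, of x] by force
qed

text \<open>One inclusion suffices because rotation preserves the number of edges; the last block is
  carried to the first.\<close>

lemma rotate_repl_blocks:
  assumes L: "L \<in> ncf 0 m e" and m: "0 < m" and d: "0 < d"
  shows "rotate_graph (d * m) m (repl_blocks d m L) = repl_blocks d m L"
proof (rule card_subset_eq)
  have R: "repl_blocks d m L \<in> ncf 0 (d * m) (d * e)" by (rule repl_blocks_ncf[OF L])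
  then show "finite (repl_blocks d m L)" by (rule ncf_finite)
  have "0 < d * m" using m d by simp
  from rotate_ncf[OF R this, of m] show "card (rotate_graph (d * m) m (repl_blocks d m L)) = card (repl_blocks d m L)"
    using R ncf_card by metis
  show "rotate_graph (d * m) m (repl_blocks d m L) \<subseteq> repl_blocks d m L"
  proof
    fix z assume "z \<in> rotate_graph (d * m) m (repl_blocks d m L)"
    then obtain x where x: "x \<in> repl_blocks d m L" "z = (\<lambda>i. (i + m) mod (d * m)) ` x"
      by (auto simp: rotate_graph_def)
    obtain t y where ty: "t < d" "y \<in> L" "x = (\<lambda>i. i + t * m) ` y" "x \<subseteq> {t * m..<t * m + m}"
      by (rule repl_blocks_block[OF L x(1)])
    define s where "s = (if Suc t = d then 0 else Suc t)"
    have s: "s < d" using ty d by (auto simp: s_def)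
    have "(i + t * m + m) mod (d * m) = i + s * m" if "i \<in> y" for i
    proof -
      have i: "i < m" using ncf_edge(1)[OF L ty(2)] that by auto
      have lt: "i + s * m < d * m"
      proof -
        have "Suc s * m \<le> d * m" using s by (intro mult_le_mono1) simp
        then show ?thesis using i by simp
      qed
      show ?thesis
      proof (cases "Suc t = d")
        case True
        then have e: "i + t * m + m = i + d * m" by auto
        show ?thesis unfolding e using True lt by (simp add: s_def)
      next
        case False
        then show ?thesis using lt by (simp add: s_def add.commute add.left_commute)
      qed
    qed
    then have "z = (\<lambda>i. i + s * m) ` y" using x(2) ty(3) by (simp add: image_image)
    then show "z \<in> repl_blocks d m L" using s ty(2) by (auto simp: repl_blocks_def shift_def)
  qed
qed

lemma joined_repl_blocks:
  assumes L: "L \<in> ncf 0 m e" and m: "0 < m" and d: "2 \<le> d"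
    and J: "joined (d * m) (repl_blocks d m L) x y"
  obtains u v t where "u = x mod int (d * m)" "v = y mod int (d * m)" "{nat u, nat v} \<in> repl_blocks d m L"
    "int t * int m \<le> u" "int t * int m \<le> v" "u < int t * int m + int m" "v < int t * int m + int m"
proof -
  let ?u = "x mod int (d * m)" and ?v = "y mod int (d * m)"
  have n0: "0 < int (d * m)" using m d by simp
  have nn: "0 \<le> ?u" "0 \<le> ?v" using n0 by (simp_all del: of_nat_mult)
  have e: "{nat ?u, nat ?v} \<in> repl_blocks d m L" using J by (simp add: joined_def)
  obtain t where t: "{nat ?u, nat ?v} \<subseteq> {t * m..<t * m + m}" using repl_blocks_block[OF L e] by metis
  then have "t * m \<le> nat ?u" "t * m \<le> nat ?v" "nat ?u < t * m + m" "nat ?v < t * m + m" by auto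
  then have "int (t * m) \<le> ?u" "int (t * m) \<le> ?v" "?u < int (t * m + m)" "?v < int (t * m + m)"
    using nn by linarith+
  then show ?thesis using that[of ?u ?v t] e by simp
qed

lemma repl_blocks_no_diam:
  assumes L: "L \<in> ncf 0 m e" and m: "0 < m" and d: "2 \<le> d"
  shows "\<not> joined (d * m) (repl_blocks d m L) x (x + int m)"
proof
  let ?n = "int (d * m)"
  assume "joined (d * m) (repl_blocks d m L) x (x + int m)"
  then obtain u v t where uv: "u = x mod ?n" "v = (x + int m) mod ?n"
    "int t * int m \<le> u" "int t * int m \<le> v" "u < int t * int m + int m" "v < int t * int m + int m"
    using joined_repl_blocks[OF L m d] by metis
  have mn: "2 * int m \<le> ?n"
  proof -
    have "2 * m \<le> d * m" using d by simp
    then show ?thesis by linarith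
  qed
  have "(x + int m - v) mod ?n = 0" "(x - u) mod ?n = 0"
    unfolding uv(1,2) by (simp_all add: mod_diff_right_eq)
  then have "?n dvd (x + int m - v) - (x - u)" by (meson dvd_diff mod_eq_0_iff_dvd)
  then have "?n dvd int m - (v - u)" by (simp add: algebra_simps)
  moreover have "0 < int m - (v - u)" "int m - (v - u) < ?n" using uv(3-6) mn by linarith+
  ultimately show False using zdvd_not_zless by blast
qed

text \<open>Modulo \<open>n\<close> both ends lie in the same block, and an arc shorter than
  \<open>m\<close> cannot reach that block again around the circle; so an arc touching the window
  from 0 to \<open>m - 1\<close> stays inside it.\<close>

lemma joined_repl_blocks_short:
  assumes L: "L \<in> ncf 0 m e" and m: "0 < m" and d: "2 \<le> d"
    and J: "joined (d * m) (repl_blocks d m L) x y" and xy: "x < y" "y < x + int m"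
    and lo: "x < int m" and hi: "0 \<le> y"
  shows "0 \<le> x" "y < int m" "{nat x, nat y} \<in> L"
proof -
  let ?n = "int (d * m)"
  obtain u v t where uv: "u = x mod ?n" "v = y mod ?n" "{nat u, nat v} \<in> repl_blocks d m L"
    "int t * int m \<le> u" "int t * int m \<le> v" "u < int t * int m + int m" "v < int t * int m + int m"
    using joined_repl_blocks[OF L m d J] by metis
  have mn: "2 * int m \<le> ?n"
  proof -
    have "2 * m \<le> d * m" using d by simp
    then show ?thesis by linarith
  qed
  have n0: "0 < ?n" using mn m by linarith
  have y2: "y < ?n" using xy lo mn by linarith
  then have vy: "v = y" using uv(2) hi by simp
  have x0: "0 \<le> x"
  proof (rule ccontr)
    assume "\<not> 0 \<le> x"
    then have "0 \<le> x + ?n" "x + ?n < ?n" using xy hi mn by linarith+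
    moreover have "x mod ?n = (x + ?n) mod ?n" by simp
    ultimately have "u = x + ?n" unfolding uv(1) using mod_pos_pos_trivial by metis
    then show False using uv vy xy mn by linarith
  qed
  then have ux: "u = x" using uv(1) xy y2 by simp
  have "t = 0"
  proof (rule ccontr)
    assume "t \<noteq> 0"
    then have "1 * int m \<le> int t * int m" by (intro mult_right_mono) auto
    then show False using uv(4) ux lo by simp
  qed
  then show "0 \<le> x" "y < int m" using x0 uv vy by auto
  then have "{nat u, nat v} \<subseteq> {..<m}" using ux vy x0 xy by auto
  then show "{nat x, nat y} \<in> L"
    using repl_blocks_restrict[OF L, of d] d uv(3) ux vy by auto
qed

lemma exposed_repl_blocks_0:
  assumes L: "L \<in> ncf 0 m e" and m: "0 < m" and d: "2 \<le> d"
  shows "exposed (d * m) m (repl_blocks d m L) 0"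
  unfolding exposed_def
proof (intro allI impI notI)
  fix x y assume A: "joined (d * m) (repl_blocks d m L) x y \<and> x < y \<and> y < x + int m" "x < 0 \<and> 0 \<le> y"
  then have "0 \<le> x" by (intro joined_repl_blocks_short(1)[OF L m d, of x y]) auto
  then show False using A by simp
qed

lemma exposed_repl_blocks:
  assumes L: "L \<in> ncf 0 m e" and m: "0 < m" and d: "2 \<le> d" and q: "0 < q" "q < m"
  shows "exposed (d * m) m (repl_blocks d m L) (int q) \<longleftrightarrow> splits_at q L"
proof
  assume A: "exposed (d * m) m (repl_blocks d m L) (int q)"
  show "splits_at q L" unfolding splits_at_def
  proof
    fix z assume z: "z \<in> L"
    then obtain u v where uv: "z = {u, v}" "u < v" using ncf_edge(2)[OF L z] edgeE by blast
    have vm: "v < m" using ncf_edge(1)[OF L z] uv by auto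
    have "m \<le> d * m" using d by simp
    then have "u < d * m" "v < d * m" using uv(2) vm by linarith+
    then have "joined (d * m) (repl_blocks d m L) (int u) (int v)"
      using sub_repl_blocks[of d L m] d z uv by (subst joined_nat) auto
    then have "\<not> (int u < int q \<and> int q \<le> int v)"
      using exposedD[OF A, of "int u" "int v"] uv vm by auto
    then show "z \<subseteq> {..<q} \<or> z \<subseteq> {q..}" using uv by auto
  qed
next
  assume c: "splits_at q L"
  show "exposed (d * m) m (repl_blocks d m L) (int q)" unfolding exposed_def
  proof (intro allI impI notI)
    fix x y assume A: "joined (d * m) (repl_blocks d m L) x y \<and> x < y \<and> y < x + int m" "x < int q \<and> int q \<le> y"
    have "x < int m" "0 \<le> y" using A q by auto
    then have "0 \<le> x" and xy: "{nat x, nat y} \<in> L" using joined_repl_blocks_short[OF L m d, of x y] A by auto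
    have "{nat x, nat y} \<subseteq> {..<q} \<or> {nat x, nat y} \<subseteq> {q..}" by (rule bspec[OF c[unfolded splits_at_def] xy])
    then show False using A \<open>0 \<le> x\<close> by auto
  qed
qed

text \<open>By symmetry every multiple of \<open>m\<close> is an exposed gap, so no short arc leaves
  its block. By \<open>short\<close>, an edge that looks long is short the other way round, but then
  it passes over the exposed gap at \<open>n\<close>.\<close>

lemma (in sym_forest) exposed_0_repl_blocks:
  assumes ex: "exposed n m F 0"
  defines "L \<equiv> {x \<in> F. x \<subseteq> {..<m}}"
  shows "L \<in> ncf 0 m (card L)" "F = repl_blocks d m L"
proof -
  show N: "L \<in> ncf 0 m (card L)"
    by (rule ncf_restrict[OF F, of _ "{..<m}"]) (auto simp: L_def)
  have ext: "exposed n m F (int t * int m)" for t using ex exposed_shifts[of 0 t] by simp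
  show "F = repl_blocks d m L"
  proof (intro equalityI subsetI)
    fix z assume z: "z \<in> F"
    obtain u v where uv: "z = {u, v}" "u < v" using ncf_edge(2)[OF F z] edgeE by blast
    have lt: "u < n" "v < n" using Fn[OF z] uv by auto
    have J: "joined n F (int u) (int v)" using z uv lt by (simp add: joined_nat)
    have "int v < int u + int m"
    proof (rule ccontr)
      assume "\<not> ?thesis"
      then have "int u + int n < int v + int m" using short[OF J] uv lt by auto
      moreover have "joined n F (int v) (int u + int n)" using J joined_add_n(2) joined_commute by metis
      moreover have "exposed n m F (int n)" using ext[of d] n by simp
      ultimately show False using lt exposedD[of n m F "int n" "int v" "int u + int n"] by simp
    qed
    then have vu: "v < u + m" by linarith
    define t where "t = u div m"
    have t: "t * m \<le> u" "u < t * m + m" using mod_less_divisor[OF m, of u] div_mult_mod_eq[of u m] unfolding t_def by linarith+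
    have vt: "v < t * m + m"
    proof (rule ccontr)
      assume "\<not> ?thesis"
      moreover have e: "int (Suc t) * int m = int (t * m + m)" by (simp add: algebra_simps)
      ultimately have "int u < int (Suc t) * int m" "int (Suc t) * int m \<le> int v"
        unfolding e using t by linarith+
      then show False using exposedD[OF ext[of "Suc t"] J] vu by simp
    qed
    have td: "t < d"
    proof (rule ccontr)
      assume "\<not> t < d"
      then have "d * m \<le> t * m" by simp
      then show False using t lt n by linarith
    qed
    have "joined n F (int (u - t * m)) (int (v - t * m))"
      using J joined_shifts[of "int (u - t * m)" t "int (v - t * m)"] t uv by (simp add: of_nat_diff)
    then have "{u - t * m, v - t * m} \<in> F" using lt by (simp add: joined_nat)
    then have "{u - t * m, v - t * m} \<in> L" using t vt m by (auto simp: L_def)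
    moreover have "z = (\<lambda>i. i + t * m) ` {u - t * m, v - t * m}" using uv t by auto
    ultimately show "z \<in> repl_blocks d m L" using td unfolding repl_blocks_def shift_def by blast
  next
    fix z assume z: "z \<in> repl_blocks d m L"
    obtain t y where ty: "t < d" "y \<in> L" "z = (\<lambda>i. i + t * m) ` y" "z \<subseteq> {t * m..<t * m + m}"
      by (rule repl_blocks_block[OF N z])
    obtain u v where uv: "y = {u, v}" "u < v" using ncf_edge(2)[OF N ty(2)] edgeE by blast
    have "u < m" "v < m" using ncf_edge(1)[OF N ty(2)] uv by auto
    have "Suc t * m \<le> d * m" using ty by (intro mult_le_mono1) simp
    then have lt: "u + t * m < n" "v + t * m < n" "u < n" "v < n" using \<open>u < m\<close> \<open>v < m\<close> n by auto
    have "joined n F (int u) (int v)" using ty uv lt by (simp add: joined_nat L_def)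
    then have "joined n F (int (u + t * m)) (int (v + t * m))" using joined_shifts[of "int u" t "int v"] by simp
    then show "z \<in> F" using lt ty(3) uv by (simp add: joined_nat del: of_nat_add)
  qed
qed

section \<open>Counting the invariant forests without a diameter\<close>

definition sym_set :: "nat \<Rightarrow> nat \<Rightarrow> nat \<Rightarrow> nat set set set" where
  "sym_set n m f = {F \<in> ncf 0 n f. rotate_graph n m F = F \<and> (\<forall>x. \<not> joined n F x (x + int m))}"

lemma sym_forestI:
  assumes "F \<in> sym_set (d * m) m f" "0 < m" "2 \<le> d"
  shows "sym_forest (d * m) m d f F"
  using assms by unfold_locales (auto simp: sym_set_def)

lemma exposed_rotate:
  assumes "0 < n" "\<And>x. x \<in> F \<Longrightarrow> x \<subseteq> {0..<n}"
  shows "exposed n m (rotate_graph n g F) a \<longleftrightarrow> exposed n m F (a - int g)"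
proof
  assume A: "exposed n m (rotate_graph n g F) a"
  show "exposed n m F (a - int g)" unfolding exposed_def
  proof (intro allI impI notI)
    fix x y assume B: "joined n F x y \<and> x < y \<and> y < x + int m" "x < a - int g \<and> a - int g \<le> y"
    have "joined n (rotate_graph n g F) (x + int g) (y + int g)"
      using B joined_rotate[of n F g "x + int g" "y + int g"] assms by simp
    then show False using exposedD[OF A] B by force
  qed
next
  assume A: "exposed n m F (a - int g)"
  show "exposed n m (rotate_graph n g F) a" unfolding exposed_def
  proof (intro allI impI notI)
    fix x y assume B: "joined n (rotate_graph n g F) x y \<and> x < y \<and> y < x + int m" "x < a \<and> a \<le> y"
    have "joined n F (x - int g) (y - int g)"
      using B joined_rotate[of n F g x y] assms by simp
    then show False using exposedD[OF A] B by force
  qed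
qed

lemma rotate_sym_set:
  assumes F: "F \<in> sym_set n m f" and n: "0 < n"
  shows "rotate_graph n g F \<in> sym_set n m f"
proof -
  have N: "F \<in> ncf 0 n f" and s: "rotate_graph n m F = F" and nd: "\<And>x. \<not> joined n F x (x + int m)"
    using F by (auto simp: sym_set_def)
  have Fn: "\<And>x. x \<in> F \<Longrightarrow> x \<subseteq> {0..<n}" using ncf_edge(1)[OF N] by blast
  have "rotate_graph n m (rotate_graph n g F) = rotate_graph n g (rotate_graph n m F)"
    by (simp add: rotate_rotate add.commute)
  moreover have "\<not> joined n (rotate_graph n g F) x (x + int m)" for x
    using joined_rotate[of n F g x "x + int m"] n Fn nd[of "x - int g"] by (simp add: algebra_simps)
  ultimately show ?thesis using rotate_ncf[OF N n] s by (simp add: sym_set_def)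
qed

lemma repl_blocks_sym_set:
  assumes "L \<in> ncf 0 m e" "0 < m" "2 \<le> d"
  shows "repl_blocks d m L \<in> sym_set (d * m) m (d * e)"
  using repl_blocks_ncf[OF assms(1)] rotate_repl_blocks[OF assms(1,2)] repl_blocks_no_diam[OF assms] assms(3)
  by (simp add: sym_set_def)

lemma exposed_repl_blocks_minus:
  assumes L: "L \<in> ncf 0 m e" and m: "0 < m" and d: "2 \<le> d" and q: "0 < q" "q < m"
  shows "exposed (d * m) m (repl_blocks d m L) (- int q) \<longleftrightarrow> splits_at (m - q) L"
proof -
  interpret sym_forest "d * m" m d "d * e" "repl_blocks d m L"
    using sym_forestI[OF repl_blocks_sym_set[OF L m d] m d] .
  have "exposed (d * m) m (repl_blocks d m L) (- int q) \<longleftrightarrow> exposed (d * m) m (repl_blocks d m L) (- int q + int 1 * int m)"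
    using exposed_shifts[of "- int q" 1] by simp
  also have "- int q + int 1 * int m = int (m - q)" using q by simp
  finally show ?thesis using exposed_repl_blocks[OF L m d, of "m - q"] q by simp
qed

text \<open>The rotation \<open>g\<close> is the first exposed gap at or after 0. The exposed gap
  preceding it is at \<open>g - (m - last_cut 0 m L)\<close>, so \<open>g\<close> is the first one
  exactly if this is negative, which is the range of \<open>g\<close>.\<close>

lemma bij_sym_set:
  assumes m: "0 < m" and d: "2 \<le> d"
  shows "bij_betw (\<lambda>(L, g). rotate_graph (d * m) g (repl_blocks d m L))
    (SIGMA L : ncf 0 m e. {..<m - last_cut 0 m L}) (sym_set (d * m) m (d * e))"
proof (rule bij_betw_imageI)
  let ?n = "d * m" and ?D = "SIGMA L : ncf 0 m e. {..<m - last_cut 0 m L}"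
  have n0: "0 < ?n" using m d by simp
  have mn: "m \<le> ?n" using d by simp
  have lc: "splits_at (last_cut 0 m L) L" "last_cut 0 m L < m" "last_cut 0 m L < q \<Longrightarrow> q < m \<Longrightarrow> \<not> splits_at q L"
    if "L \<in> ncf 0 m e" for L q
    using last_cut[of L 0 m] ncf_edge(1)[OF that] m by blast+
  have Rn: "x \<subseteq> {0..<?n}" if "L \<in> ncf 0 m e" "x \<in> repl_blocks d m L" for L x
    using ncf_edge(1)[OF repl_blocks_ncf[OF that(1)] that(2)] .
  \<comment> \<open>A smaller \<open>g'\<close> would turn up in the copies of \<open>L\<close> as a
    cut strictly between the last cut of \<open>L\<close> and the end of its block.\<close>
  have aux: "\<not> g' < g" if L: "L \<in> ncf 0 m e" "L' \<in> ncf 0 m e" and g: "g < m - last_cut 0 m L"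
    and eq: "rotate_graph ?n g (repl_blocks d m L) = rotate_graph ?n g' (repl_blocks d m L')" for L L' g g'
  proof
    assume lt: "g' < g"
    have "exposed ?n m (rotate_graph ?n g' (repl_blocks d m L')) (int g')"
      using exposed_rotate[of ?n "repl_blocks d m L'" m g' "int g'"] n0 Rn[OF L(2)] exposed_repl_blocks_0[OF L(2) m d] by simp
    then have "exposed ?n m (repl_blocks d m L) (int g' - int g)"
      using exposed_rotate[of ?n "repl_blocks d m L" m g "int g'"] n0 Rn[OF L(1)] eq by simp
    then have "exposed ?n m (repl_blocks d m L) (- int (g - g'))" using lt by (simp add: of_nat_diff)
    then have "splits_at (m - (g - g')) L"
      using exposed_repl_blocks_minus[OF L(1) m d, of "g - g'"] lt g by simp
    moreover have "last_cut 0 m L < m - (g - g')" "m - (g - g') < m" using lt g by linarith+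
    ultimately show False using lc(3)[OF L(1)] by blast
  qed
  show "inj_on (\<lambda>(L, g). rotate_graph ?n g (repl_blocks d m L)) ?D"
  proof (rule inj_onI, clarify)
    fix L g L' g'
    assume L: "L \<in> ncf 0 m e" "L' \<in> ncf 0 m e" and g: "g < m - last_cut 0 m L" "g' < m - last_cut 0 m L'"
      and eq: "rotate_graph ?n g (repl_blocks d m L) = rotate_graph ?n g' (repl_blocks d m L')"
    have gg: "g = g'" using aux[OF L g(1) eq] aux[OF L(2,1) g(2) eq[symmetric]] by simp
    have "g \<le> ?n" using g mn by linarith
    then have "repl_blocks d m L = repl_blocks d m L'"
      using rotate_inverse(2)[of "repl_blocks d m L" ?n g] rotate_inverse(2)[of "repl_blocks d m L'" ?n g] Rn L eq gg by metis
    moreover have d0: "0 < d" using d by simp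
    ultimately have "L = L'" using repl_blocks_restrict[OF L(1) d0] repl_blocks_restrict[OF L(2) d0] by metis
    then show "L = L' \<and> g = g'" using gg by simp
  qed
  show "(\<lambda>(L, g). rotate_graph ?n g (repl_blocks d m L)) ` ?D = sym_set ?n m (d * e)"
  proof (intro equalityI subsetI)
    fix F assume "F \<in> (\<lambda>(L, g). rotate_graph ?n g (repl_blocks d m L)) ` ?D"
    then obtain L g where "F = rotate_graph ?n g (repl_blocks d m L)" "L \<in> ncf 0 m e" by auto
    then show "F \<in> sym_set ?n m (d * e)" using rotate_sym_set[OF repl_blocks_sym_set[OF _ m d] n0] by simp
  next
    fix F assume F: "F \<in> sym_set ?n m (d * e)"
    interpret sf: sym_forest ?n m d "d * e" F by (rule sym_forestI[OF F m d])
    obtain h where "exposed ?n m F h" using sf.ex_exposed by blast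
    then have "exposed ?n m F (h mod int m)" using sf.exposed_mod by blast
    then have "exposed ?n m F (int (nat (h mod int m)))" using m by simp
    define g where "g = (LEAST g. exposed ?n m F (int g))"
    have g: "exposed ?n m F (int g)" unfolding g_def by (rule LeastI) fact
    have gle: "g \<le> nat (h mod int m)" unfolding g_def by (rule Least_le) fact
    have "nat (h mod int m) < m" using m by (simp add: nat_less_iff)
    then have gm: "g < m" using gle by simp
    have gmin: "\<not> exposed ?n m F (int q)" if "q < g" for q
      using not_less_Least[of q "\<lambda>g. exposed ?n m F (int g)"] that unfolding g_def by blast
    define G where "G = rotate_graph ?n (?n - g) F"
    have gn: "g \<le> ?n" using gm mn by linarith
    have G: "G \<in> sym_set ?n m (d * e)" unfolding G_def by (rule rotate_sym_set[OF F n0])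
    have FG: "F = rotate_graph ?n g G" unfolding G_def using rotate_inverse(1)[of F ?n g] sf.Fn gn by simp
    interpret sg: sym_forest ?n m d "d * e" G by (rule sym_forestI[OF G m d])
    have exG: "exposed ?n m F a \<longleftrightarrow> exposed ?n m G (a - int g)" for a
      using exposed_rotate[of ?n G m g a] n0 sg.Fn FG by simp
    have "exposed ?n m G 0" using g exG[of "int g"] by simp
    note L = sg.exposed_0_repl_blocks[OF this]
    define L where "L = {x \<in> G. x \<subseteq> {..<m}}"
    have LN: "L \<in> ncf 0 m (card L)" and GL: "G = repl_blocks d m L" using L by (simp_all add: L_def)
    have "d * card L = d * e"
      using ncf_card[OF repl_blocks_ncf[OF LN, of d]] ncf_card[OF sg.F] GL by simp
    then have ce: "card L = e" using d by simp
    then have LN': "L \<in> ncf 0 m e" using LN by simp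
    define q where "q = last_cut 0 m L"
    have q: "splits_at q L" "q < m" using lc[OF LN'] by (auto simp: q_def)
    have "g < m - q"
    proof (rule ccontr)
      assume A: "\<not> g < m - q"
      then have q0: "0 < q" using gm by simp
      have "exposed ?n m G (int q)" using exposed_repl_blocks[OF LN' m d q0 q(2)] q(1) GL by simp
      then have ex: "exposed ?n m F (int q + int g)" using exG[of "int q + int g"] by simp
      have e: "int q + int g = int (q + g - m) + int 1 * int m" using A by simp
      have "exposed ?n m F (int (q + g - m))" using ex[unfolded e] sf.exposed_shifts by blast
      moreover have "q + g - m < g" using q(2) A by linarith
      ultimately show False using gmin by blast
    qed
    then show "F \<in> (\<lambda>(L, g). rotate_graph ?n g (repl_blocks d m L)) ` ?D"
      using FG GL LN' by (intro image_eqI[of _ _ "(L, g)"]) (auto simp: q_def)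
  qed
qed

lemma sym_set_not_dvd:
  assumes m: "0 < m" and d: "2 \<le> d" and f: "\<not> d dvd f"
  shows "sym_set (d * m) m f = {}"
proof (rule ccontr)
  assume "sym_set (d * m) m f \<noteq> {}"
  then obtain F where F: "F \<in> sym_set (d * m) m f" by blast
  have n0: "0 < d * m" using m d by simp
  interpret sf: sym_forest "d * m" m d f F by (rule sym_forestI[OF F m d])
  obtain h where h: "exposed (d * m) m F h" using sf.ex_exposed by blast
  define g where "g = nat (h mod int m)"
  have "exposed (d * m) m F (int g)" using h sf.exposed_mod m by (simp add: g_def)
  have "g < m" using m by (simp add: g_def nat_less_iff)
  moreover have "m \<le> d * m" using d by simp
  ultimately have gn: "g \<le> d * m" by linarith
  define G where "G = rotate_graph (d * m) (d * m - g) F"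
  have G: "G \<in> sym_set (d * m) m f" unfolding G_def by (rule rotate_sym_set[OF F n0])
  have FG: "F = rotate_graph (d * m) g G" unfolding G_def using rotate_inverse(1)[of F "d * m" g] sf.Fn gn by simp
  interpret sg: sym_forest "d * m" m d f G by (rule sym_forestI[OF G m d])
  have "exposed (d * m) m G 0"
    using exposed_rotate[of "d * m" G m g "int g"] n0 sg.Fn FG \<open>exposed (d * m) m F (int g)\<close> by simp
  note L = sg.exposed_0_repl_blocks[OF this]
  have "f = d * card {x \<in> G. x \<subseteq> {..<m}}"
    using ncf_card[OF repl_blocks_ncf[OF L(1), of d]] ncf_card[OF sg.F] L(2) by metis
  then show False using f by simp
qed

lemma card_sym_set:
  assumes m: "0 < m" and d: "2 \<le> d"
  shows "card (sym_set (d * m) m (d * e)) = (\<Sum>L\<in>ncf 0 m e. m - last_cut 0 m L)"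
  using bij_betw_same_card[OF bij_sym_set[OF assms]] by (simp add: card_SigmaI finite_ncf)

section \<open>Centrally symmetric forests with a diameter\<close>

definition diam_set :: "nat \<Rightarrow> nat \<Rightarrow> nat set set set" where
  "diam_set m f = {F \<in> ncf 0 (2 * m) f. rotate_graph (2 * m) m F = F \<and> (\<exists>i<m. {i, i + m} \<in> F)}"

text \<open>The diameter is its own image under the half turn; this one fixed edge makes the number
  of edges odd.\<close>

definition double :: "nat \<Rightarrow> nat set set \<Rightarrow> nat set set" where
  "double m M = insert {0, m} (M \<union> rotate_graph (2 * m) m M)"

lemma half_turn:
  fixes i m :: nat
  shows "i \<le> m \<Longrightarrow> 0 < m \<Longrightarrow> (i + m) mod (2 * m) = (if i = m then 0 else i + m)"
  by (auto simp: mult_2[symmetric])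

lemma half_turn_edge:
  fixes m :: nat
  assumes "x \<subseteq> {..m}" "0 < m"
  shows "(\<lambda>i. (i + m) mod (2 * m)) ` x \<subseteq> insert 0 {m..<2 * m}"
  using assms by (auto simp: half_turn subset_iff)

text \<open>For acyclicity the rotated copy is attached in two pieces, the images of the two sides
  of a cut of \<open>M\<close>: the first meets what is already there only in \<open>m\<close>, the
  second only in 0. This uses that \<open>M\<close> is decomposable.\<close>

lemma double_ncf:
  assumes M: "M \<in> red_ncf 0 (Suc m) e" and m: "0 < m"
  shows "double m M \<in> ncf 0 (2 * m) (2 * e + 1)"
    and "{x \<in> double m M. x \<subseteq> {..m}} - {{0, m}} = M"
    and "rotate_graph (2 * m) m (double m M) = double m M"
proof -
  let ?r = "\<lambda>i. (i + m) mod (2 * m)" and ?R = "rotate_graph (2 * m) m M"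
  have N: "M \<in> ncf 0 (Suc m) e" using M by (simp add: red_ncf_def)
  have n0: "0 < 2 * m" using m by simp
  have Me: "x \<subseteq> {..m}" if "x \<in> M" for x using ncf_edge(1)[OF N that] by force
  have N2: "M \<in> ncf 0 (2 * m) e"
    using ncf_restrict[OF N, of M UNIV 0 "2 * m"] ncf_card[OF N] m by auto
  have Mn: "x \<subseteq> {0..<2 * m}" if "x \<in> M" for x using ncf_edge(1)[OF N2 that] .
  have R: "?R \<in> ncf 0 (2 * m) e" by (rule rotate_ncf[OF N2 n0])
  have Re: "x \<subseteq> insert 0 {m..<2 * m}" if x: "x \<in> ?R" for x
  proof -
    obtain y where y: "y \<in> M" "x = ?r ` y" using x by (auto simp: rotate_graph_def)
    show ?thesis unfolding y(2) by (rule half_turn_edge[OF Me[OF y(1)] m])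
  qed
  have nM: "{0, m} \<notin> M" using red_ncf_close_ncf(2)[OF M m] .
  have RR: "rotate_graph (2 * m) m ?R = M"
    using rotate_multiple[OF Mn, of M 1] by (simp add: rotate_rotate mult_2)
  have r0m: "?r ` {0, m} = {0, m}" using m by (auto simp: half_turn)
  have nR: "{0, m} \<notin> ?R"
  proof
    assume "{0, m} \<in> ?R"
    then have "?r ` {0, m} \<in> rotate_graph (2 * m) m ?R" by (simp only: rotate_graph_def) (rule imageI)
    then show False using RR nM r0m by simp
  qed
  have small: "x = {0, m}" if "x \<subseteq> {..m}" "x \<subseteq> insert 0 {m..<2 * m}" "card x = 2" for x
  proof -
    have "x \<subseteq> {0, m}" using that by force
    moreover have "card {0, m} = 2" using m by simp
    ultimately show ?thesis using that(3) card_subset_eq[of "{0, m}" x] by simp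
  qed
  have disj: "M \<inter> ?R = {}"
    using small[OF Me Re] ncf_edge(2)[OF N] nM by blast
  show "rotate_graph (2 * m) m (double m M) = double m M"
  proof -
    have "rotate_graph (2 * m) m (double m M) = insert (?r ` {0, m}) (?R \<union> rotate_graph (2 * m) m ?R)"
      by (simp only: double_def rotate_graph_def image_insert image_Un)
    then show ?thesis unfolding r0m RR double_def by (simp add: Un_commute)
  qed
  show "{x \<in> double m M. x \<subseteq> {..m}} - {{0, m}} = M"
  proof (intro equalityI subsetI)
    fix x assume "x \<in> {x \<in> double m M. x \<subseteq> {..m}} - {{0, m}}"
    then have x: "x \<in> M \<or> x \<in> ?R" "x \<subseteq> {..m}" "x \<noteq> {0, m}" by (auto simp: double_def)
    then show "x \<in> M" using small[OF x(2) Re] ncf_edge(2)[OF R] by blast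
  next
    fix x assume "x \<in> M"
    then show "x \<in> {x \<in> double m M. x \<subseteq> {..m}} - {{0, m}}" using Me nM by (auto simp: double_def)
  qed
  have nc: "non_crossing (double m M)"
    unfolding non_crossing_def
  proof
    assume "\<exists>a b c d. {a, b} \<in> double m M \<and> {c, d} \<in> double m M \<and> a < c \<and> c < b \<and> b < d"
    then obtain a b c d where *: "{a, b} \<in> double m M" "{c, d} \<in> double m M" and o: "a < c" "c < b" "b < d"
      by blast
    have D: "{a, b} = {0, m} \<or> {a, b} \<in> M \<or> {a, b} \<in> ?R" "{c, d} = {0, m} \<or> {c, d} \<in> M \<or> {c, d} \<in> ?R"
      using * by (auto simp: double_def)
    have 1: "\<not> ({a, b} \<in> M \<and> {c, d} \<in> M)" "\<not> ({a, b} \<in> ?R \<and> {c, d} \<in> ?R)"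
      using ncf_non_crossing[OF N] ncf_non_crossing[OF R] o unfolding non_crossing_def by blast+
    have ab: "{a, b} \<in> M \<Longrightarrow> b \<le> m" "{a, b} \<in> ?R \<Longrightarrow> m \<le> b" "{a, b} = {0, m} \<Longrightarrow> a = 0 \<and> b = m"
      using Me[of "{a, b}"] Re[of "{a, b}"] o by (auto simp: doubleton_eq_iff)
    have cd: "{c, d} \<in> M \<Longrightarrow> d \<le> m" "{c, d} \<in> ?R \<Longrightarrow> m \<le> c" "\<not> {c, d} = {0, m}"
      using Me[of "{c, d}"] Re[of "{c, d}"] o by (auto simp: doubleton_eq_iff)
    show False using D 1 ab cd o by auto
  qed
  obtain q where q: "0 < q" "q \<le> m" "splits_at q M" using M by (auto simp: red_ncf_def)
  obtain M1 M2 where M12: "M = M1 \<union> M2" "M1 \<in> ncf 0 q (card M1)" "M2 \<in> ncf q (Suc m) (card M2)"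
    using cut_split_ncf[OF N q(3)] by blast
  have inj: "inj_on ?r {0..<2 * m}" by (rule inj_on_rotate[OF n0])
  have C: "acyc (insert {0, m} M)" using ncf_acyc[OF red_ncf_close_ncf(1)[OF M m]] .
  let ?R1 = "rotate_graph (2 * m) m M1" and ?R2 = "rotate_graph (2 * m) m M2"
  have a1: "acyc ?R1" "acyc ?R2"
    unfolding rotate_graph_def
    using acyc_image[OF inj, of M1] acyc_image[OF inj, of M2] Mn M12 ncf_acyc by blast+
  have e1: "x \<subseteq> {m..<m + q}" if x: "x \<in> ?R1" for x
  proof -
    obtain y where y: "y \<in> M1" "x = ?r ` y" using x by (auto simp: rotate_graph_def)
    have "?r i = i + m \<and> i < q" if "i \<in> y" for i
    proof -
      have "i < q" using subsetD[OF ncf_edge(1)[OF M12(2) y(1)] that] by simp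
      then show ?thesis using q(2) half_turn[of i m] m by simp
    qed
    then show ?thesis using y(2) by auto
  qed
  have e2: "x \<subseteq> insert 0 {m + q..<2 * m}" if x: "x \<in> ?R2" for x
  proof -
    obtain y where y: "y \<in> M2" "x = ?r ` y" using x by (auto simp: rotate_graph_def)
    have "?r i \<in> insert 0 {m + q..<2 * m}" if "i \<in> y" for i
    proof -
      have "q \<le> i" "i \<le> m" using subsetD[OF ncf_edge(1)[OF M12(3) y(1)] that] by simp_all
      then show ?thesis using half_turn[of i m] m by auto
    qed
    then show ?thesis unfolding y(2) by (rule image_subsetI)
  qed
  have c1: "acyc (insert {0, m} M \<union> ?R1)"
  proof (rule acyc_glue[OF C a1(1), of "{..m}" "{m..<m + q}" m])
    show "x \<subseteq> {..m}" if "x \<in> insert {0, m} M" for x using that Me by auto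
    show "x \<subseteq> {m..<m + q}" if "x \<in> ?R1" for x using e1[OF that] .
    show "{..m} \<inter> {m..<m + q} \<subseteq> {m}" by auto
  qed
  have "acyc ((insert {0, m} M \<union> ?R1) \<union> ?R2)"
  proof (rule acyc_glue[OF c1 a1(2), of "{..<m + q}" "insert 0 {m + q..<2 * m}" 0])
    show "x \<subseteq> {..<m + q}" if x: "x \<in> insert {0, m} M \<union> ?R1" for x
    proof -
      have "{..m} \<subseteq> {..<m + q}" "{m..<m + q} \<subseteq> {..<m + q}" "{0, m} \<subseteq> {..<m + q}" using q by auto
      then show ?thesis using x Me e1 by blast
    qed
    show "x \<subseteq> insert 0 {m + q..<2 * m}" if "x \<in> ?R2" for x using e2[OF that] .
    show "{..<m + q} \<inter> insert 0 {m + q..<2 * m} \<subseteq> {0}" by auto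
  qed
  moreover have "(insert {0, m} M \<union> ?R1) \<union> ?R2 = double m M"
    unfolding double_def M12(1) rotate_graph_def image_Un by blast
  ultimately have ac: "acyc (double m M)" by simp
  have "card (double m M) = Suc (card (M \<union> ?R))"
    unfolding double_def using nM nR ncf_finite[OF N] ncf_finite[OF R] by simp
  also have "card (M \<union> ?R) = 2 * e"
    using card_Un_disjoint[OF ncf_finite[OF N] ncf_finite[OF R] disj] ncf_card[OF N] ncf_card[OF R] by simp
  finally have cd: "card (double m M) = 2 * e + 1" by simp
  have "x \<subseteq> {0..<2 * m} \<and> card x = 2" if "x \<in> double m M" for x
    using that ncf_edge[OF N2, of x] ncf_edge[OF R, of x] m by (auto simp: double_def)
  then show "double m M \<in> ncf 0 (2 * m) (2 * e + 1)" using nc ac cd by (auto simp: ncf_def)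
qed

lemma rotate_edge:
  "{u, v} \<in> F \<Longrightarrow> {(u + g) mod n, (v + g) mod n} \<in> rotate_graph n g F"
  unfolding rotate_graph_def by (rule image_eqI[of _ _ "{u, v}"]) auto

text \<open>After the diameter has been rotated to \<open>{0, m}\<close>, no edge crosses it, so
  each edge belongs to one of the halves, and the half turn carries the far half to the near
  one.\<close>

lemma diam_decompose:
  assumes F: "F \<in> diam_set m f" and m: "0 < m"
  obtains i M where "i < m" "M \<in> red_ncf 0 (Suc m) (card M)" "F = rotate_graph (2 * m) i (double m M)"
proof -
  let ?n = "2 * m"
  have N: "F \<in> ncf 0 ?n f" and s: "rotate_graph ?n m F = F" using F by (auto simp: diam_set_def)
  obtain i where i: "i < m" "{i, i + m} \<in> F" using F by (auto simp: diam_set_def)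
  have n0: "0 < ?n" using m by simp
  have Fn: "\<And>x. x \<in> F \<Longrightarrow> x \<subseteq> {0..<?n}" using ncf_edge(1)[OF N] by blast
  define G where "G = rotate_graph ?n (?n - i) F"
  have G: "G \<in> ncf 0 ?n f" unfolding G_def by (rule rotate_ncf[OF N n0])
  have GF: "F = rotate_graph ?n i G" unfolding G_def using rotate_inverse(1)[of F ?n i] Fn i by simp
  have sG: "rotate_graph ?n m G = G"
    using s unfolding G_def rotate_rotate by (metis add.commute rotate_rotate)
  have "{(i + (?n - i)) mod ?n, (i + m + (?n - i)) mod ?n} \<in> G"
    unfolding G_def by (rule rotate_edge[OF i(2)])
  moreover have "(i + (?n - i)) mod ?n = 0" "(i + m + (?n - i)) mod ?n = m" using i m by simp_all
  ultimately have dG: "{0, m} \<in> G" by simp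
  define M where "M = {x \<in> G. x \<subseteq> {..m}} - {{0, m}}"
  have M: "M \<in> red_ncf 0 (Suc m) (card M)" unfolding M_def by (rule ncf_open_red_ncf[OF G dG m])
  have rG: "(\<lambda>i. (i + m) mod ?n) ` x \<in> G" if "x \<in> G" for x
  proof -
    have "(\<lambda>i. (i + m) mod ?n) ` x \<in> rotate_graph ?n m G" unfolding rotate_graph_def using that by (rule imageI)
    then show ?thesis using sG by simp
  qed
  have "G = double m M"
  proof (intro equalityI subsetI)
    fix x assume x: "x \<in> G"
    obtain u v where uv: "x = {u, v}" "u < v" using ncf_edge(2)[OF G x] edgeE by blast
    have v: "v < ?n" using ncf_edge(1)[OF G x] uv by auto
    have "\<not> (0 < u \<and> u < m \<and> m < v)"
      using ncf_non_crossing[OF G] dG x uv unfolding non_crossing_def by blast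
    then have "v \<le> m \<or> u = 0 \<and> m < v \<or> m \<le> u" by linarith
    then show "x \<in> double m M"
    proof
      assume "v \<le> m"
      then have "x \<subseteq> {..m}" using uv by auto
      then show ?thesis using x by (auto simp: double_def M_def)
    next
      \<comment> \<open>The far half runs from \<open>m\<close> to \<open>2 * m\<close>, and
        \<open>2 * m\<close> is the vertex 0; hence it contains the edges from 0 to a vertex beyond
        \<open>m\<close>.\<close>
      assume A: "u = 0 \<and> m < v \<or> m \<le> u"
      have ru: "(u + m) mod ?n = (if u = 0 then m else u - m)" "(v + m) mod ?n = v - m"
      proof -
        have hi: "(t + m) mod ?n = t - m" if "m \<le> t" "t < ?n" for t
        proof -
          have "t + m = (t - m) + ?n" using that by simp
          then show ?thesis using that by (metis mod_add_self2 mod_less less_imp_diff_less)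
        qed
        show "(u + m) mod ?n = (if u = 0 then m else u - m)" using hi[of u] A uv v m by auto
        show "(v + m) mod ?n = v - m" using hi[of v] A uv v by auto
      qed
      let ?x = "(\<lambda>i. (i + m) mod ?n) ` x"
      have xm: "?x = {(if u = 0 then m else u - m), v - m}" using uv ru by simp
      have "?x \<subseteq> {..m}" unfolding xm using uv v A by auto
      moreover have "?x \<noteq> {0, m}"
      proof
        assume "?x = {0, m}"
        then have "u = 0 \<and> v = m \<or> (u = m \<or> u = 0) \<and> v - m = m" unfolding xm using A uv v m
          by (auto simp: doubleton_eq_iff split: if_splits)
        then show False using A uv v m by auto
      qed
      ultimately have "?x \<in> M" using rG[OF x] by (simp add: M_def)
      then have "(\<lambda>i. (i + m) mod ?n) ` ?x \<in> rotate_graph ?n m M" unfolding rotate_graph_def by (rule imageI)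
      moreover have "(\<lambda>i. (i + m) mod ?n) ` ?x = x"
      proof -
        have "((t + m) mod ?n + m) mod ?n = t" if "t < ?n" for t
        proof -
          have "((t + m) mod ?n + m) mod ?n = (t + ?n) mod ?n" by (simp add: mod_add_left_eq mult_2 add.assoc)
          then show ?thesis using that by simp
        qed
        then show ?thesis using uv v by (simp add: image_image)
      qed
      ultimately show ?thesis by (simp add: double_def)
    qed
  next
    fix x assume "x \<in> double m M"
    then show "x \<in> G" using dG rG by (auto simp: double_def M_def rotate_graph_def)
  qed
  then show ?thesis using that[OF i(1) M] GF by simp
qed

lemma double_diam: "0 < m \<Longrightarrow> i < m \<Longrightarrow> {i, i + m} \<in> rotate_graph (2 * m) i (double m M)"
  using rotate_edge[of 0 m "double m M" i "2 * m"] by (simp add: double_def add.commute)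

lemma double_diam_set:
  assumes "M \<in> red_ncf 0 (Suc m) e" "0 < m" "i < m"
  shows "rotate_graph (2 * m) i (double m M) \<in> diam_set m (2 * e + 1)"
proof -
  have n0: "0 < 2 * m" using assms by simp
  have "rotate_graph (2 * m) m (rotate_graph (2 * m) i (double m M)) = rotate_graph (2 * m) i (rotate_graph (2 * m) m (double m M))"
    by (simp add: rotate_rotate add.commute)
  then show ?thesis
    using rotate_ncf[OF double_ncf(1)[OF assms(1,2)] n0] double_ncf(3)[OF assms(1,2)] double_diam[OF assms(2,3)] assms(3)
    by (auto simp: diam_set_def)
qed

text \<open>Two different diameters cross, so \<open>i\<close> is determined by the forest; undoing
  the rotation then recovers \<open>M\<close>.\<close>

lemma bij_diam_set:
  assumes m: "0 < m"
  shows "bij_betw (\<lambda>(i, M). rotate_graph (2 * m) i (double m M)) ({..<m} \<times> red_ncf 0 (Suc m) e) (diam_set m (2 * e + 1))"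
proof (rule bij_betw_imageI)
  let ?n = "2 * m"
  have n0: "0 < ?n" using m by simp
  show "inj_on (\<lambda>(i, M). rotate_graph ?n i (double m M)) ({..<m} \<times> red_ncf 0 (Suc m) e)"
  proof (rule inj_onI, clarify)
    fix i M j M'
    assume ij: "i < m" "j < m" and M: "M \<in> red_ncf 0 (Suc m) e" "M' \<in> red_ncf 0 (Suc m) e"
      and eq: "rotate_graph ?n i (double m M) = rotate_graph ?n j (double m M')"
    let ?F = "rotate_graph ?n i (double m M)"
    have nc: "non_crossing ?F" using ncf_non_crossing[OF rotate_ncf[OF double_ncf(1)[OF M(1) m] n0]] .
    have e: "{i, i + m} \<in> ?F" "{j, j + m} \<in> ?F"
      using double_diam[OF m ij(1), of M] double_diam[OF m ij(2), of M'] eq by simp_all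
    have "\<not> i < j"
    proof
      assume "i < j"
      then have "i < j \<and> j < i + m \<and> i + m < j + m" using ij by simp
      then show False using nc e unfolding non_crossing_def by blast
    qed
    moreover have "\<not> j < i"
    proof
      assume "j < i"
      then have "j < i \<and> i < j + m \<and> j + m < i + m" using ij by simp
      then show False using nc e unfolding non_crossing_def by blast
    qed
    ultimately have ij': "i = j" by simp
    have Dn: "\<And>x M. M \<in> red_ncf 0 (Suc m) e \<Longrightarrow> x \<in> double m M \<Longrightarrow> x \<subseteq> {0..<?n}"
      using ncf_edge(1)[OF double_ncf(1)[OF _ m]] by blast
    have "i \<le> ?n" using ij by simp
    then have "double m M = double m M'"
      using rotate_inverse(2)[of "double m M" ?n i] rotate_inverse(2)[of "double m M'" ?n i] Dn M eq ij' by metis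
    then have "M = M'" using double_ncf(2)[OF M(1) m] double_ncf(2)[OF M(2) m] by metis
    then show "i = j \<and> M = M'" using ij' by simp
  qed
  show "(\<lambda>(i, M). rotate_graph ?n i (double m M)) ` ({..<m} \<times> red_ncf 0 (Suc m) e) = diam_set m (2 * e + 1)"
  proof (intro equalityI subsetI)
    fix F assume "F \<in> (\<lambda>(i, M). rotate_graph ?n i (double m M)) ` ({..<m} \<times> red_ncf 0 (Suc m) e)"
    then show "F \<in> diam_set m (2 * e + 1)" using double_diam_set[OF _ m] by auto
  next
    fix F assume F: "F \<in> diam_set m (2 * e + 1)"
    obtain i M where iM: "i < m" "M \<in> red_ncf 0 (Suc m) (card M)" "F = rotate_graph ?n i (double m M)"
      by (rule diam_decompose[OF F m])
    have "F \<in> diam_set m (2 * card M + 1)" using double_diam_set[OF iM(2) m iM(1)] iM(3) by simp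
    then have "2 * card M + 1 = 2 * e + 1" using F by (auto simp: diam_set_def ncf_def)
    then show "F \<in> (\<lambda>(i, M). rotate_graph ?n i (double m M)) ` ({..<m} \<times> red_ncf 0 (Suc m) e)"
      using iM by (intro image_eqI[of _ _ "(i, M)"]) auto
  qed
qed

lemma card_diam_set: "0 < m \<Longrightarrow> card (diam_set m (2 * e + 1)) = m * card (red_ncf 0 (Suc m) e)"
  using bij_betw_same_card[OF bij_diam_set] by (metis card_cartesian_product card_lessThan)

lemma diam_set_even:
  assumes m: "0 < m" and f: "even f"
  shows "diam_set m f = {}"
proof (rule ccontr)
  assume "diam_set m f \<noteq> {}"
  then obtain F where F: "F \<in> diam_set m f" by blast
  obtain i M where iM: "i < m" "M \<in> red_ncf 0 (Suc m) (card M)" "F = rotate_graph (2 * m) i (double m M)"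
    by (rule diam_decompose[OF F m])
  have "F \<in> diam_set m (2 * card M + 1)" using double_diam_set[OF iM(2) m iM(1)] iM(3) by simp
  then have "2 * card M + 1 = f" using F by (auto simp: diam_set_def ncf_def)
  then show False using f by auto
qed

section \<open>Cyclic sieving\<close>

lemma nc_forests_eq_ncf:
  assumes "k \<le> n"
  shows "nc_forests n k = ncf 0 n (n - k)"
proof (intro equalityI subsetI)
  fix F assume "F \<in> nc_forests n k"
  then have F: "\<And>x. x \<in> F \<Longrightarrow> x \<subseteq> {0..<n} \<and> card x = 2" "non_crossing F" "\<not> has_cycle F" "num_components n F = k"
    by (auto simp: nc_forests_def is_graph_def)
  have fin: "finite F" by (rule finite_subset[of _ "Pow {0..<n}"]) (use F(1) in auto)
  have ac: "acyc F" using acyc_if_not_has_cycle[OF F(3)] F(1) by blast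
  have "card F + k = n"
    using acyc_card_components[OF fin _ F(1) ac] F(4) by (simp add: num_components_def)
  then show "F \<in> ncf 0 n (n - k)" using F ac by (auto simp: ncf_def)
next
  fix F assume F: "F \<in> ncf 0 n (n - k)"
  have e: "\<And>x. x \<in> F \<Longrightarrow> x \<subseteq> {0..<n} \<and> card x = 2" using ncf_edge[OF F] by blast
  have "card F + num_components n F = n"
    using acyc_card_components[OF ncf_finite[OF F] _ e ncf_acyc[OF F]] by (simp add: num_components_def)
  then have "num_components n F = k" using ncf_card[OF F] assms by simp
  then show "F \<in> nc_forests n k"
    using e ncf_non_crossing[OF F] not_has_cycle_if_acyc[OF ncf_acyc[OF F]] by (auto simp: nc_forests_def is_graph_def)
qed

lemma rotate_iterate:
  assumes "\<And>x. x \<in> F \<Longrightarrow> x \<subseteq> {0..<n}" "rotate_graph n a F = F"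
  shows "rotate_graph n (a * t) F = F"
proof (induction t)
  case 0
  then show ?case using rotate_multiple[of F n 0] assms(1) by simp
next
  case (Suc t)
  then show ?case using assms(2) rotate_rotate[of n a "a * t" F] by simp
qed

text \<open>By Bezout, rotation by \<open>j\<close> and by \<open>gcd n j\<close> generate the same
  group, so it is enough to treat rotations by divisors of \<open>n\<close>.\<close>

lemma rotate_gcd:
  assumes Fn: "\<And>x. x \<in> F \<Longrightarrow> x \<subseteq> {0..<n}"
  shows "rotate_graph n j F = F \<longleftrightarrow> rotate_graph n (gcd n j) F = F"
proof
  assume A: "rotate_graph n j F = F"
  show "rotate_graph n (gcd n j) F = F"
  proof (cases "j = 0")
    case True
    then show ?thesis using rotate_multiple[of F n 1] Fn by simp
  next
    case False
    obtain x y where xy: "j * x = n * y + gcd j n" using bezout_nat[OF False] by blast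
    have "rotate_graph n (gcd n j + n * y) F = F"
      using rotate_iterate[OF Fn A, of x] xy by (simp add: add.commute gcd.commute)
    then show ?thesis using rotate_multiple[of F n y] Fn by (simp flip: rotate_rotate)
  qed
next
  assume A: "rotate_graph n (gcd n j) F = F"
  obtain t where "j = gcd n j * t" using gcd_dvd2 by blast
  then show "rotate_graph n j F = F" using rotate_iterate[OF Fn A, of t] by simp
qed

text \<open>With \<open>e = n - k\<close> this is the right-hand side of
  \<open>forest_q_1\<close>.\<close>

lemma num_ncf_formula:
  assumes n: "0 < n"
  shows "num_ncf n e * (n + e) = (n choose Suc e) * ((n + 2 * e - 1) choose e)"
proof -
  define N where "N = n + 2 * e"
  have N0: "0 < N" using n by (simp add: N_def)
  have 1: "real (Suc e) * real (Suc n choose Suc e) = real (Suc n) * real (n choose e)"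
    using Suc_times_binomial_eq[of n e] by (metis of_nat_mult mult.commute)
  have 2: "real (Suc e) * real (n choose Suc e) = (real n - real e) * real (n choose e)"
  proof (cases "e \<le> n")
    case True
    have "Suc e * (n choose Suc e) = (n - e) * (n choose e)"
      using binomial_absorption[of e n] binomial_absorb_comp[of n e] by simp
    then show ?thesis using True by (metis of_nat_diff of_nat_mult)
  next
    case False
    then show ?thesis by (simp add: binomial_eq_0)
  qed
  have "(N - e) * (N choose e) = N * ((N - 1) choose e)" by (rule binomial_absorb_comp)
  moreover have "N - e = n + e" by (simp add: N_def)
  ultimately have 3: "real (n + e) * real (N choose e) = real N * real ((N - 1) choose e)"
    by (metis of_nat_mult)
  have "(real n - real e) * (real (Suc n choose Suc e) / real (Suc n)) = real (n choose Suc e)"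
  proof -
    have "real (Suc n choose Suc e) / real (Suc n) = real (n choose e) / real (Suc e)"
      using 1 by (simp add: field_simps del: of_nat_Suc binomial_Suc_Suc)
    moreover have "(real n - real e) * (real (n choose e) / real (Suc e)) = real (n choose Suc e)"
      using 2 by (simp add: field_simps del: of_nat_Suc)
    ultimately show ?thesis by simp
  qed
  note 4 = this
  have "real (num_ncf n e) = (real n - real e) * (real (Suc n choose Suc e) / real (Suc n)) * (real (N choose e) / real N)"
    unfolding num_ncf_closed[OF n] gf.lagrange_coeff_def by (simp add: N_def del: binomial_Suc_Suc)
  then have "real (num_ncf n e) * real (n + e) = real (n choose Suc e) * (real (n + e) * real (N choose e) / real N)"
    unfolding 4 by simp
  also have "\<dots> = real (n choose Suc e) * real ((N - 1) choose e)"
    unfolding 3 using N0 by simp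
  finally show ?thesis unfolding N_def by (metis of_nat_eq_iff of_nat_mult)
qed

text \<open>With \<open>e = m - a\<close> this is the value in \<open>forest_q_root_dvd\<close>, up
  to the symmetry of the first binomial.\<close>

lemma num_ncf_sym_formula:
  assumes m: "0 < m"
  shows "real (Suc e * num_ncf m e) = real ((m - 1) choose e) *
    (real ((m + 2 * e - 1) choose e) - real (if 0 < e then (m + 2 * e - 1) choose (e - 1) else 0))"
proof -
  define X where "X = m + 2 * e - 1"
  define c where "c = (if 0 < e then X choose (e - 1) else 0)"
  have "real e * real (X choose e) = real (m + e) * real c"
  proof (cases e)
    case (Suc f)
    have "Suc f * (X choose Suc f) = (X - f) * (X choose f)"
      using binomial_absorption[of f X] binomial_absorb_comp[of X f] by simp
    moreover have "X - f = m + e" using Suc m by (simp add: X_def)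
    ultimately have "Suc f * (X choose Suc f) = (m + e) * (X choose f)" by simp
    then have "real (Suc f) * real (X choose Suc f) = real (m + e) * real (X choose f)"
      by (simp only: of_nat_mult[symmetric])
    then show ?thesis using Suc by (simp add: c_def)
  qed (simp add: c_def)
  then have 3: "(real (X choose e) - real c) * real (m + e) = real m * real (X choose e)"
    by (simp add: algebra_simps)
  have "Suc e * (m choose Suc e) = m * ((m - 1) choose e)" by (rule binomial_absorption)
  then have 2: "(Suc e * num_ncf m e) * (m + e) = m * ((m - 1) choose e) * (X choose e)"
    using num_ncf_formula[OF m, of e] unfolding X_def by (simp only: mult.assoc) (simp only: mult.assoc[symmetric])
  then have "real (Suc e * num_ncf m e) * real (m + e) = real m * real ((m - 1) choose e) * real (X choose e)"
    by (simp only: of_nat_mult[symmetric])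
  also have "\<dots> = (real ((m - 1) choose e) * (real (X choose e) - real c)) * real (m + e)"
    unfolding mult.assoc 3 by simp
  finally have "real (Suc e * num_ncf m e) = real ((m - 1) choose e) * (real (X choose e) - real c)"
    using m by (simp del: of_nat_mult of_nat_Suc)
  then show ?thesis unfolding c_def X_def .
qed

text \<open>With \<open>e = m - a - 1\<close> this is the value in
  \<open>forest_q_root_2_odd\<close>, up to the symmetry of the first binomial.\<close>

lemma red_ncf_formula:
  assumes m: "0 < m"
  shows "m * card (red_ncf 0 (Suc m) e) = (m choose Suc e) * ((m + 2 * e) choose e)"
proof -
  define N where "N = m + 1 + 2 * e"
  obtain i where i: "m = Suc i" using m gr0_implies_Suc by blast
  have "(N - e) * (N choose e) = N * ((N - 1) choose e)" by (rule binomial_absorb_comp)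
  moreover have "N - e = m + 1 + e" "N - 1 = m + 2 * e" by (simp_all add: N_def)
  ultimately have 1: "real (m + 1 + e) * real (N choose e) = real N * real ((m + 2 * e) choose e)"
    by (metis of_nat_mult)
  have eN: "2 + (m - 1) + 2 * e = N" "m - 1 + 1 = m" "e + 1 = Suc e" using m by (simp_all add: N_def)
  have "real (card (red_ncf 0 (Suc m) e)) = real (m + 1 + e) * real (m choose Suc e) * real (N choose e) / (real m * real N)"
    unfolding card_red_ncf_closed[OF m] gf.lagrange_coeff_def eN by (simp add: i del: binomial_Suc_Suc)
  then have "real m * real (card (red_ncf 0 (Suc m) e)) = real (m choose Suc e) * (real (m + 1 + e) * real (N choose e) / real N)"
    using m by simp
  also have "\<dots> = real (m choose Suc e) * real ((m + 2 * e) choose e)"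
    unfolding 1 by (simp add: N_def)
  finally show ?thesis by (metis of_nat_eq_iff of_nat_mult)
qed

lemma joined_diameter:
  assumes F: "F \<in> ncf 0 (2 * m) f" and m: "0 < m"
  shows "(\<exists>x. joined (2 * m) F x (x + int m)) \<longleftrightarrow> (\<exists>i<m. {i, i + m} \<in> F)"
proof
  assume "\<exists>x. joined (2 * m) F x (x + int m)"
  then obtain x where x: "joined (2 * m) F x (x + int m)" by blast
  let ?n = "int (2 * m)"
  have n0: "0 < ?n" using m by simp
  define u where "u = nat (x mod ?n)"
  have u: "u < 2 * m" "int u = x mod ?n" using n0 by (auto simp: u_def nat_less_iff)
  have "(x + int m) mod ?n = int ((u + m) mod (2 * m))"
    using u(2) by (simp add: zmod_int mod_add_left_eq)
  then have e: "{u, (u + m) mod (2 * m)} \<in> F" using x unfolding joined_def u_def by simp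
  show "\<exists>i<m. {i, i + m} \<in> F"
  proof (cases "u < m")
    case True
    then show ?thesis using e by (intro exI[of _ u]) simp
  next
    case False
    have "u + m = (u - m) + 2 * m" using False by simp
    then have "(u + m) mod (2 * m) = u - m" using u(1) by (metis mod_add_self2 mod_less less_imp_diff_less)
    then have "{u - m, (u - m) + m} \<in> F" using e False by (simp add: insert_commute)
    moreover have "u - m < m" using u(1) False by simp
    ultimately show ?thesis by blast
  qed
next
  assume "\<exists>i<m. {i, i + m} \<in> F"
  then obtain i where i: "i < m" "{i, i + m} \<in> F" by blast
  then have "joined (2 * m) F (int i) (int (i + m))" by (subst joined_nat) auto
  then show "\<exists>x. joined (2 * m) F x (x + int m)" by auto
qed

lemma fixed_forests_2:
  assumes m: "0 < m"
  shows "{F \<in> ncf 0 (2 * m) f. rotate_graph (2 * m) m F = F} = sym_set (2 * m) m f \<union> diam_set m f"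
    and "sym_set (2 * m) m f \<inter> diam_set m f = {}"
  using joined_diameter[OF _ m] by (auto simp: sym_set_def diam_set_def)

lemma fixed_forests_3:
  assumes m: "0 < m" and d: "3 \<le> d"
  shows "{F \<in> ncf 0 (d * m) f. rotate_graph (d * m) m F = F} = sym_set (d * m) m f"
proof -
  have "\<not> joined (d * m) F x (x + int m)" if F: "F \<in> ncf 0 (d * m) f" and s: "rotate_graph (d * m) m F = F" for F x
  proof (rule acyc_no_polygon[OF F refl m d])
    fix x y assume "joined (d * m) F x y"
    moreover have "0 < d * m" using m d by simp
    ultimately show "joined (d * m) F (x + int m) (y + int m)"
      using joined_rotate[of "d * m" F m "x + int m" "y + int m"] ncf_edge(1)[OF F] s by simp
  qed
  then show ?thesis by (auto simp: sym_set_def)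
qed

text \<open>For \<open>d = 2\<close> the number of edges is even, whereas a forest with a diameter
  has an odd number; so only \<open>sym_set\<close> contributes.\<close>

lemma card_fixed_dvd:
  assumes m: "0 < m" and d: "2 \<le> d"
  shows "card {F \<in> ncf 0 (d * m) (d * e). rotate_graph (d * m) m F = F} = Suc e * num_ncf m e"
proof (cases "d = 2")
  case True
  then show ?thesis
    using fixed_forests_2[OF m, of "2 * e"] diam_set_even[OF m, of "2 * e"] card_sym_set[OF m d] sum_last_cut_num_ncf[OF m]
    by simp
next
  case False
  then show ?thesis
    using fixed_forests_3[OF m, of d] d card_sym_set[OF m d] sum_last_cut_num_ncf[OF m] by simp
qed

lemma card_fixed_not_dvd:
  assumes m: "0 < m" and d: "2 \<le> d" and f: "\<not> d dvd f" "\<not> (d = 2 \<and> odd f)"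
  shows "card {F \<in> ncf 0 (d * m) f. rotate_graph (d * m) m F = F} = 0"
proof -
  have "d \<noteq> 2" using f by auto
  then show ?thesis using fixed_forests_3[OF m, of d] d sym_set_not_dvd[OF m d f(1)] by simp
qed

lemma card_fixed_2_odd:
  assumes m: "0 < m"
  shows "card {F \<in> ncf 0 (2 * m) (2 * e + 1). rotate_graph (2 * m) m F = F} = m * card (red_ncf 0 (Suc m) e)"
  using fixed_forests_2[OF m, of "2 * e + 1"] sym_set_not_dvd[OF m, of 2 "2 * e + 1"] card_diam_set[OF m]
  by simp

text \<open>The cases are the identity; rotations with \<open>d\<close> dividing \<open>k\<close>;
  half turns with \<open>k\<close> odd, where exactly the forests with a diameter are fixed; and the
  rest, where both sides vanish.\<close>

lemma forest_q_eq_card: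
  fixes \<omega> :: complex
  assumes k: "1 \<le> k" "k \<le> d * m" and m: "0 < m" and \<omega>: "primitive_root d \<omega>"
  shows "forest_q \<omega> (d * m) k
    = of_nat (card {F \<in> ncf 0 (d * m) (d * m - k). rotate_graph (d * m) m F = F})"
proof -
  have d0: "0 < d" using \<omega> by (simp add: primitive_root_def)
  consider "d = 1" | "2 \<le> d" "d dvd k" | "2 \<le> d" "\<not> d dvd k" "d = 2 \<and> odd k" | "2 \<le> d" "\<not> d dvd k" "\<not> (d = 2 \<and> odd k)"
    using d0 by linarith
  then show ?thesis
  proof cases
    case 1
    then have w: "\<omega> = 1" using \<omega> by (simp add: primitive_root_def)
    have km: "k \<le> m" using k 1 by simp
    have "{F \<in> ncf 0 (d * m) (d * m - k). rotate_graph (d * m) m F = F} = ncf 0 m (m - k)"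
    proof -
      have "rotate_graph m m F = F" if "F \<in> ncf 0 m (m - k)" for F
        using rotate_multiple[of F m 1] ncf_edge(1)[OF that] by simp
      then show ?thesis using 1 by auto
    qed
    then have c: "card {F \<in> ncf 0 (d * m) (d * m - k). rotate_graph (d * m) m F = F} = num_ncf m (m - k)"
      by (simp add: num_ncf_def)
    have e: "m + (m - k) = 2 * m - k" "m + 2 * (m - k) - 1 = 3 * m - 2 * k - 1" using km by auto
    have ch: "m choose Suc (m - k) = m choose (k - 1)"
      using binomial_symmetric[of "k - 1" m] k km by (simp add: Suc_diff_le)
    have "num_ncf m (m - k) * (2 * m - k) = (m choose (k - 1)) * ((3 * m - 2 * k - 1) choose (m - k))"
      using num_ncf_formula[OF m, of "m - k"] unfolding e ch .
    then have "forest_q 1 m k * of_nat (2 * m - k) = of_nat (num_ncf m (m - k)) * (of_nat (2 * m - k) :: complex)"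
      using forest_q_1[OF k(1) km, where 'a = complex] by (metis of_nat_mult)
    moreover have "(of_nat (2 * m - k) :: complex) \<noteq> 0" unfolding of_nat_eq_0_iff using km m by simp
    ultimately show ?thesis unfolding c using w 1 by simp
  next
    case 2
    then obtain a where a: "k = d * a" by blast
    have a1: "1 \<le> a" using k a by (cases a) auto
    have am: "a \<le> m" using k(2) a d0 by simp
    define e where "e = m - a"
    have e: "d * m - k = d * e" using a by (simp add: e_def diff_mult_distrib2)
    have ee: "3 * m - 2 * a - 1 = m + 2 * e - 1" "m - a - 1 = e - 1" "a < m \<longleftrightarrow> 0 < e" "m - a = e"
      using am a1 by (auto simp: e_def)
    have ch: "(m - 1) choose (a - 1) = (m - 1) choose e"
      using binomial_symmetric[of "a - 1" "m - 1"] a1 am by (simp add: e_def)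
    have "forest_q \<omega> (d * m) k = of_real (real ((m - 1) choose e) *
       (real ((m + 2 * e - 1) choose e) - real (if 0 < e then (m + 2 * e - 1) choose (e - 1) else 0)))"
      unfolding a forest_q_root_dvd[OF \<omega> 2(1) a1 am] ee ch by simp
    then show ?thesis
      unfolding e card_fixed_dvd[OF m 2(1)] num_ncf_sym_formula[OF m, symmetric] by simp
  next
    case 3
    then obtain a where a: "k = 2 * a + 1" by (auto elim: oddE)
    have d2: "d = 2" using 3 by simp
    have am: "a < m" using k a d2 by simp
    define e where "e = m - a - 1"
    have e: "2 * m - (2 * a + 1) = 2 * e + 1" "3 * m - 2 * a - 2 = m + 2 * e" using am by (auto simp: e_def)
    have ch: "m choose a = m choose Suc e"
      using binomial_symmetric[of a m] am by (simp add: e_def Suc_diff_Suc)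
    have \<omega>2: "primitive_root 2 \<omega>" using \<omega> d2 by simp
    have "forest_q \<omega> (2 * m) (2 * a + 1) = of_nat ((m choose Suc e) * ((m + 2 * e) choose e))"
      unfolding forest_q_root_2_odd[OF \<omega>2 am] e ch e_def[symmetric] ..
    also have "\<dots> = of_nat (card {F \<in> ncf 0 (2 * m) (2 * e + 1). rotate_graph (2 * m) m F = F})"
      unfolding card_fixed_2_odd[OF m] red_ncf_formula[OF m] ..
    finally show ?thesis unfolding d2 a e(1) .
  next
    case 4
    have nd: "\<not> d dvd d * m - k"
    proof
      assume "d dvd d * m - k"
      then have "d dvd d * m - (d * m - k)" by (rule dvd_diff_nat[rotated]) simp
      then show False using 4(2) k(2) by simp
    qed
    have "\<not> (d = 2 \<and> odd (d * m - k))" using 4(2,3) by auto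
    then show ?thesis
      using forest_q_root_not_dvd[OF \<omega> k 4(2,3)] card_fixed_not_dvd[OF m 4(1) nd] by simp
  qed
qed

text \<open>The fraction is stated by cross-multiplication with \<open>qint (2*n - k)\<close>, a
  nonzero polynomial, so \<open>P\<close> is determined; \<open>n div gcd n j\<close> is the order
  of the rotation by \<open>j\<close>.\<close>

theorem theorem1p3:
  fixes n k :: nat
  assumes "1 \<le> n" and "1 \<le> k" and "k \<le> n"
  shows "\<exists>P :: int poly.
           (\<forall>i. coeff P i \<ge> 0) \<and>
           map_poly of_int P * (qint (2*n - k) :: rat poly)
             = qbinom n (k - 1) * qbinom (3*n - 2*k - 1) (n - k) \<and>
           (\<forall>j < n. \<forall>\<omega> :: complex.
              (let d = n div gcd n j in
                 \<omega> ^ d = 1 \<and> (\<forall>m. 0 < m \<and> m < d \<longrightarrow> \<omega> ^ m \<noteq> 1) \<longrightarrow>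
                 poly (map_poly of_int P) \<omega>
                   = of_nat (card {F \<in> nc_forests n k. rotate_graph n j F = F})))"
proof (intro exI[of _ "forest_q (monom 1 1) n k"] conjI allI impI)
  let ?P = "forest_q (monom 1 1) n k :: int poly"
  show "0 \<le> coeff ?P i" for i by (rule forest_q_nonneg[OF assms(2,3)])
  have "map_poly of_int ?P = (forest_q (map_poly of_int (monom 1 1)) n k :: rat poly)"
    by (rule forest_q_hom) (simp_all add: map_poly_of_int_add map_poly_of_int_mult)
  then show "map_poly of_int ?P * (qint (2*n - k) :: rat poly)
      = qbinom n (k - 1) * qbinom (3*n - 2*k - 1) (n - k)"
    using forest_q_mult[OF assms(2,3), of "monom (1::rat) 1"]
    by (simp add: qint_eq_qn qbinom_eq_gauss map_poly_monom)
  fix j :: nat and \<omega> :: complex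
  assume "j < n"
  show "let d = n div gcd n j in
       \<omega> ^ d = 1 \<and> (\<forall>m. 0 < m \<and> m < d \<longrightarrow> \<omega> ^ m \<noteq> 1) \<longrightarrow>
       poly (map_poly of_int ?P) \<omega> = of_nat (card {F \<in> nc_forests n k. rotate_graph n j F = F})"
    unfolding Let_def
  proof
    define m where "m = gcd n j"
    define d where "d = n div m"
    have m0: "0 < m" using assms(1) by (simp add: m_def)
    have n: "n = d * m" by (simp add: d_def m_def)
    assume "\<omega> ^ (n div gcd n j) = 1 \<and> (\<forall>m. 0 < m \<and> m < n div gcd n j \<longrightarrow> \<omega> ^ m \<noteq> 1)"
    then have \<omega>: "\<omega> ^ d = 1" "\<forall>m. 0 < m \<and> m < d \<longrightarrow> \<omega> ^ m \<noteq> 1" unfolding d_def m_def by auto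
    have d0: "0 < d" using n assms(1) by (cases d) auto
    have prim: "primitive_root d \<omega>" using \<omega> d0 by (simp add: primitive_root_def)
    have "poly (map_poly of_int ?P) \<omega> = forest_q (poly (map_poly of_int (monom 1 1)) \<omega>) n k"
      by (rule forest_q_hom[where h = "\<lambda>p. poly (map_poly of_int p) \<omega>"])
        (simp_all add: map_poly_of_int_add map_poly_of_int_mult)
    also have "poly (map_poly of_int (monom 1 1)) \<omega> = \<omega>"
      by (simp add: map_poly_monom poly_monom)
    also have "forest_q \<omega> n k = of_nat (card {F \<in> ncf 0 n (n - k). rotate_graph n m F = F})"
      using forest_q_eq_card[OF assms(2) _ m0 prim] assms(3) n by simp
    also have "{F \<in> ncf 0 n (n - k). rotate_graph n m F = F} = {F \<in> nc_forests n k. rotate_graph n j F = F}"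
    proof -
      have "rotate_graph n m F = F \<longleftrightarrow> rotate_graph n j F = F" if "F \<in> ncf 0 n (n - k)" for F
        unfolding m_def by (rule rotate_gcd[symmetric]) (rule ncf_edge(1)[OF that])
      then show ?thesis unfolding nc_forests_eq_ncf[OF assms(3)] by auto
    qed
    finally show "poly (map_poly of_int ?P) \<omega> = of_nat (card {F \<in> nc_forests n k. rotate_graph n j F = F})" .
  qed
qed

end
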